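(* Let $n\ge 2$ be an integer, let $\psi\in C(\overline{\mathbb{D}^n})$, and for $q\in b\mathbb{D}$ let $\psi_q(z')=\psi(z',q)$ for $z'\in\mathbb{D}^{n-1}$. Assume that the function $q\mapsto\|H^{\mathbb{D}^{n-1}}_{\psi_q}\|$ (operator norm) is non-constant on $b\mathbb{D}$. Then the essential spectrum of $H_\psi^*H_\psi$ on $A^2(\mathbb{D}^n)$ contains an open interval.
   Context: $\mathbb{D}$ is the open unit disc in $\mathbb{C}$ and $b\mathbb{D}$ is its boundary, the unit circle. For a bounded domain $\Omega\subset\mathbb{C}^d$, $A^2(\Omega)$ is the Bergman space of holomorphic functions on $\Omega$ that are square integrable with respect to Lebesgue measure, and $P^\Omega:L^2(\Omega)\to A^2(\Omega)$ is the orthogonal (Bergman) projection. For a bounded measurable function $\psi$ on $\Omega$ the Hankel operator $H_\psi^\Omega:A^2(\Omega)\to L^2(\Omega)$ is $H_\psi^\Omega f=(I-P^\Omega)(\psi f)$; $(H_\psi^\Omega)^*$ is its Hilbert space adjoint, so $(H_\psi^\Omega)^*H_\psi^\Omega$ is a bounded self-adjoint operator on $A^2(\Omega)$. Here $H_\psi$ means $H_\psi^{\mathbb{D}^n}$. $\sigma(T)$ denotes the spectrum of $T$; the discrete spectrum $\sigma_d(T)$ is the set of eigenvalues of finite (algebraic) multiplicity that are isolated points of $\sigma(T)$; the essential spectrum is $\sigma_e(T)=\sigma(T)\setminus\sigma_d(T)$. "Open interval" means a nonempty open interval of the real line. *)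

theory Defs
  imports "HOL-Complex_Analysis.Complex_Analysis"
begin

subsection \<open>Polydiscs and holomorphic functions of several variables\<close>

definition polydisc :: "(complex ^ 'k) set" where
  "polydisc = {z. \<forall>i. z $ i \<in> ball 0 1}"

text \<open>
  The point \<open>(z', q)\<close>. The coordinates of the larger space are indexed by \<^typ>\<open>'m option\<close>,
  with \<^term>\<open>None\<close> the index of the last coordinate, so its dimension is \<open>CARD('m) + 1 \<ge> 2\<close>.
\<close>

definition append_coord :: "complex ^ 'm \<Rightarrow> complex \<Rightarrow> complex ^ ('m::finite) option" where
  "append_coord z q = (\<chi> i. case i of Some j \<Rightarrow> z $ j | None \<Rightarrow> q)"

text \<open>Frechet differentiable with complex-linear derivative.\<close>

definition holomorphic_vec_on :: "(complex ^ 'k \<Rightarrow> complex) \<Rightarrow> (complex ^ 'k) set \<Rightarrow> bool" where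
  "holomorphic_vec_on f \<Omega> \<longleftrightarrow>
     (\<forall>z\<in>\<Omega>. \<exists>L. (f has_derivative L) (at z) \<and> (\<forall>c v. L (c *s v) = c * L v))"


subsection \<open>Bergman spaces and Hankel operators\<close>

definition square_integrable_on :: "(complex ^ 'k \<Rightarrow> complex) \<Rightarrow> (complex ^ 'k) set \<Rightarrow> bool" where
  "square_integrable_on f \<Omega> \<longleftrightarrow>
     f \<in> borel_measurable (lebesgue_on \<Omega>) \<and> integrable (lebesgue_on \<Omega>) (\<lambda>z. (cmod (f z))\<^sup>2)"

definition L2_inner ::
    "(complex ^ 'k) set \<Rightarrow> (complex ^ 'k \<Rightarrow> complex) \<Rightarrow> (complex ^ 'k \<Rightarrow> complex) \<Rightarrow> complex" where
  "L2_inner \<Omega> f g = (LINT z|lebesgue_on \<Omega>. f z * cnj (g z))"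

definition L2_norm_on :: "(complex ^ 'k) set \<Rightarrow> (complex ^ 'k \<Rightarrow> complex) \<Rightarrow> real" where
  "L2_norm_on \<Omega> f = sqrt (LINT z|lebesgue_on \<Omega>. (cmod (f z))\<^sup>2)"

text \<open>
  Functions on \<open>\<Omega>\<close> are represented by total functions that vanish off \<open>\<Omega>\<close>. For open \<open>\<Omega>\<close>, two
  elements of the Bergman space that agree almost everywhere on \<open>\<Omega>\<close> are then equal, so no quotient
  is needed, and the definite descriptions below denote unique elements.
\<close>

definition bergman_space :: "(complex ^ 'k) set \<Rightarrow> (complex ^ 'k \<Rightarrow> complex) set" where
  "bergman_space \<Omega> =
     {f. holomorphic_vec_on f \<Omega> \<and> square_integrable_on f \<Omega> \<and> (\<forall>z. z \<notin> \<Omega> \<longrightarrow> f z = 0)}"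

definition bergman_proj ::
    "(complex ^ 'k) set \<Rightarrow> (complex ^ 'k \<Rightarrow> complex) \<Rightarrow> complex ^ 'k \<Rightarrow> complex" where
  "bergman_proj \<Omega> f =
     (THE g. g \<in> bergman_space \<Omega> \<and>
             (\<forall>h\<in>bergman_space \<Omega>. L2_inner \<Omega> (\<lambda>z. f z - g z) h = 0))"

definition hankel ::
    "(complex ^ 'k) set \<Rightarrow> (complex ^ 'k \<Rightarrow> complex) \<Rightarrow> (complex ^ 'k \<Rightarrow> complex)
       \<Rightarrow> complex ^ 'k \<Rightarrow> complex" where
  "hankel \<Omega> \<psi> f = (\<lambda>z. \<psi> z * f z - bergman_proj \<Omega> (\<lambda>w. \<psi> w * f w) z)"

definition hankel_norm :: "(complex ^ 'k) set \<Rightarrow> (complex ^ 'k \<Rightarrow> complex) \<Rightarrow> real" where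
  "hankel_norm \<Omega> \<psi> =
     Sup {L2_norm_on \<Omega> (hankel \<Omega> \<psi> f) | f. f \<in> bergman_space \<Omega> \<and> L2_norm_on \<Omega> f \<le> 1}"

definition hankel_adjoint ::
    "(complex ^ 'k) set \<Rightarrow> (complex ^ 'k \<Rightarrow> complex) \<Rightarrow> (complex ^ 'k \<Rightarrow> complex)
       \<Rightarrow> complex ^ 'k \<Rightarrow> complex" where
  "hankel_adjoint \<Omega> \<psi> g =
     (THE h. h \<in> bergman_space \<Omega> \<and>
             (\<forall>f\<in>bergman_space \<Omega>. L2_inner \<Omega> (hankel \<Omega> \<psi> f) g = L2_inner \<Omega> f h))"


subsection \<open>Spectra of operators on a normed space of functions\<close>

text \<open>
  Here \<open>V\<close> is a complex vector space of functions, \<open>N\<close> a norm on \<open>V\<close> and \<open>T\<close> a linear map from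
  \<open>V\<close> to \<open>V\<close>; values of \<open>T\<close> off \<open>V\<close> are irrelevant.
\<close>

definition bounded_operator_on ::
    "(('a \<Rightarrow> complex) \<Rightarrow> real) \<Rightarrow> ('a \<Rightarrow> complex) set
       \<Rightarrow> (('a \<Rightarrow> complex) \<Rightarrow> 'a \<Rightarrow> complex) \<Rightarrow> bool" where
  "bounded_operator_on N V S \<longleftrightarrow>
     (\<forall>f\<in>V. S f \<in> V) \<and>
     (\<forall>f\<in>V. \<forall>g\<in>V. S (\<lambda>x. f x + g x) = (\<lambda>x. S f x + S g x)) \<and>
     (\<forall>c. \<forall>f\<in>V. S (\<lambda>x. c * f x) = (\<lambda>x. c * S f x)) \<and>
     (\<exists>C. \<forall>f\<in>V. N (S f) \<le> C * N f)"

definition shifted_operator ::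
    "(('a \<Rightarrow> complex) \<Rightarrow> 'a \<Rightarrow> complex) \<Rightarrow> complex \<Rightarrow> ('a \<Rightarrow> complex) \<Rightarrow> 'a \<Rightarrow> complex" where
  "shifted_operator T \<mu> f = (\<lambda>x. T f x - \<mu> * f x)"

definition spectrum_on ::
    "(('a \<Rightarrow> complex) \<Rightarrow> real) \<Rightarrow> ('a \<Rightarrow> complex) set
       \<Rightarrow> (('a \<Rightarrow> complex) \<Rightarrow> 'a \<Rightarrow> complex) \<Rightarrow> complex set" where
  "spectrum_on N V T =
     {\<mu>. \<not> (\<exists>S. bounded_operator_on N V S \<and>
               (\<forall>f\<in>V. S (shifted_operator T \<mu> f) = f \<and> shifted_operator T \<mu> (S f) = f))}"

definition eigenvalue_on ::
    "('a \<Rightarrow> complex) set \<Rightarrow> (('a \<Rightarrow> complex) \<Rightarrow> 'a \<Rightarrow> complex) \<Rightarrow> complex \<Rightarrow> bool" where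
  "eigenvalue_on V T \<mu> \<longleftrightarrow> (\<exists>f\<in>V. f \<noteq> (\<lambda>x. 0) \<and> T f = (\<lambda>x. \<mu> * f x))"

definition generalized_eigenspace_on ::
    "('a \<Rightarrow> complex) set \<Rightarrow> (('a \<Rightarrow> complex) \<Rightarrow> 'a \<Rightarrow> complex) \<Rightarrow> complex
       \<Rightarrow> ('a \<Rightarrow> complex) set" where
  "generalized_eigenspace_on V T \<mu> = {f\<in>V. \<exists>k. (shifted_operator T \<mu> ^^ k) f = (\<lambda>x. 0)}"

definition finite_dimensional_funs :: "('a \<Rightarrow> complex) set \<Rightarrow> bool" where
  "finite_dimensional_funs E \<longleftrightarrow>
     (\<exists>B. finite B \<and> B \<subseteq> E \<and> (\<forall>f\<in>E. \<exists>c. f = (\<lambda>x. \<Sum>b\<in>B. c b * b x)))"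

definition discrete_spectrum_on ::
    "(('a \<Rightarrow> complex) \<Rightarrow> real) \<Rightarrow> ('a \<Rightarrow> complex) set
       \<Rightarrow> (('a \<Rightarrow> complex) \<Rightarrow> 'a \<Rightarrow> complex) \<Rightarrow> complex set" where
  "discrete_spectrum_on N V T =
     {\<mu>. eigenvalue_on V T \<mu> \<and> finite_dimensional_funs (generalized_eigenspace_on V T \<mu>) \<and>
          \<mu> isolated_in spectrum_on N V T}"

definition essential_spectrum_on ::
    "(('a \<Rightarrow> complex) \<Rightarrow> real) \<Rightarrow> ('a \<Rightarrow> complex) set
       \<Rightarrow> (('a \<Rightarrow> complex) \<Rightarrow> 'a \<Rightarrow> complex) \<Rightarrow> complex set" where
  "essential_spectrum_on N V T = spectrum_on N V T - discrete_spectrum_on N V T"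

end

theory Submission
  imports Defs
begin

text \<open>
For \<open>q\<close> on the unit circle let \<open>s(q)\<close> be the norm of the Hankel operator \<open>H\<^sub>q\<close> on the
smaller polydisc whose symbol is the boundary slice \<open>\<psi>(\<cdot>, q)\<close>, and let \<open>T = H\<^sup>* H\<close> be the
operator on the full polydisc. The heart of the matter is that \<open>s(q)\<^sup>2\<close> lies in the spectrum of
\<open>T\<close> for every \<open>q\<close> (\<open>boundary_slice_norm_in_spectrum\<close>). The function \<open>s\<close> is continuous, since the norm of a
Hankel operator is 1-Lipschitz in the supremum norm of its symbol (\<open>hankel_norm_perturb\<close>), and it is
not constant; as the circle is connected, the numbers \<open>s(q)\<^sup>2\<close> fill a nondegenerate interval. A point
of an open interval that lies in the spectrum is not isolated in the spectrum, so it cannot belong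
to the discrete spectrum, and the whole interval is essential spectrum.

To see \<open>s(q)\<^sup>2\<close> in the spectrum, one constructs approximate eigenvectors of product form
\<open>f(z') k(w)\<close>. The factor \<open>k\<close> is a power of \<open>(1 + cnj q w) / 2\<close>, cut off outside the disc; its mass
concentrates at \<open>q\<close> as the exponent grows (\<open>peak_function\<close>). Against such a factor \<open>\<psi>(z', w)\<close> may be
replaced by \<open>\<psi>(z', q)\<close> with a small error in the mean square (\<open>peak_function_localizes_symbol\<close>), and the projection
of a product \<open>F(z') k(w)\<close> with holomorphic \<open>k\<close> acts on \<open>F\<close> alone. Hence \<open>H (f k)\<close> is close to
\<open>(H\<^sub>q f) k\<close>. The factor \<open>f\<close> nearly attains the norm \<open>s(q)\<close>. The form
\<open>s(q)\<^sup>2 \<langle>u, v\<rangle> - \<langle>H\<^sub>q u, H\<^sub>q v\<rangle>\<close> is positive semidefinite, so the Cauchy-Schwarz inequality for it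
turns near-maximality into the weak eigenvalue equation \<open>\<langle>H\<^sub>q u, H\<^sub>q f\<rangle> \<approx> s(q)\<^sup>2 \<langle>u, f\<rangle>\<close> for all \<open>u\<close>
(\<open>near_maximizer_weak_eigenvector\<close>). Integrating this with \<open>u = h(\<cdot>, w)\<close> against \<open>k(w)\<close> bounds
\<open>\<langle>h, (T - s(q)\<^sup>2) (f k)\<rangle>\<close> for every \<open>h\<close> in the Bergman space, in particular for
\<open>h = (T - s(q)\<^sup>2) (f k)\<close> (\<open>approximate_eigenvector\<close>).

Projections and adjoints are given by definite descriptions, so they must first be shown to exist.
The Bergman space is complete because point evaluations are bounded: a holomorphic function is
the average of its values over the circle \<open>z + e\<^bsup>it\<^esup> w\<close> for each small vector \<open>w\<close>, and
Lebesgue measure is invariant under the rotation \<open>w \<mapsto> e\<^bsup>it\<^esup> w\<close>. Restricting to complex lines in this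
way reduces all the function theory of several variables that is needed to that of one variable.
\<close>

section \<open>Square-integrable functions and orthogonal projection\<close>

text \<open>
The measure is a parameter here because three measures are in use: restricted Lebesgue measure on
\<open>\<Omega>\<close>, and the Borel measure \<open>lborel\<close> both on the plane and, for Fubini, on the whole spaces. Square
integrable functions are not identified almost everywhere, so \<open>norm_L2\<close> below is a seminorm.
\<close>

definition L2_fun :: "'a measure \<Rightarrow> ('a \<Rightarrow> complex) \<Rightarrow> bool" where
  "L2_fun M f \<longleftrightarrow> f \<in> borel_measurable M \<and> integrable M (\<lambda>x. (cmod (f x))\<^sup>2)"

definition inner_L2 :: "'a measure \<Rightarrow> ('a \<Rightarrow> complex) \<Rightarrow> ('a \<Rightarrow> complex) \<Rightarrow> complex" where
  "inner_L2 M f g = (LINT x|M. f x * cnj (g x))"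

definition norm_L2 :: "'a measure \<Rightarrow> ('a \<Rightarrow> complex) \<Rightarrow> real" where
  "norm_L2 M f = sqrt (LINT x|M. (cmod (f x))\<^sup>2)"

lemma L2_fun_measurable: "L2_fun M f \<Longrightarrow> f \<in> borel_measurable M"
  and L2_fun_integrable: "L2_fun M f \<Longrightarrow> integrable M (\<lambda>x. (cmod (f x))\<^sup>2)"
  by (auto simp: L2_fun_def)

lemma borel_measurable_cnj [measurable (raw)]:
  "f \<in> borel_measurable M \<Longrightarrow> (\<lambda>x. cnj (f x)) \<in> borel_measurable M"
  by (rule measurable_compose[where N=borel]) (auto intro: borel_measurable_continuous_onI continuous_intros)

lemma inner_L2_integrable:
  assumes "L2_fun M f" "L2_fun M g"
  shows "integrable M (\<lambda>x. f x * cnj (g x))"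
proof (rule Bochner_Integration.integrable_bound)
  show "integrable M (\<lambda>x. (cmod (f x))\<^sup>2 + (cmod (g x))\<^sup>2)"
    using assms by (auto simp: L2_fun_def)
  show "(\<lambda>x. f x * cnj (g x)) \<in> borel_measurable M"
    using assms by (auto simp: L2_fun_def intro!: borel_measurable_times borel_measurable_cnj)
  have "u * v \<le> u\<^sup>2 + v\<^sup>2" if "u \<ge> 0" "v \<ge> 0" for u v :: real
  proof -
    have "2 * (u * v) \<le> u\<^sup>2 + v\<^sup>2" using sum_squares_bound[of u v] by simp
    moreover have "u * v \<ge> 0" using that by simp
    ultimately show ?thesis by linarith
  qed
  then show "AE x in M. norm (f x * cnj (g x)) \<le> norm ((cmod (f x))\<^sup>2 + (cmod (g x))\<^sup>2)"
    by (auto simp: norm_mult)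
qed

lemma L2_fun_add_cmult:
  assumes "L2_fun M f" "L2_fun M g"
  shows "L2_fun M (\<lambda>x. f x + c * g x)"
proof -
  have eq: "(cmod (f x + c * g x))\<^sup>2
      = (cmod (f x))\<^sup>2 + 2 * Re (cnj c * (f x * cnj (g x))) + (cmod c)\<^sup>2 * (cmod (g x))\<^sup>2" for x
    unfolding cmod_power2 by (simp add: algebra_simps power2_eq_square)
  have "integrable M (\<lambda>x. Re (cnj c * (f x * cnj (g x))))"
    using inner_L2_integrable[OF assms] by (intro integrable_Re integrable_mult_right)
  then have "integrable M (\<lambda>x. (cmod (f x + c * g x))\<^sup>2)"
    unfolding eq using assms
    by (intro Bochner_Integration.integrable_add integrable_mult_right) (auto simp: L2_fun_def)
  then show ?thesis using assms by (auto simp: L2_fun_def)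
qed

lemma norm_L2_nonneg [simp]: "0 \<le> norm_L2 M f"
  by (simp add: norm_L2_def)

lemma norm_L2_sq: "(norm_L2 M f)\<^sup>2 = (LINT x|M. (cmod (f x))\<^sup>2)"
  by (simp add: norm_L2_def)

lemma inner_L2_self: "inner_L2 M f f = of_real ((norm_L2 M f)\<^sup>2)"
  unfolding norm_L2_sq inner_L2_def by (simp add: complex_norm_square[symmetric] del: of_real_power)

lemma norm_L2_sq_add_cmult:
  assumes "L2_fun M f" "L2_fun M g"
  shows "(norm_L2 M (\<lambda>x. f x + c * g x))\<^sup>2
    = (norm_L2 M f)\<^sup>2 + 2 * Re (cnj c * inner_L2 M f g) + (cmod c)\<^sup>2 * (norm_L2 M g)\<^sup>2"
proof -
  have eq: "(cmod (f x + c * g x))\<^sup>2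
      = (cmod (f x))\<^sup>2 + 2 * Re (cnj c * (f x * cnj (g x))) + (cmod c)\<^sup>2 * (cmod (g x))\<^sup>2" for x
    unfolding cmod_power2 by (simp add: algebra_simps power2_eq_square)
  have i: "integrable M (\<lambda>x. cnj c * (f x * cnj (g x)))"
    using inner_L2_integrable[OF assms] by (intro integrable_mult_right)
  show ?thesis
    unfolding norm_L2_sq eq inner_L2_def
    using assms i by (simp add: L2_fun_def integrable_Re integral_Re del: Re_complex_of_real times_complex.sel complex_cnj)
qed

lemma inner_L2_cnj: "cnj (inner_L2 M f g) = inner_L2 M g f"
  unfolding inner_L2_def by (subst Bochner_Integration.integral_cnj[symmetric]) (simp add: mult.commute)

lemma inner_L2_add_left:
  assumes "L2_fun M f" "L2_fun M g" "L2_fun M h"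
  shows "inner_L2 M (\<lambda>x. f x + c * g x) h = inner_L2 M f h + c * inner_L2 M g h"
  using inner_L2_integrable[OF assms(1,3)] inner_L2_integrable[OF assms(2,3)]
  unfolding inner_L2_def by (simp add: ring_distribs mult.assoc)

lemma inner_L2_add_right:
  assumes "L2_fun M f" "L2_fun M g" "L2_fun M h"
  shows "inner_L2 M h (\<lambda>x. f x + c * g x) = inner_L2 M h f + cnj c * inner_L2 M h g"
  using inner_L2_add_left[OF assms, of c] inner_L2_cnj[of M h] by (metis complex_cnj_add complex_cnj_cnj complex_cnj_mult)

lemma L2_fun_diff:
  assumes "L2_fun M f" "L2_fun M g" shows "L2_fun M (\<lambda>x. f x - g x)"
  using L2_fun_add_cmult[OF assms, of "-1"] by simp

lemma inner_L2_diff_left: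
  assumes "L2_fun M f" "L2_fun M g" "L2_fun M h"
  shows "inner_L2 M (\<lambda>x. f x - g x) h = inner_L2 M f h - inner_L2 M g h"
  using inner_L2_add_left[OF assms, of "-1"] by simp

lemma inner_L2_diff_right:
  assumes "L2_fun M f" "L2_fun M g" "L2_fun M h"
  shows "inner_L2 M h (\<lambda>x. f x - g x) = inner_L2 M h f - inner_L2 M h g"
  using inner_L2_add_right[OF assms, of "-1"] by simp

text \<open>
The algebraic core of the Cauchy-Schwarz inequality for a positive semidefinite Hermitian form: it
serves both the inner product itself and the form attached to a near-maximizer of a Hankel operator.
\<close>

lemma nonneg_quadratic_imp_discriminant:
  fixes z :: complex
  assumes "\<And>c. 0 \<le> a + 2 * Re (cnj c * z) + (cmod c)\<^sup>2 * b" and "0 \<le> b"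
  shows "(cmod z)\<^sup>2 \<le> a * b"
proof (cases "b = 0")
  case True
  have *: "2 * t * (cmod z)\<^sup>2 \<le> a" for t
  proof -
    have "Re (cnj (- of_real t * z) * z) = - t * (cmod z)\<^sup>2"
      unfolding cmod_power2 by (simp add: algebra_simps power2_eq_square)
    then show ?thesis using assms(1)[of "- of_real t * z"] True by simp
  qed
  have "z = 0"
  proof (rule ccontr)
    assume "z \<noteq> 0"
    then show False using *[of "(a + 1) / (2 * (cmod z)\<^sup>2)"] by simp
  qed
  then show ?thesis using True by simp
next
  case False
  then have b: "b > 0" using assms(2) by simp
  have "Re (cnj (- of_real (1/b) * z) * z) = - (1/b) * (cmod z)\<^sup>2"
    unfolding cmod_power2 by (simp add: algebra_simps power2_eq_square add_divide_distrib)
  moreover have "(cmod (- of_real (1/b) * z))\<^sup>2 * b = (1/b) * (cmod z)\<^sup>2"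
    using b by (simp add: norm_mult power_mult_distrib power2_eq_square norm_divide)
  ultimately have "0 \<le> a - (1/b) * (cmod z)\<^sup>2"
    using assms(1)[of "- of_real (1/b) * z"] by linarith
  then show ?thesis using b by (simp add: field_simps)
qed

lemma inner_L2_Cauchy_Schwarz:
  assumes "L2_fun M f" "L2_fun M g"
  shows "cmod (inner_L2 M f g) \<le> norm_L2 M f * norm_L2 M g"
proof -
  have "(cmod (inner_L2 M f g))\<^sup>2 \<le> (norm_L2 M f)\<^sup>2 * (norm_L2 M g)\<^sup>2"
    by (rule nonneg_quadratic_imp_discriminant) (simp_all flip: norm_L2_sq_add_cmult[OF assms] del: times_complex.sel)
  then show ?thesis
    by (metis norm_L2_nonneg mult_nonneg_nonneg power2_le_imp_le power_mult_distrib)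
qed

lemma norm_L2_triangle:
  assumes "L2_fun M f" "L2_fun M g"
  shows "norm_L2 M (\<lambda>x. f x + g x) \<le> norm_L2 M f + norm_L2 M g"
proof -
  have "(norm_L2 M (\<lambda>x. f x + g x))\<^sup>2 = (norm_L2 M f)\<^sup>2 + 2 * Re (inner_L2 M f g) + (norm_L2 M g)\<^sup>2"
    using norm_L2_sq_add_cmult[OF assms, of 1] by simp
  also have "\<dots> \<le> (norm_L2 M f)\<^sup>2 + 2 * (norm_L2 M f * norm_L2 M g) + (norm_L2 M g)\<^sup>2"
    using inner_L2_Cauchy_Schwarz[OF assms] complex_Re_le_cmod[of "inner_L2 M f g"] by linarith
  also have "\<dots> = (norm_L2 M f + norm_L2 M g)\<^sup>2" by (simp add: power2_sum)
  finally show ?thesis by (meson add_nonneg_nonneg norm_L2_nonneg power2_le_imp_le)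
qed

lemma norm_L2_cmult: "norm_L2 M (\<lambda>x. c * f x) = cmod c * norm_L2 M f"
  by (simp add: norm_L2_def norm_mult power_mult_distrib real_sqrt_mult)

lemma L2_fun_zero: "L2_fun M (\<lambda>x. 0)"
  by (simp add: L2_fun_def)

lemma norm_L2_diff_commute: "norm_L2 M (\<lambda>x. f x - g x) = norm_L2 M (\<lambda>x. g x - f x)"
  by (simp add: norm_L2_def norm_minus_commute)

lemma L2_fun_bounded_mult:
  assumes f: "L2_fun M f" and p: "p \<in> borel_measurable M"
    and b: "\<And>x. x \<in> space M \<Longrightarrow> cmod (p x) \<le> B"
  shows "L2_fun M (\<lambda>x. p x * f x)" and "0 \<le> B \<Longrightarrow> norm_L2 M (\<lambda>x. p x * f x) \<le> B * norm_L2 M f"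
proof -
  have le: "(cmod (p x * f x))\<^sup>2 \<le> B\<^sup>2 * (cmod (f x))\<^sup>2" if "x \<in> space M" for x
    unfolding norm_mult power_mult_distrib
    by (intro mult_right_mono power_mono) (use b that in auto)
  have "integrable M (\<lambda>x. (cmod (p x * f x))\<^sup>2)"
    by (rule Bochner_Integration.integrable_bound[where f="\<lambda>x. B\<^sup>2 * (cmod (f x))\<^sup>2"])
       (use f p le in \<open>auto simp: L2_fun_def abs_of_nonneg intro!: AE_I2\<close>)
  then show l: "L2_fun M (\<lambda>x. p x * f x)" using f p by (auto simp: L2_fun_def)
  assume "0 \<le> B"
  have "(norm_L2 M (\<lambda>x. p x * f x))\<^sup>2 \<le> (LINT x|M. B\<^sup>2 * (cmod (f x))\<^sup>2)"
    unfolding norm_L2_sq using l f by (intro integral_mono le) (auto simp: L2_fun_def)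
  also have "\<dots> = (B * norm_L2 M f)\<^sup>2" by (simp add: norm_L2_sq power_mult_distrib)
  finally show "norm_L2 M (\<lambda>x. p x * f x) \<le> B * norm_L2 M f"
    using \<open>0 \<le> B\<close> by (meson mult_nonneg_nonneg norm_L2_nonneg power2_le_imp_le)
qed

text \<open>
A minimizing sequence for the distance from \<open>F\<close> to \<open>V\<close> is a Cauchy sequence by the parallelogram law,
and its limit is orthogonal to \<open>V\<close> after subtraction from \<open>F\<close>, by a first-order variation. The
limit belongs to \<open>V\<close> because \<open>V\<close> itself is assumed complete.
\<close>

lemma orthogonal_projection_exists:
  assumes V: "\<And>f. f \<in> V \<Longrightarrow> L2_fun M f"
    and lin: "\<And>f g c. f \<in> V \<Longrightarrow> g \<in> V \<Longrightarrow> (\<lambda>x. f x + c * g x) \<in> V"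
    and ne: "V \<noteq> {}"
    and complete: "\<And>u. (\<And>n. u n \<in> V) \<Longrightarrow>
        (\<And>e. e > 0 \<Longrightarrow> \<exists>N::nat. \<forall>m\<ge>N. \<forall>n\<ge>N. norm_L2 M (\<lambda>x. u m x - u n x) < e) \<Longrightarrow>
        \<exists>g\<in>V. (\<lambda>n. norm_L2 M (\<lambda>x. u n x - g x)) \<longlonglongrightarrow> 0"
    and F: "L2_fun M F"
  shows "\<exists>g\<in>V. \<forall>h\<in>V. inner_L2 M (\<lambda>x. F x - g x) h = 0"
proof -
  define D where "D g = (norm_L2 M (\<lambda>x. F x - g x))\<^sup>2" for g
  define d where "d = Inf (D ` V)"
  have bdd: "bdd_below (D ` V)" by (rule bdd_belowI[of _ 0]) (auto simp: D_def)
  have d_le: "d \<le> D g" if "g \<in> V" for g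
    unfolding d_def using that bdd by (auto intro: cInf_lower)
  have "\<exists>g\<in>V. D g < d + inverse (Suc n)" for n
    using cInf_lessD[of "D ` V" "d + inverse (Suc n)"] ne by (auto simp: d_def)
  then obtain u where u: "\<And>n. u n \<in> V" and uD: "\<And>n. D (u n) < d + inverse (Suc n)" by metis
  have par: "(norm_L2 M (\<lambda>x. u m x - u n x))\<^sup>2 \<le> 2 * inverse (Suc m) + 2 * inverse (Suc n)" for m n
  proof -
    let ?a = "\<lambda>x. F x - u m x" and ?b = "\<lambda>x. F x - u n x"
    have ab: "L2_fun M ?a" "L2_fun M ?b" using F u V by (auto intro: L2_fun_diff)
    \<comment> \<open>The midpoint of the two approximants, whose distance to \<open>F\<close> is at least the infimum.\<close>
    let ?h = "\<lambda>x. (0 + (1/2) * u m x) + (1/2) * u n x"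
    have z: "(\<lambda>x. 0) \<in> V" using lin[OF u u, of m "-1" m] by simp
    have h: "?h \<in> V" by (rule lin[OF _ u], rule lin[OF z u])
    have "(\<lambda>x. F x - ?h x) = (\<lambda>x. (1/2) * (?a x + 1 * ?b x))" by (auto simp: fun_eq_iff field_simps)
    then have "D ?h = (1/4) * (norm_L2 M (\<lambda>x. ?a x + 1 * ?b x))\<^sup>2"
      unfolding D_def by (simp only: norm_L2_cmult power_mult_distrib) (simp add: power2_eq_square)
    moreover have "(norm_L2 M (\<lambda>x. ?a x + 1 * ?b x))\<^sup>2 = D (u m) + 2 * Re (inner_L2 M ?a ?b) + D (u n)"
      unfolding norm_L2_sq_add_cmult[OF ab] D_def by simp
    moreover have "(norm_L2 M (\<lambda>x. ?a x + (-1) * ?b x))\<^sup>2 = D (u m) - 2 * Re (inner_L2 M ?a ?b) + D (u n)"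
      unfolding norm_L2_sq_add_cmult[OF ab] D_def by simp
    moreover have "norm_L2 M (\<lambda>x. ?a x + (-1) * ?b x) = norm_L2 M (\<lambda>x. u m x - u n x)"
      using norm_L2_diff_commute[of M "u n" "u m"] by simp
    ultimately show ?thesis using d_le[OF h] uD[of m] uD[of n] by simp
  qed
  have "\<exists>N::nat. \<forall>m\<ge>N. \<forall>n\<ge>N. norm_L2 M (\<lambda>x. u m x - u n x) < e" if e: "e > 0" for e
  proof -
    obtain N where N: "inverse (Suc N) < e\<^sup>2 / 4"
      using reals_Archimedean[of "e\<^sup>2/4"] e by auto
    show ?thesis
    proof (intro exI allI impI)
      fix m n assume mn: "N \<le> m" "N \<le> n"
      have "inverse (real (Suc m)) \<le> inverse (real (Suc N))" "inverse (real (Suc n)) \<le> inverse (real (Suc N))"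
        using mn by (auto intro!: le_imp_inverse_le)
      then have "(norm_L2 M (\<lambda>x. u m x - u n x))\<^sup>2 < e\<^sup>2" using par[of m n] N by linarith
      then show "norm_L2 M (\<lambda>x. u m x - u n x) < e" using e by (simp add: power2_less_imp_less)
    qed
  qed
  from complete[OF u this] obtain g where g: "g \<in> V"
    and lim: "(\<lambda>n. norm_L2 M (\<lambda>x. u n x - g x)) \<longlonglongrightarrow> 0" by blast
  have Dg: "D g \<le> d"
  proof -
    have d0: "0 \<le> d" unfolding d_def using ne by (auto intro!: cInf_greatest simp: D_def)
    have "norm_L2 M (\<lambda>x. F x - g x) \<le> sqrt (d + inverse (Suc n)) + norm_L2 M (\<lambda>x. u n x - g x)" for n
    proof -
      have "norm_L2 M (\<lambda>x. F x - g x) = norm_L2 M (\<lambda>x. (F x - u n x) + (u n x - g x))" by simp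
      also have "\<dots> \<le> norm_L2 M (\<lambda>x. F x - u n x) + norm_L2 M (\<lambda>x. u n x - g x)"
        by (rule norm_L2_triangle) (use F V u g in \<open>auto intro: L2_fun_diff\<close>)
      also have "norm_L2 M (\<lambda>x. F x - u n x) \<le> sqrt (d + inverse (Suc n))"
        using uD[of n] unfolding D_def by (simp add: real_le_rsqrt)
      finally show ?thesis by simp
    qed
    moreover have "(\<lambda>n. sqrt (d + inverse (Suc n)) + norm_L2 M (\<lambda>x. u n x - g x)) \<longlonglongrightarrow> sqrt (d + 0) + 0"
      by (intro tendsto_intros lim LIMSEQ_inverse_real_of_nat)
    ultimately have "norm_L2 M (\<lambda>x. F x - g x) \<le> sqrt (d + 0) + 0"
      by (intro LIMSEQ_le_const) auto
    then have "(norm_L2 M (\<lambda>x. F x - g x))\<^sup>2 \<le> (sqrt d)\<^sup>2" by (intro power_mono) auto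
    then show ?thesis using d0 by (simp add: D_def)
  qed
  have "inner_L2 M (\<lambda>x. F x - g x) h = 0" if h: "h \<in> V" for h
  proof -
    have Fg: "L2_fun M (\<lambda>x. F x - g x)" using F V g by (auto intro: L2_fun_diff)
    have "(cmod (inner_L2 M (\<lambda>x. F x - g x) h))\<^sup>2 \<le> 0 * (norm_L2 M h)\<^sup>2"
    proof (rule nonneg_quadratic_imp_discriminant)
      fix c
      \<comment> \<open>Minimality of \<open>g\<close> against the competitor \<open>g - c h\<close>, for every complex \<open>c\<close>.\<close>
      have "D (\<lambda>x. g x + (-c) * h x) = (norm_L2 M (\<lambda>x. (F x - g x) + c * h x))\<^sup>2"
        by (simp add: D_def algebra_simps)
      then have "D (\<lambda>x. g x + (-c) * h x) =
          D g + 2 * Re (cnj c * inner_L2 M (\<lambda>x. F x - g x) h) + (cmod c)\<^sup>2 * (norm_L2 M h)\<^sup>2"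
        unfolding D_def using norm_L2_sq_add_cmult[OF Fg V[OF h]] by simp
      with d_le[OF lin[OF g h, of "-c"]] Dg
      show "0 \<le> 0 + 2 * Re (cnj c * inner_L2 M (\<lambda>x. F x - g x) h) + (cmod c)\<^sup>2 * (norm_L2 M h)\<^sup>2" by simp
    qed simp
    then show ?thesis by simp
  qed
  with g show ?thesis by blast
qed


section \<open>Point evaluations on Bergman spaces\<close>

lemma nn_integral_lborel_translate:
  fixes c :: "'a::euclidean_space"
  assumes [measurable]: "f \<in> borel_measurable borel"
  shows "(\<integral>\<^sup>+x. f (c + x) \<partial>lborel) = (\<integral>\<^sup>+x. f x \<partial>lborel)"
proof -
  have "(\<integral>\<^sup>+x. f x \<partial>lborel) = (\<integral>\<^sup>+x. f x \<partial>(distr lborel borel ((+) c)))"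
    by (simp add: lborel_distr_plus)
  also have "\<dots> = (\<integral>\<^sup>+x. f (c + x) \<partial>lborel)"
    by (subst nn_integral_distr) auto
  finally show ?thesis by simp
qed

text \<open>
The usual uniqueness argument for Haar measure: with \<open>B\<close> the unit ball, the double integral of
\<open>1\<^sub>A(R x) 1\<^sub>B(y - R x)\<close> is \<open>\<lambda>(R\<^sup>-\<^sup>1 A) \<lambda>(B)\<close> when integrated over \<open>y\<close> first, and \<open>\<lambda>(A) \<lambda>(B)\<close> after the
translation that moves \<open>y\<close> into the argument of \<open>1\<^sub>A\<close>. The second computation uses that \<open>B\<close> is
symmetric and invariant under \<open>R\<close>.
\<close>

lemma lborel_distr_linear_isometry:
  fixes R :: "'a::euclidean_space \<Rightarrow> 'a"
  assumes lin: "linear R" and iso: "\<And>x. norm (R x) = norm x"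
  shows "distr lborel borel R = lborel"
proof (rule measure_eqI)
  have cont: "continuous_on UNIV R" by (rule linear_continuous_on) (simp add: lin linear_linear)
  then have R[measurable]: "R \<in> borel_measurable borel" by (rule borel_measurable_continuous_onI)
  have "inj R" using iso linear_injective_0[OF lin] norm_eq_zero by metis
  then have "surj R" using lin linear_injective_imp_surjective by blast
  then obtain S where S: "\<And>y. R (S y) = y" by (metis surj_f_inv_f)
  show "sets (distr lborel borel R) = sets lborel" by simp
  fix A assume "A \<in> sets (distr lborel borel R)"
  then have A[measurable]: "A \<in> sets borel" by simp
  define B where "B = ball (0::'a) 1"
  have B[measurable]: "B \<in> sets borel" by (simp add: B_def)
  have Bpos: "emeasure lborel B \<noteq> 0"
    using content_ball_pos[of 1 "0::'a"] by (auto simp: B_def measure_def)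
  have Bfin: "emeasure lborel B \<noteq> \<infinity>"
    unfolding B_def using emeasure_lborel_ball_finite by (metis less_top infinity_ennreal_def)
  let ?a = "indicator A :: 'a \<Rightarrow> ennreal" and ?b = "indicator B :: 'a \<Rightarrow> ennreal"
  have "emeasure lborel (R -` A) * emeasure lborel B = (\<integral>\<^sup>+x. ?a (R x) * emeasure lborel B \<partial>lborel)"
    by (subst nn_integral_multc) (auto simp: nn_integral_indicator[symmetric] indicator_vimage[symmetric]
        measurable_sets_borel[OF R A] simp del: nn_integral_indicator)
  also have "\<dots> = (\<integral>\<^sup>+x. (\<integral>\<^sup>+y. ?a (R x) * ?b (- R x + y) \<partial>lborel) \<partial>lborel)"
  proof (rule nn_integral_cong)
    fix x
    have "(\<integral>\<^sup>+y. ?a (R x) * ?b (- R x + y) \<partial>lborel) = ?a (R x) * (\<integral>\<^sup>+y. ?b (- R x + y) \<partial>lborel)"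
      by (rule nn_integral_cmult) simp
    also have "(\<integral>\<^sup>+y. ?b (- R x + y) \<partial>lborel) = emeasure lborel B"
      by (subst nn_integral_lborel_translate) auto
    finally show "?a (R x) * emeasure lborel B = (\<integral>\<^sup>+y. ?a (R x) * ?b (- R x + y) \<partial>lborel)" by simp
  qed
  also have "\<dots> = (\<integral>\<^sup>+y. (\<integral>\<^sup>+x. ?a (R x) * ?b (- R x + y) \<partial>lborel) \<partial>lborel)"
    by (rule lborel_pair.Fubini'[symmetric]) measurable
  also have "\<dots> = (\<integral>\<^sup>+y. (\<integral>\<^sup>+x. ?a (y + R x) * ?b (- R x) \<partial>lborel) \<partial>lborel)"
  proof (rule nn_integral_cong)
    fix y
    have "(\<integral>\<^sup>+x. ?a (R x) * ?b (- R x + y) \<partial>lborel) = (\<integral>\<^sup>+x. ?a (R (S y + x)) * ?b (- R (S y + x) + y) \<partial>lborel)"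
      by (rule nn_integral_lborel_translate[symmetric]) measurable
    also have "\<dots> = (\<integral>\<^sup>+x. ?a (y + R x) * ?b (- R x) \<partial>lborel)"
      by (simp add: linear_add[OF lin] S)
    finally show "(\<integral>\<^sup>+x. ?a (R x) * ?b (- R x + y) \<partial>lborel) = (\<integral>\<^sup>+x. ?a (y + R x) * ?b (- R x) \<partial>lborel)" .
  qed
  also have "\<dots> = (\<integral>\<^sup>+x. (\<integral>\<^sup>+y. ?a (y + R x) * ?b (- R x) \<partial>lborel) \<partial>lborel)"
    by (rule lborel_pair.Fubini') measurable
  also have "\<dots> = (\<integral>\<^sup>+x. emeasure lborel A * ?b x \<partial>lborel)"
  proof (rule nn_integral_cong)
    fix x
    have b: "?b (- R x) = ?b x" by (auto simp: B_def indicator_def iso)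
    have "(\<integral>\<^sup>+y. ?a (y + R x) * ?b (- R x) \<partial>lborel) = (\<integral>\<^sup>+y. ?a (R x + y) \<partial>lborel) * ?b (- R x)"
      by (subst nn_integral_multc[symmetric]) (auto simp: add.commute)
    also have "(\<integral>\<^sup>+y. ?a (R x + y) \<partial>lborel) = emeasure lborel A"
      by (subst nn_integral_lborel_translate) auto
    finally show "(\<integral>\<^sup>+y. ?a (y + R x) * ?b (- R x) \<partial>lborel) = emeasure lborel A * ?b x"
      unfolding b .
  qed
  also have "\<dots> = emeasure lborel A * emeasure lborel B"
    by (subst nn_integral_cmult) auto
  finally have "emeasure lborel (R -` A) = emeasure lborel A"
    using Bpos Bfin by (simp add: mult.commute[of _ "emeasure lborel B"] ennreal_mult_cancel_left)
  then show "emeasure (distr lborel borel R) A = emeasure lborel A"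
    by (subst emeasure_distr) auto
qed

lemma vec_norm_cscale: "norm (c *s (w::complex^'k)) = cmod c * norm w"
  by (simp add: norm_vec_def norm_mult L2_set_right_distrib)

lemma bounded_linear_cscale: "bounded_linear (\<lambda>t. t *s (w::complex^'k))"
  by (rule bounded_linear_intro[where K="norm w"])
     (auto simp: vec_norm_cscale vec_eq_iff algebra_simps)

lemma linear_cscale: "linear (\<lambda>w. c *s (w::complex^'k))"
  by (rule linearI) (auto simp: vec_eq_iff algebra_simps)

lemma continuous_on_cscale:
  assumes "continuous_on A f" "continuous_on A g"
  shows "continuous_on A (\<lambda>x. f x *s (g x :: complex^'k))"
  unfolding vector_scalar_mult_def using assms by (intro continuous_intros) auto

lemma lborel_distr_unimodular_scale:
  assumes "cmod c = 1"
  shows "distr lborel borel (\<lambda>w::complex^'k. c *s w) = lborel"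
  by (rule lborel_distr_linear_isometry) (auto simp: linear_cscale vec_norm_cscale assms)

lemma unit_disc_mean_value:
  assumes hol: "F holomorphic_on U" and U: "open U" "cball 0 1 \<subseteq> U"
  shows "((\<lambda>t. F (exp (2 * of_real pi * \<i> * of_real t))) has_integral F 0) {0..1}"
proof -
  have "((\<lambda>u. F u/(u-0)) has_contour_integral (2 * of_real pi * \<i> * F 0)) (circlepath 0 1)"
    using U hol ball_subset_cball[of 0 "1::real"]
    by (intro Cauchy_integral_circlepath)
       (auto intro: holomorphic_on_imp_continuous_on holomorphic_on_subset elim!: holomorphic_on_subset)
  then have "((\<lambda>x. F (circlepath 0 1 x) / circlepath 0 1 x * vector_derivative (circlepath 0 1) (at x))
        has_integral 2 * of_real pi * \<i> * F 0) {0..1}"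
    by (simp add: has_contour_integral)
  then have "((\<lambda>x. (2 * of_real pi * \<i>) * F (exp (2 * of_real pi * \<i> * of_real x)))
        has_integral 2 * of_real pi * \<i> * F 0) {0..1}"
    by (rule has_integral_eq[rotated]) (simp only: vector_derivative_circlepath, simp add: circlepath)
  then have "((\<lambda>x. (1 / (2 * of_real pi * \<i>)) * ((2 * of_real pi * \<i>) * F (exp (2 * of_real pi * \<i> * of_real x))))
        has_integral (1 / (2 * of_real pi * \<i>)) * (2 * of_real pi * \<i> * F 0)) {0..1}"
    by (rule has_integral_mult_right)
  then show ?thesis by simp
qed

text \<open>
Subharmonicity of \<open>\<bar>F\<bar>\<^sup>2\<close>, obtained by applying the mean value property to the holomorphic function
\<open>F\<^sup>2\<close>. It is stated with the nonnegative integral so that Tonelli's theorem applies later without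
any integrability condition.
\<close>

lemma cmod_square_le_circle_mean:
  assumes hol: "F holomorphic_on U" and U: "open U" "cball 0 1 \<subseteq> U"
  shows "ennreal ((cmod (F 0))\<^sup>2)
    \<le> (\<integral>\<^sup>+t. indicator {0..1} t * ennreal ((cmod (F (exp (2 * of_real pi * \<i> * of_real t))))\<^sup>2) \<partial>lborel)"
proof -
  let ?e = "\<lambda>t::real. exp (2 * of_real pi * \<i> * of_real t)"
  let ?g = "\<lambda>t. (cmod (F (?e t)))\<^sup>2"
  have eU: "?e t \<in> U" for t using U by (auto simp: norm_exp_eq_Re)
  have contF: "continuous_on U F" using hol by (rule holomorphic_on_imp_continuous_on)
  have cont: "continuous_on {0..1} (\<lambda>t. F (?e t))"
    by (rule continuous_on_compose2[OF contF]) (auto intro!: continuous_intros simp: eU)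
  have "((\<lambda>t. (F (?e t))\<^sup>2) has_integral (F 0)\<^sup>2) {0..1}"
    by (rule unit_disc_mean_value[OF _ U]) (intro holomorphic_intros hol)
  then have *: "(F 0)\<^sup>2 = integral {0..1} (\<lambda>t. (F (?e t))\<^sup>2)"
    by (simp add: integral_unique)
  have int: "?g integrable_on {0..1}"
    by (intro integrable_continuous_real continuous_intros cont)
  have "(cmod (F 0))\<^sup>2 \<le> integral {0..1} ?g"
    unfolding norm_power[symmetric] * using cont int
    by (intro integral_norm_bound_integral integrable_continuous_real continuous_intros)
       (auto simp: norm_power)
  then have "ennreal ((cmod (F 0))\<^sup>2) \<le> ennreal (integral {0..1} ?g)" by (rule ennreal_leI)
  also have "\<dots> = (\<integral>\<^sup>+t. ennreal (indicator {0..1} t * ?g t) \<partial>lborel)"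
    by (rule nn_integral_has_integral_lebesgue[symmetric]) (use int in auto)
  also have "\<dots> = (\<integral>\<^sup>+t. indicator {0..1} t * ennreal (?g t) \<partial>lborel)"
    by (intro nn_integral_cong) (auto simp: indicator_def)
  finally show ?thesis .
qed


lemma L2_inner_eq: "L2_inner \<Omega> = inner_L2 (lebesgue_on \<Omega>)"
  by (simp add: fun_eq_iff L2_inner_def inner_L2_def)

lemma L2_norm_on_eq: "L2_norm_on \<Omega> = norm_L2 (lebesgue_on \<Omega>)"
  by (simp add: fun_eq_iff L2_norm_on_def norm_L2_def)

lemma square_integrable_on_eq: "square_integrable_on f \<Omega> = L2_fun (lebesgue_on \<Omega>) f"
  by (simp add: square_integrable_on_def L2_fun_def)

lemma holomorphic_vec_on_imp_continuous_on:
  "holomorphic_vec_on f \<Omega> \<Longrightarrow> continuous_on \<Omega> f"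
  unfolding holomorphic_vec_on_def
  by (meson continuous_at_imp_continuous_on has_derivative_continuous)

lemma holomorphic_vec_on_add_cmult:
  assumes "holomorphic_vec_on f \<Omega>" "holomorphic_vec_on g \<Omega>"
  shows "holomorphic_vec_on (\<lambda>z. f z + c * g z) \<Omega>"
  unfolding holomorphic_vec_on_def
proof
  fix z assume "z \<in> \<Omega>"
  then obtain L K where *: "(f has_derivative L) (at z)" "(g has_derivative K) (at z)"
    and "\<forall>c v. L (c *s v) = c * L v" "\<forall>c v. K (c *s v) = c * K v"
    using assms unfolding holomorphic_vec_on_def by meson
  moreover have "((\<lambda>z. f z + c * g z) has_derivative (\<lambda>h. L h + c * K h)) (at z)"
    by (intro derivative_intros *)
  ultimately show "\<exists>L. ((\<lambda>z. f z + c * g z) has_derivative L) (at z) \<and> (\<forall>c v. L (c *s v) = c * L v)"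
    by (intro exI[of _ "\<lambda>h. L h + c * K h"]) (simp add: algebra_simps)
qed

text \<open>
Complex linearity of the derivative is exactly what makes restrictions to complex lines holomorphic
in one variable; the mean value inequality and the derivative bound below both come from such restrictions.
\<close>

lemma has_field_derivative_along_line:
  fixes w :: "complex ^ 'k"
  assumes "(f has_derivative L) (at (z + t *s w))" and "\<And>c v. L (c *s v) = c * L v"
  shows "((\<lambda>t. f (z + t *s w)) has_field_derivative L w) (at t)"
proof -
  have "((\<lambda>t. z + t *s w) has_derivative (\<lambda>h. h *s w)) (at t)"
    using has_derivative_add[OF has_derivative_const bounded_linear_imp_has_derivative[OF bounded_linear_cscale[of w]]]
    by simp
  then have "((\<lambda>t. f (z + t *s w)) has_derivative (\<lambda>h. L (h *s w))) (at t)"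
    using assms(1) by (rule has_derivative_compose)
  then show ?thesis unfolding has_field_derivative_def assms(2) by (simp add: mult.commute[of _ "L w"])
qed

lemma holomorphic_on_line:
  fixes w :: "complex ^ 'k"
  assumes "holomorphic_vec_on f \<Omega>" and "open \<Omega>"
  shows "(\<lambda>t. f (z + t *s w)) holomorphic_on {t. z + t *s w \<in> \<Omega>}"
    and "open {t. z + t *s w \<in> \<Omega>}"
proof -
  have "continuous_on UNIV (\<lambda>t. z + t *s w)"
    by (intro continuous_intros continuous_on_cscale)
  then show "open {t. z + t *s w \<in> \<Omega>}"
    using open_vimage[OF assms(2)] by (simp add: vimage_def)
  show "(\<lambda>t. f (z + t *s w)) holomorphic_on {t. z + t *s w \<in> \<Omega>}"
    unfolding holomorphic_on_def
  proof
    fix t assume "t \<in> {t. z + t *s w \<in> \<Omega>}"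
    then obtain L where "(f has_derivative L) (at (z + t *s w))" "\<And>c v. L (c *s v) = c * L v"
      using assms(1) unfolding holomorphic_vec_on_def by blast
    from has_field_derivative_along_line[OF this]
    show "(\<lambda>t. f (z + t *s w)) field_differentiable at t within {t. z + t *s w \<in> \<Omega>}"
      using field_differentiable_at_within field_differentiable_def by blast
  qed
qed

lemma borel_measurable_open_support:
  fixes f :: "'a::topological_space \<Rightarrow> complex"
  assumes "continuous_on \<Omega> f" "open \<Omega>" "\<And>z. z \<notin> \<Omega> \<Longrightarrow> f z = 0"
  shows "f \<in> borel_measurable borel"
proof -
  have "(\<lambda>z. indicator \<Omega> z *\<^sub>R f z) \<in> borel_measurable borel"
    using assms by (intro borel_measurable_continuous_on_indicator) auto
  also have "(\<lambda>z. indicator \<Omega> z *\<^sub>R f z) = f" using assms(3) by (auto simp: indicator_def fun_eq_iff)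
  finally show ?thesis .
qed

text \<open>
Elements of the Bergman space vanish off \<open>\<Omega>\<close>, so integrals over \<open>\<Omega>\<close> are integrals over the whole
space.
\<close>

lemma nn_integral_lebesgue_on:
  assumes "open \<Omega>" "\<And>z. z \<notin> \<Omega> \<Longrightarrow> f z = 0"
  shows "(\<integral>\<^sup>+z. f z \<partial>lebesgue_on \<Omega>) = (\<integral>\<^sup>+z. f z \<partial>lborel)"
proof -
  have "(\<integral>\<^sup>+z. f z \<partial>lebesgue_on \<Omega>) = (\<integral>\<^sup>+z. f z * indicator \<Omega> z \<partial>lebesgue)"
    using assms(1) by (subst nn_integral_restrict_space) auto
  also have "\<dots> = (\<integral>\<^sup>+z. f z \<partial>lebesgue)"
    by (intro nn_integral_cong) (use assms(2) in \<open>auto simp: indicator_def\<close>)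
  finally show ?thesis by (simp add: nn_integral_completion)
qed

lemma nn_integral_cmod_sq:
  assumes "L2_fun M f"
  shows "(\<integral>\<^sup>+x. ennreal ((cmod (f x))\<^sup>2) \<partial>M) = ennreal ((norm_L2 M f)\<^sup>2)"
  unfolding norm_L2_sq using assms by (intro nn_integral_eq_integral) (auto simp: L2_fun_def)

lemma L2_fun_if_nn_integral_le:
  assumes "f \<in> borel_measurable M" "(\<integral>\<^sup>+x. ennreal ((cmod (f x))\<^sup>2) \<partial>M) \<le> ennreal (a\<^sup>2)" "0 \<le> a"
  shows "L2_fun M f" "norm_L2 M f \<le> a"
proof -
  have "integrable M (\<lambda>x. (cmod (f x))\<^sup>2)"
    using assms le_less_trans[OF assms(2) ennreal_less_top]
    by (intro integrableI_bounded) auto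
  then show "L2_fun M f" using assms by (simp add: L2_fun_def)
  then have "(norm_L2 M f)\<^sup>2 \<le> a\<^sup>2" using assms(2,3) by (simp add: nn_integral_cmod_sq)
  then show "norm_L2 M f \<le> a" using assms(3) by (rule power2_le_imp_le)
qed

lemma bergman_spaceD:
  assumes "f \<in> bergman_space \<Omega>"
  shows "holomorphic_vec_on f \<Omega>" "L2_fun (lebesgue_on \<Omega>) f" "z \<notin> \<Omega> \<Longrightarrow> f z = 0"
  using assms by (auto simp: bergman_space_def square_integrable_on_eq)

lemma bergman_space_borel:
  assumes "open \<Omega>" "f \<in> bergman_space \<Omega>"
  shows "f \<in> borel_measurable borel"
  using borel_measurable_open_support[OF holomorphic_vec_on_imp_continuous_on] bergman_spaceD[OF assms(2)] assms(1)
  by blast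

lemma bergman_space_add_cmult:
  assumes "f \<in> bergman_space \<Omega>" "g \<in> bergman_space \<Omega>"
  shows "(\<lambda>z. f z + c * g z) \<in> bergman_space \<Omega>"
  using assms L2_fun_add_cmult holomorphic_vec_on_add_cmult
  by (auto simp: bergman_space_def square_integrable_on_eq)

lemma zero_in_bergman_space: "(\<lambda>z. 0) \<in> bergman_space \<Omega>"
  by (auto simp: bergman_space_def square_integrable_on_eq L2_fun_zero holomorphic_vec_on_def
      intro!: exI[of _ "\<lambda>_. 0"])

lemma bergman_space_cmult: "f \<in> bergman_space \<Omega> \<Longrightarrow> (\<lambda>z. c * f z) \<in> bergman_space \<Omega>"
  using bergman_space_add_cmult[OF zero_in_bergman_space, of f \<Omega> c] by simp

lemma bergman_space_diff:
  assumes "f \<in> bergman_space \<Omega>" "g \<in> bergman_space \<Omega>"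
  shows "(\<lambda>z. f z - g z) \<in> bergman_space \<Omega>"
  using bergman_space_add_cmult[OF assms, of "-1"] by simp

text \<open>
For each \<open>w\<close> in the ball, \<open>\<bar>f(z)\<bar>\<^sup>2\<close> is at most the mean of \<open>\<bar>f\<bar>\<^sup>2\<close> over the circle \<open>z + e\<^bsup>it\<^esup> w\<close>. Integrating
over \<open>w\<close> and exchanging the integrals, the rotation \<open>w \<mapsto> e\<^bsup>it\<^esup> w\<close> drops out for each fixed \<open>t\<close>.
\<close>

lemma bergman_sub_mean_value:
  fixes \<Omega> :: "(complex ^ 'k) set"
  assumes \<Omega>: "open \<Omega>" and f: "f \<in> bergman_space \<Omega>" and r: "cball z r \<subseteq> \<Omega>"
  shows "ennreal ((cmod (f z))\<^sup>2) * emeasure lborel (ball (0::complex^'k) r)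
    \<le> ennreal ((norm_L2 (lebesgue_on \<Omega>) f)\<^sup>2)"
proof -
  have fb[measurable]: "f \<in> borel_measurable borel" by (rule bergman_space_borel[OF \<Omega> f])
  let ?e = "\<lambda>t::real. exp (2 * of_real pi * \<i> * of_real t)"
  let ?B = "ball (0::complex^'k) r"
  let ?f = "\<lambda>w. ennreal ((cmod (f w))\<^sup>2)"
  let ?J = "indicator {0..1} :: real \<Rightarrow> ennreal"
  have [measurable]: "?B \<in> sets borel" by simp
  have ne: "cmod (?e t) = 1" for t by (auto simp: norm_exp_eq_Re)
  have e_cont: "continuous_on UNIV (\<lambda>p::real \<times> (complex^'k). ?e (fst p) *s snd p)"
    by (intro continuous_intros continuous_on_cscale)
  have [measurable]: "(\<lambda>p::real \<times> (complex^'k). ?e (fst p) *s snd p) \<in> borel_measurable (borel \<Otimes>\<^sub>M borel)"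
    using borel_measurable_continuous_onI[OF e_cont] by (simp add: borel_prod)
  have "?f z * emeasure lborel ?B = (\<integral>\<^sup>+w. ?f z * indicator ?B w \<partial>lborel)"
    by (subst nn_integral_cmult) (auto intro!: borel_measurable_indicator)
  also have "\<dots> \<le> (\<integral>\<^sup>+w. (\<integral>\<^sup>+t. ?J t * (?f (z + ?e t *s w) * indicator ?B w) \<partial>lborel) \<partial>lborel)"
  proof (rule nn_integral_mono)
    fix w :: "complex^'k"
    show "?f z * indicator ?B w \<le> (\<integral>\<^sup>+t. ?J t * (?f (z + ?e t *s w) * indicator ?B w) \<partial>lborel)"
    proof (cases "w \<in> ?B")
      case True
      have "z + t *s w \<in> cball z r" if "t \<in> cball 0 1" for t
      proof -
        have "cmod t * norm w \<le> 1 * r" using that True by (intro mult_mono) auto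
        then show ?thesis by (simp add: dist_norm vec_norm_cscale)
      qed
      then have "cball 0 1 \<subseteq> {t. z + t *s w \<in> \<Omega>}" using r by blast
      from cmod_square_le_circle_mean[OF holomorphic_on_line[OF bergman_spaceD(1)[OF f] \<Omega>] this]
      show ?thesis using True by simp
    qed auto
  qed
  also have "\<dots> = (\<integral>\<^sup>+t. (\<integral>\<^sup>+w. ?J t * (?f (z + ?e t *s w) * indicator ?B w) \<partial>lborel) \<partial>lborel)"
    by (rule lborel_pair.Fubini') measurable
  also have "\<dots> \<le> (\<integral>\<^sup>+t. ?J t * ennreal ((norm_L2 (lebesgue_on \<Omega>) f)\<^sup>2) \<partial>lborel)"
  proof (rule nn_integral_mono)
    fix t
    let ?h = "\<lambda>w. ?f (z + w) * indicator ?B w"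
    have "(\<lambda>w. ?e t *s w) \<in> borel_measurable (borel :: (complex^'k) measure)"
      by (intro borel_measurable_continuous_onI continuous_on_cscale continuous_intros)
    then have m[measurable]: "(\<lambda>w. ?e t *s w) \<in> lborel \<rightarrow>\<^sub>M (borel :: (complex^'k) measure)" by simp
    have "(\<integral>\<^sup>+w. ?J t * (?f (z + ?e t *s w) * indicator ?B w) \<partial>lborel)
        = (\<integral>\<^sup>+w. ?J t * ?h (?e t *s w) \<partial>lborel)"
      by (intro nn_integral_cong) (auto simp: indicator_def vec_norm_cscale ne)
    also have "\<dots> = ?J t * (\<integral>\<^sup>+w. ?h (?e t *s w) \<partial>lborel)"
      by (rule nn_integral_cmult) measurable
    also have "(\<integral>\<^sup>+w. ?h (?e t *s w) \<partial>lborel) = (\<integral>\<^sup>+w. ?h w \<partial>distr lborel borel (\<lambda>w. ?e t *s w))"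
      by (rule nn_integral_distr[symmetric]) measurable
    also have "\<dots> = (\<integral>\<^sup>+w. ?h w \<partial>lborel)" by (simp only: lborel_distr_unimodular_scale[OF ne])
    also have "\<dots> \<le> (\<integral>\<^sup>+w. ?f (z + w) \<partial>lborel)"
      by (intro nn_integral_mono) (auto simp: indicator_def)
    also have "\<dots> = (\<integral>\<^sup>+w. ?f w \<partial>lborel)" by (rule nn_integral_lborel_translate) measurable
    also have "\<dots> = (\<integral>\<^sup>+w. ?f w \<partial>lebesgue_on \<Omega>)"
      by (rule nn_integral_lebesgue_on[symmetric]) (use \<Omega> bergman_spaceD(3)[OF f] in auto)
    also have "\<dots> = ennreal ((norm_L2 (lebesgue_on \<Omega>) f)\<^sup>2)"
      by (rule nn_integral_cmod_sq[OF bergman_spaceD(2)[OF f]])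
    finally show "(\<integral>\<^sup>+w. ?J t * (?f (z + ?e t *s w) * indicator ?B w) \<partial>lborel)
        \<le> ?J t * ennreal ((norm_L2 (lebesgue_on \<Omega>) f)\<^sup>2)" by (simp add: mult_left_mono)
  qed
  also have "\<dots> = ennreal ((norm_L2 (lebesgue_on \<Omega>) f)\<^sup>2)"
    by (subst nn_integral_multc) auto
  finally show ?thesis .
qed

text \<open>
The constant depends on the radius alone, which makes the bound uniform for \<open>z\<close> in a compact set.
\<close>

lemma bergman_eval_bound:
  assumes r: "r > 0"
  shows "\<exists>C>0. \<forall>(\<Omega>::(complex^'k) set) z f. open \<Omega> \<longrightarrow> cball z r \<subseteq> \<Omega> \<longrightarrow> f \<in> bergman_space \<Omega> \<longrightarrow>
     cmod (f z) \<le> C * norm_L2 (lebesgue_on \<Omega>) f"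
proof -
  let ?B = "ball (0::complex^'k) r"
  define m where "m = measure lborel ?B"
  have m: "m > 0" unfolding m_def using r by (rule content_ball_pos)
  have em: "emeasure lborel ?B = ennreal m"
    unfolding m_def by (rule emeasure_eq_ennreal_measure) (use emeasure_lborel_ball_finite[of "0::complex^'k" r] in auto)
  show ?thesis
  proof (intro exI[of _ "1 / sqrt m"] conjI allI impI)
    show "1 / sqrt m > 0" using m by simp
    fix \<Omega> :: "(complex^'k) set" and z f
    assume "open \<Omega>" "cball z r \<subseteq> \<Omega>" "f \<in> bergman_space \<Omega>"
    from bergman_sub_mean_value[OF this(1,3,2)]
    have "ennreal ((cmod (f z))\<^sup>2 * m) \<le> ennreal ((norm_L2 (lebesgue_on \<Omega>) f)\<^sup>2)"
      unfolding em using m by (simp add: ennreal_mult)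
    then have "(cmod (f z))\<^sup>2 * m \<le> (norm_L2 (lebesgue_on \<Omega>) f)\<^sup>2" by simp
    then have "(cmod (f z) * sqrt m)\<^sup>2 \<le> (norm_L2 (lebesgue_on \<Omega>) f)\<^sup>2"
      using m by (simp add: power_mult_distrib)
    then have "cmod (f z) * sqrt m \<le> norm_L2 (lebesgue_on \<Omega>) f"
      by (rule power2_le_imp_le) simp
    then show "cmod (f z) \<le> 1 / sqrt m * norm_L2 (lebesgue_on \<Omega>) f" using m by (simp add: field_simps)
  qed
qed


section \<open>Completeness of Bergman spaces\<close>

text \<open>
The Cauchy inequality for the one-variable function \<open>t \<mapsto> f (x + t h)\<close> on the disc of radius
\<open>\<rho> / \<bar>h\<bar>\<close>.
\<close>

lemma derivative_bound_along_line:
  fixes \<Omega> :: "(complex ^ 'k) set"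
  assumes f: "holomorphic_vec_on f \<Omega>" and \<Omega>: "open \<Omega>" and x: "cball x \<rho> \<subseteq> \<Omega>" "\<rho> > 0"
    and B: "\<And>y. y \<in> cball x \<rho> \<Longrightarrow> cmod (f y) \<le> B"
    and L: "(f has_derivative L) (at x)" "\<And>c v. L (c *s v) = c * L v"
  shows "cmod (L h) \<le> B / \<rho> * norm h"
proof (cases "h = 0")
  case True
  then show ?thesis using L(2)[of 0 0] by simp
next
  case False
  define F where "F t = f (x + t *s h)" for t
  let ?r = "\<rho> / norm h" and ?U = "{t. x + t *s h \<in> \<Omega>}"
  have inU: "x + t *s h \<in> cball x \<rho>" if "t \<in> cball 0 ?r" for t
    using that False by (simp add: dist_norm vec_norm_cscale field_simps)
  then have U: "cball 0 ?r \<subseteq> ?U" using x by blast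
  have holU: "F holomorphic_on ?U"
    using holomorphic_on_line(1)[OF f \<Omega>, where w=h and z=x] by (simp add: F_def[abs_def])
  have "(F has_field_derivative L h) (at 0)"
    unfolding F_def by (rule has_field_derivative_along_line) (use L in auto)
  then have d: "deriv F 0 = L h" by (rule DERIV_imp_deriv)
  have "norm ((deriv ^^ 1) F 0) \<le> fact 1 * B / ?r ^ 1"
  proof (rule Cauchy_inequality)
    show "F holomorphic_on ball 0 ?r"
      using holU U ball_subset_cball by (meson holomorphic_on_subset order_trans)
    show "continuous_on (cball 0 ?r) F"
      using holU U holomorphic_on_imp_continuous_on holomorphic_on_subset by blast
    show "?r > 0" using x False by simp
    show "norm (F t) \<le> B" if "norm (0 - t) = ?r" for t
      unfolding F_def by (rule B, rule inU) (use that in simp)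
  qed
  then show ?thesis by (simp add: d)
qed

text \<open>
The Weierstrass convergence theorem in several variables. Cauchy estimates on smaller balls show
that the derivatives are a uniform Cauchy sequence; hence the limit is differentiable, and complex
linearity of the derivative survives pointwise limits.
\<close>

lemma holomorphic_vec_on_limit:
  fixes \<Omega> :: "(complex ^ 'k) set"
  assumes \<Omega>: "open \<Omega>" and u: "\<And>n. holomorphic_vec_on (u n) \<Omega>"
    and unif: "\<And>z. z \<in> \<Omega> \<Longrightarrow> \<exists>r>0. cball z r \<subseteq> \<Omega> \<and>
       (\<forall>e>0. \<exists>N::nat. \<forall>m\<ge>N. \<forall>n\<ge>N. \<forall>x\<in>cball z r. cmod (u m x - u n x) \<le> e)"
    and lim: "\<And>z. z \<in> \<Omega> \<Longrightarrow> (\<lambda>n. u n z) \<longlonglongrightarrow> g z"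
  shows "holomorphic_vec_on g \<Omega>"
  unfolding holomorphic_vec_on_def
proof
  fix z assume "z \<in> \<Omega>"
  then obtain r where r: "r > 0" "cball z r \<subseteq> \<Omega>"
    and ucau: "\<And>e. e > 0 \<Longrightarrow> \<exists>N::nat. \<forall>m\<ge>N. \<forall>n\<ge>N. \<forall>x\<in>cball z r. cmod (u m x - u n x) \<le> e"
    using unif by meson
  let ?S = "ball z (r/2)"
  have "\<forall>n. \<forall>x\<in>\<Omega>. \<exists>L. (u n has_derivative L) (at x) \<and> (\<forall>c v. L (c *s v) = c * L v)"
    using u unfolding holomorphic_vec_on_def by blast
  then obtain D where D: "\<And>n x. x \<in> \<Omega> \<Longrightarrow> (u n has_derivative D n x) (at x)"
    and Dlin: "\<And>n x c v. x \<in> \<Omega> \<Longrightarrow> D n x (c *s v) = c * D n x v" by metis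
  have S\<Omega>: "cball x (r/2) \<subseteq> cball z r" if "x \<in> ?S" for x
  proof
    fix y assume "y \<in> cball x (r/2)"
    then show "y \<in> cball z r" using that dist_triangle[of z y x] by simp
  qed
  then have Sin: "x \<in> \<Omega>" if "x \<in> ?S" for x using r that by (metis centre_in_cball half_gt_zero less_imp_le subsetD)
  have Dcau: "\<exists>N. \<forall>m\<ge>N. \<forall>n\<ge>N. \<forall>x\<in>?S. \<forall>h. cmod (D m x h - D n x h) \<le> e * norm h" if "e > 0" for e
  proof -
    have "e * r / 2 > 0" using that r by simp
    from ucau[OF this] obtain N where
      N: "\<And>m n x. m \<ge> N \<Longrightarrow> n \<ge> N \<Longrightarrow> x \<in> cball z r \<Longrightarrow> cmod (u m x - u n x) \<le> e * r / 2" by meson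
    show ?thesis
    proof (intro exI allI impI ballI)
      fix m n x h assume mn: "N \<le> m" "N \<le> n" and x: "x \<in> ?S"
      have "cmod ((\<lambda>h. D m x h - D n x h) h) \<le> (e * r / 2) / (r/2) * norm h"
      proof (rule derivative_bound_along_line[where f="\<lambda>x. u m x - u n x" and x=x])
        show "holomorphic_vec_on (\<lambda>x. u m x - u n x) \<Omega>"
          using holomorphic_vec_on_add_cmult[OF u u, of m "-1" n] by simp
        show "cball x (r/2) \<subseteq> \<Omega>" using S\<Omega>[OF x] r by blast
        show "cmod (u m y - u n y) \<le> e * r / 2" if "y \<in> cball x (r/2)" for y
          using N[OF mn] S\<Omega>[OF x] that by blast
        show "((\<lambda>x. u m x - u n x) has_derivative (\<lambda>h. D m x h - D n x h)) (at x)"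
          by (intro derivative_intros D Sin x)
      qed (use r \<Omega> Dlin[OF Sin[OF x]] in \<open>auto simp: algebra_simps\<close>)
      then show "cmod (D m x h - D n x h) \<le> e * norm h" using r by simp
    qed
  qed
  have conv: "convergent (\<lambda>n. D n x h)" if x: "x \<in> ?S" for x h
  proof -
    have "Cauchy (\<lambda>n. D n x h)"
      unfolding Cauchy_altdef2
    proof (intro allI impI)
      fix e :: real assume e: "e > 0"
      have "e / (norm h + 1) > 0" using e by (simp add: add_nonneg_pos)
      from Dcau[OF this] obtain N where
        N: "\<And>m n. m \<ge> N \<Longrightarrow> n \<ge> N \<Longrightarrow> cmod (D m x h - D n x h) \<le> e / (norm h + 1) * norm h" using x by meson
      have "e / (norm h + 1) * norm h < e"
        using e norm_ge_zero[of h] by (simp add: divide_less_eq not_less add_nonneg_pos algebra_simps)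
      then show "\<exists>N. \<forall>n\<ge>N. dist (D n x h) (D N x h) < e"
        using N by (intro exI[of _ N]) (auto simp: dist_norm intro: le_less_trans)
    qed
    then show ?thesis by (rule Cauchy_convergent)
  qed
  define D' where "D' x h = lim (\<lambda>n. D n x h)" for x h
  have D'lim: "(\<lambda>n. D n x h) \<longlonglongrightarrow> D' x h" if "x \<in> ?S" for x h
    unfolding D'_def using conv[OF that] by (simp add: convergent_LIMSEQ_iff)
  have "\<exists>G. \<forall>x\<in>?S. (\<lambda>n. u n x) \<longlonglongrightarrow> G x \<and> (G has_derivative D' x) (at x within ?S)"
  proof (rule has_derivative_sequence)
    show "(u n has_derivative D n x) (at x within ?S)" if "x \<in> ?S" for n x
      using D[OF Sin[OF that]] by (rule has_derivative_at_withinI)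
    show "\<forall>\<^sub>F n in sequentially. \<forall>x\<in>?S. \<forall>h. norm (D n x h - D' x h) \<le> e * norm h" if e: "e > 0" for e
    proof -
      obtain N where
        N: "\<And>m n x h. m \<ge> N \<Longrightarrow> n \<ge> N \<Longrightarrow> x \<in> ?S \<Longrightarrow> cmod (D m x h - D n x h) \<le> e * norm h"
        using Dcau[OF e] by meson
      have "norm (D n x h - D' x h) \<le> e * norm h" if "n \<ge> N" "x \<in> ?S" for n x h
      proof (rule LIMSEQ_le_const2)
        show "(\<lambda>m. norm (D n x h - D m x h)) \<longlonglongrightarrow> norm (D n x h - D' x h)"
          by (intro tendsto_intros D'lim that)
        show "\<exists>N. \<forall>m\<ge>N. norm (D n x h - D m x h) \<le> e * norm h" using N that by blast
      qed
      then show ?thesis unfolding eventually_sequentially by blast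
    qed
    show "z \<in> ?S" using r by simp
    show "(\<lambda>n. u n z) \<longlonglongrightarrow> g z" by (rule lim) fact
  qed simp
  then obtain G where G: "\<And>x. x \<in> ?S \<Longrightarrow> (\<lambda>n. u n x) \<longlonglongrightarrow> G x"
    "\<And>x. x \<in> ?S \<Longrightarrow> (G has_derivative D' x) (at x within ?S)" by blast
  have zS: "z \<in> ?S" using r by simp
  have Gg: "G x = g x" if "x \<in> ?S" for x using LIMSEQ_unique[OF G(1)[OF that] lim[OF Sin[OF that]]] .
  have "(G has_derivative D' z) (at z)" using G(2)[OF zS] at_within_open[OF zS open_ball] by simp
  then have "(g has_derivative D' z) (at z)"
    by (rule has_derivative_transform_within_open[OF _ open_ball zS]) (rule Gg)
  moreover have "D' z (c *s v) = c * D' z v" for c v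
  proof (rule LIMSEQ_unique[OF D'lim[OF zS]])
    show "(\<lambda>n. D n z (c *s v)) \<longlonglongrightarrow> c * D' z v"
      unfolding Dlin[OF \<open>z \<in> \<Omega>\<close>] by (intro tendsto_intros D'lim zS)
  qed
  ultimately show "\<exists>L. (g has_derivative L) (at z) \<and> (\<forall>c v. L (c *s v) = c * L v)" by blast
qed

text \<open>
Bounded point evaluations make a Cauchy sequence in norm a Cauchy sequence locally uniformly, which
produces a holomorphic pointwise limit; Fatou's lemma then upgrades pointwise convergence to
convergence in norm.
\<close>

lemma bergman_space_complete:
  fixes \<Omega> :: "(complex ^ 'k) set"
  assumes \<Omega>: "open \<Omega>" and u: "\<And>n. u n \<in> bergman_space \<Omega>"
    and cau: "\<And>e. e > 0 \<Longrightarrow> \<exists>N::nat. \<forall>m\<ge>N. \<forall>n\<ge>N. norm_L2 (lebesgue_on \<Omega>) (\<lambda>x. u m x - u n x) < e"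
  shows "\<exists>g\<in>bergman_space \<Omega>. (\<lambda>n. norm_L2 (lebesgue_on \<Omega>) (\<lambda>x. u n x - g x)) \<longlonglongrightarrow> 0"
proof -
  let ?M = "lebesgue_on \<Omega>"
  have unif: "\<exists>r>0. cball z r \<subseteq> \<Omega> \<and>
       (\<forall>e>0. \<exists>N::nat. \<forall>m\<ge>N. \<forall>n\<ge>N. \<forall>x\<in>cball z r. cmod (u m x - u n x) \<le> e)" if z: "z \<in> \<Omega>" for z
  proof -
    obtain r where r: "r > 0" "cball z r \<subseteq> \<Omega>" using \<Omega> z open_contains_cball by blast
    then have "r/2 > 0" by simp
    from bergman_eval_bound[OF this] obtain C where C: "C > 0"
      and bound: "\<forall>(\<Omega>::(complex^'k) set) z f. open \<Omega> \<longrightarrow> cball z (r/2) \<subseteq> \<Omega> \<longrightarrow> f \<in> bergman_space \<Omega> \<longrightarrow>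
         cmod (f z) \<le> C * norm_L2 (lebesgue_on \<Omega>) f" by blast
    have sub: "cball x (r/2) \<subseteq> \<Omega>" if "x \<in> cball z (r/2)" for x
    proof
      fix y assume "y \<in> cball x (r/2)"
      then have "y \<in> cball z r" using that dist_triangle[of z y x] by simp
      then show "y \<in> \<Omega>" using r by blast
    qed
    show ?thesis
    proof (intro exI[of _ "r/2"] conjI allI impI)
      show "cball z (r/2) \<subseteq> \<Omega>" using r by (auto simp: subset_iff)
      fix e :: real assume "e > 0"
      then have "e / C > 0" using C by simp
      from cau[OF this] obtain N where N: "\<And>m n. m \<ge> N \<Longrightarrow> n \<ge> N \<Longrightarrow> norm_L2 ?M (\<lambda>x. u m x - u n x) < e / C" by blast
      have "cmod (u m x - u n x) \<le> e" if "m \<ge> N" "n \<ge> N" "x \<in> cball z (r/2)" for m n x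
      proof -
        have "cmod (u m x - u n x) \<le> C * norm_L2 ?M (\<lambda>x. u m x - u n x)"
          by (rule bound[rule_format, OF \<Omega> sub bergman_space_diff[OF u u]]) fact
        also have "\<dots> \<le> C * (e / C)" using N[OF that(1,2)] C by (intro mult_left_mono) auto
        finally show ?thesis using C by simp
      qed
      then show "\<exists>N. \<forall>m\<ge>N. \<forall>n\<ge>N. \<forall>x\<in>cball z (r/2). cmod (u m x - u n x) \<le> e" by blast
    qed (use r in auto)
  qed
  have "convergent (\<lambda>n. u n z)" if z: "z \<in> \<Omega>" for z
  proof -
    obtain r where r: "r > 0" and
      un: "\<forall>e>0. \<exists>N::nat. \<forall>m\<ge>N. \<forall>n\<ge>N. \<forall>x\<in>cball z r. cmod (u m x - u n x) \<le> e"
      using unif[OF z] by (elim exE conjE)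
    have "Cauchy (\<lambda>n. u n z)"
      unfolding Cauchy_altdef2
    proof (intro allI impI)
      fix e :: real assume e: "e > 0"
      then obtain N where "\<forall>m\<ge>N. \<forall>n\<ge>N. \<forall>x\<in>cball z r. cmod (u m x - u n x) \<le> e/2"
        using un half_gt_zero by blast
      then have "cmod (u n z - u N z) \<le> e/2" if "n \<ge> N" for n
        using r that by simp
      moreover have "e/2 < e" using e by simp
      ultimately show "\<exists>N. \<forall>n\<ge>N. dist (u n z) (u N z) < e"
        unfolding dist_norm using le_less_trans by blast
    qed
    then show ?thesis by (rule Cauchy_convergent)
  qed
  then have "\<forall>z. \<exists>y. if z \<in> \<Omega> then (\<lambda>n. u n z) \<longlonglongrightarrow> y else y = 0" by (auto simp: convergent_def)
  then obtain g where g: "\<And>z. z \<in> \<Omega> \<Longrightarrow> (\<lambda>n. u n z) \<longlonglongrightarrow> g z" "\<And>z. z \<notin> \<Omega> \<Longrightarrow> g z = 0"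
    by metis
  have sp: "space ?M = \<Omega>" by simp
  have um: "u n \<in> borel_measurable ?M" for n
    using bergman_spaceD(2)[OF u] by (rule L2_fun_measurable)
  have gm: "g \<in> borel_measurable ?M"
    by (rule borel_measurable_LIMSEQ_metric[OF um]) (use g(1) in auto)
  have tail: "L2_fun ?M (\<lambda>x. u n x - g x) \<and> norm_L2 ?M (\<lambda>x. u n x - g x) \<le> e"
    if e: "e > 0" and N: "\<And>m. m \<ge> N \<Longrightarrow> norm_L2 ?M (\<lambda>x. u n x - u m x) < e" for n N e
  proof -
    let ?F = "\<lambda>m x. ennreal ((cmod (u n x - u m x))\<^sup>2)"
    have "(\<integral>\<^sup>+x. ennreal ((cmod (u n x - g x))\<^sup>2) \<partial>?M) = (\<integral>\<^sup>+x. liminf (\<lambda>m. ?F m x) \<partial>?M)"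
    proof (rule nn_integral_cong)
      fix x assume "x \<in> space ?M"
      then have "(\<lambda>m. ?F m x) \<longlonglongrightarrow> ennreal ((cmod (u n x - g x))\<^sup>2)"
        using sp by (intro tendsto_intros g(1)) auto
      then show "ennreal ((cmod (u n x - g x))\<^sup>2) = liminf (\<lambda>m. ?F m x)"
        by (intro lim_imp_Liminf[symmetric]) auto
    qed
    also have "\<dots> \<le> liminf (\<lambda>m. \<integral>\<^sup>+x. ?F m x \<partial>?M)"
      by (rule nn_integral_liminf) (use um in measurable)
    also have "\<dots> = liminf (\<lambda>m. ennreal ((norm_L2 ?M (\<lambda>x. u n x - u m x))\<^sup>2))"
      by (subst nn_integral_cmod_sq[OF bergman_spaceD(2)[OF bergman_space_diff[OF u u]]]) simp
    also have "\<dots> \<le> ennreal (e\<^sup>2)"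
    proof (rule Liminf_le)
      have "ennreal ((norm_L2 ?M (\<lambda>x. u n x - u m x))\<^sup>2) \<le> ennreal (e\<^sup>2)" if "m \<ge> N" for m
        using N[OF that] e by (intro ennreal_leI power_mono) auto
      then show "\<forall>\<^sub>F m in sequentially. ennreal ((norm_L2 ?M (\<lambda>x. u n x - u m x))\<^sup>2) \<le> ennreal (e\<^sup>2)"
        unfolding eventually_sequentially by blast
    qed simp
    finally have le: "(\<integral>\<^sup>+x. ennreal ((cmod (u n x - g x))\<^sup>2) \<partial>?M) \<le> ennreal (e\<^sup>2)" .
    have m: "(\<lambda>x. u n x - g x) \<in> borel_measurable ?M" using um gm by measurable
    show ?thesis using L2_fun_if_nn_integral_le[OF m le] e by auto
  qed
  have "L2_fun ?M g"
  proof -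
    obtain N where N: "\<And>m n. m \<ge> N \<Longrightarrow> n \<ge> N \<Longrightarrow> norm_L2 ?M (\<lambda>x. u m x - u n x) < 1" using cau[of 1] by auto
    have "L2_fun ?M (\<lambda>x. u N x - g x)" using tail[of 1 N N] N by auto
    from L2_fun_diff[OF bergman_spaceD(2)[OF u[of N]] this] show ?thesis by simp
  qed
  moreover have "holomorphic_vec_on g \<Omega>"
    by (rule holomorphic_vec_on_limit[OF \<Omega> bergman_spaceD(1)[OF u] unif g(1)])
  ultimately have gA: "g \<in> bergman_space \<Omega>"
    using g(2) by (simp add: bergman_space_def square_integrable_on_eq)
  have "(\<lambda>n. norm_L2 ?M (\<lambda>x. u n x - g x)) \<longlonglongrightarrow> 0"
  proof (rule LIMSEQ_I)
    fix e :: real assume e: "e > 0"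
    then obtain N where N: "\<And>m n. m \<ge> N \<Longrightarrow> n \<ge> N \<Longrightarrow> norm_L2 ?M (\<lambda>x. u m x - u n x) < e/2"
      using cau[of "e/2"] by auto
    have half: "norm_L2 ?M (\<lambda>x. u n x - g x) \<le> e/2" if "n \<ge> N" for n
      using tail[of "e/2" N n] N e that by auto
    then have "norm (norm_L2 ?M (\<lambda>x. u n x - g x) - 0) < e" if "n \<ge> N" for n
    proof -
      show ?thesis using half[OF that] e by simp
    qed
    then show "\<exists>N. \<forall>n\<ge>N. norm (norm_L2 ?M (\<lambda>x. u n x - g x) - 0) < e" by blast
  qed
  with gA show ?thesis by blast
qed

text \<open>
This is where the seminorm becomes a norm, and hence why projections and adjoints are unique.
\<close>

lemma bergman_space_norm_eq_0:
  assumes "open \<Omega>" "f \<in> bergman_space \<Omega>" "norm_L2 (lebesgue_on \<Omega>) f = 0"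
  shows "f = (\<lambda>z. 0)"
proof
  fix z show "f z = 0"
  proof (cases "z \<in> \<Omega>")
    case True
    then obtain r where r: "r > 0" "cball z r \<subseteq> \<Omega>" using assms(1) open_contains_cball by blast
    from bergman_eval_bound[OF r(1)] r(2) assms(1,2) have "\<exists>C. cmod (f z) \<le> C * norm_L2 (lebesgue_on \<Omega>) f"
      by meson
    then show ?thesis using assms(3) by simp
  next
    case False
    then show ?thesis using bergman_spaceD(3)[OF assms(2)] by blast
  qed
qed

lemma bergman_proj_unique:
  assumes \<Omega>: "open \<Omega>" and F: "L2_fun (lebesgue_on \<Omega>) F"
    and g: "g \<in> bergman_space \<Omega>" "\<And>h. h \<in> bergman_space \<Omega> \<Longrightarrow> inner_L2 (lebesgue_on \<Omega>) (\<lambda>z. F z - g z) h = 0"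
  shows "bergman_proj \<Omega> F = g"
  unfolding bergman_proj_def L2_inner_eq
proof (rule the_equality)
  fix k assume k: "k \<in> bergman_space \<Omega> \<and> (\<forall>h\<in>bergman_space \<Omega>. inner_L2 (lebesgue_on \<Omega>) (\<lambda>z. F z - k z) h = 0)"
  let ?d = "\<lambda>z. g z - k z"
  have d: "?d \<in> bergman_space \<Omega>" using g k by (auto intro: bergman_space_diff)
  have "inner_L2 (lebesgue_on \<Omega>) ?d ?d = inner_L2 (lebesgue_on \<Omega>) (\<lambda>z. (F z - k z) - (F z - g z)) ?d" by simp
  also have "\<dots> = inner_L2 (lebesgue_on \<Omega>) (\<lambda>z. F z - k z) ?d - inner_L2 (lebesgue_on \<Omega>) (\<lambda>z. F z - g z) ?d"
    by (intro inner_L2_diff_left L2_fun_diff F bergman_spaceD(2)) (use g k d in auto)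
  also have "\<dots> = 0" using g(2)[OF d] k d by simp
  finally have "norm_L2 (lebesgue_on \<Omega>) ?d = 0" by (simp add: inner_L2_self)
  then have "?d = (\<lambda>z. 0)" using bergman_space_norm_eq_0[OF \<Omega> d] by blast
  then show "k = g" by (auto simp: fun_eq_iff)
qed (use g in blast)

lemma bergman_proj:
  assumes \<Omega>: "open \<Omega>" and F: "L2_fun (lebesgue_on \<Omega>) F"
  shows "bergman_proj \<Omega> F \<in> bergman_space \<Omega>"
    and "h \<in> bergman_space \<Omega> \<Longrightarrow> inner_L2 (lebesgue_on \<Omega>) (\<lambda>z. F z - bergman_proj \<Omega> F z) h = 0"
proof -
  have "\<exists>g\<in>bergman_space \<Omega>. \<forall>h\<in>bergman_space \<Omega>. inner_L2 (lebesgue_on \<Omega>) (\<lambda>z. F z - g z) h = 0"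
    by (rule orthogonal_projection_exists[OF bergman_spaceD(2) bergman_space_add_cmult _ bergman_space_complete[OF \<Omega>] F])
       (use zero_in_bergman_space in blast)+
  then obtain g where g: "g \<in> bergman_space \<Omega>" "\<And>h. h \<in> bergman_space \<Omega> \<Longrightarrow> inner_L2 (lebesgue_on \<Omega>) (\<lambda>z. F z - g z) h = 0"
    by blast
  from bergman_proj_unique[OF \<Omega> F this] g
  show "bergman_proj \<Omega> F \<in> bergman_space \<Omega>"
    and "h \<in> bergman_space \<Omega> \<Longrightarrow> inner_L2 (lebesgue_on \<Omega>) (\<lambda>z. F z - bergman_proj \<Omega> F z) h = 0" by auto
qed


section \<open>Hankel operators with bounded symbols\<close>

text \<open>
The map \<open>I - P\<close>, so that a Hankel operator is multiplication by the symbol followed by this map.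
\<close>

definition proj_residual :: "(complex ^ 'k) set \<Rightarrow> (complex ^ 'k \<Rightarrow> complex) \<Rightarrow> complex ^ 'k \<Rightarrow> complex" where
  "proj_residual \<Omega> F = (\<lambda>z. F z - bergman_proj \<Omega> F z)"

lemma hankel_eq_proj_residual: "hankel \<Omega> \<psi> f = proj_residual \<Omega> (\<lambda>z. \<psi> z * f z)"
  by (simp add: hankel_def proj_residual_def)

lemma proj_residual_L2:
  assumes "open \<Omega>" "L2_fun (lebesgue_on \<Omega>) F"
  shows "L2_fun (lebesgue_on \<Omega>) (proj_residual \<Omega> F)"
  unfolding proj_residual_def using assms bergman_proj(1) bergman_spaceD(2) by (intro L2_fun_diff) auto

lemma proj_residual_orthogonal:
  assumes "open \<Omega>" "L2_fun (lebesgue_on \<Omega>) F" "h \<in> bergman_space \<Omega>"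
  shows "inner_L2 (lebesgue_on \<Omega>) (proj_residual \<Omega> F) h = 0" "inner_L2 (lebesgue_on \<Omega>) h (proj_residual \<Omega> F) = 0"
  using bergman_proj(2)[OF assms] inner_L2_cnj[of "lebesgue_on \<Omega>" "proj_residual \<Omega> F" h]
  by (simp_all add: proj_residual_def)

text \<open>
The orthogonal decomposition is unique, so \<open>(I - P) F\<close> is recognized by its two defining properties.
\<close>

lemma proj_residual_eqI:
  assumes "open \<Omega>" "L2_fun (lebesgue_on \<Omega>) F"
    and "(\<lambda>z. F z - G z) \<in> bergman_space \<Omega>"
    and "\<And>h. h \<in> bergman_space \<Omega> \<Longrightarrow> inner_L2 (lebesgue_on \<Omega>) G h = 0"
  shows "proj_residual \<Omega> F = G"
proof -
  have "bergman_proj \<Omega> F = (\<lambda>z. F z - G z)"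
    by (rule bergman_proj_unique) (use assms in auto)
  then show ?thesis by (simp add: proj_residual_def)
qed

lemma proj_residual_add_cmult:
  assumes \<Omega>: "open \<Omega>" and F: "L2_fun (lebesgue_on \<Omega>) F" and G: "L2_fun (lebesgue_on \<Omega>) G"
  shows "proj_residual \<Omega> (\<lambda>z. F z + c * G z) = (\<lambda>z. proj_residual \<Omega> F z + c * proj_residual \<Omega> G z)"
proof (rule proj_residual_eqI[OF \<Omega>])
  show "L2_fun (lebesgue_on \<Omega>) (\<lambda>z. F z + c * G z)" by (rule L2_fun_add_cmult[OF F G])
  have "(\<lambda>z. bergman_proj \<Omega> F z + c * bergman_proj \<Omega> G z) \<in> bergman_space \<Omega>"
    by (rule bergman_space_add_cmult[OF bergman_proj(1)[OF \<Omega> F] bergman_proj(1)[OF \<Omega> G]])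
  then show "(\<lambda>z. F z + c * G z - (proj_residual \<Omega> F z + c * proj_residual \<Omega> G z)) \<in> bergman_space \<Omega>"
    by (simp add: proj_residual_def algebra_simps)
  fix h assume h: "h \<in> bergman_space \<Omega>"
  show "inner_L2 (lebesgue_on \<Omega>) (\<lambda>z. proj_residual \<Omega> F z + c * proj_residual \<Omega> G z) h = 0"
    using proj_residual_orthogonal(1)[OF \<Omega> F h] proj_residual_orthogonal(1)[OF \<Omega> G h]
    by (subst inner_L2_add_left) (use proj_residual_L2 \<Omega> F G bergman_spaceD(2)[OF h] in auto)
qed

lemma proj_residual_norm_le:
  assumes \<Omega>: "open \<Omega>" and F: "L2_fun (lebesgue_on \<Omega>) F"
  shows "norm_L2 (lebesgue_on \<Omega>) (proj_residual \<Omega> F) \<le> norm_L2 (lebesgue_on \<Omega>) F"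
proof -
  let ?M = "lebesgue_on \<Omega>"
  have P: "bergman_proj \<Omega> F \<in> bergman_space \<Omega>" by (rule bergman_proj(1)[OF \<Omega> F])
  have "(norm_L2 ?M F)\<^sup>2 = (norm_L2 ?M (\<lambda>z. proj_residual \<Omega> F z + 1 * bergman_proj \<Omega> F z))\<^sup>2"
    by (simp add: proj_residual_def)
  also have "\<dots> = (norm_L2 ?M (proj_residual \<Omega> F))\<^sup>2 + (norm_L2 ?M (bergman_proj \<Omega> F))\<^sup>2"
    by (subst norm_L2_sq_add_cmult[OF proj_residual_L2[OF \<Omega> F] bergman_spaceD(2)[OF P]])
       (simp add: proj_residual_orthogonal(1)[OF \<Omega> F P])
  finally have "(norm_L2 ?M (proj_residual \<Omega> F))\<^sup>2 \<le> (norm_L2 ?M F)\<^sup>2" by simp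
  then show ?thesis by (rule power2_le_imp_le) simp
qed

text \<open>
The bound \<open>B\<close> is any upper bound of \<open>\<bar>\<psi>\<bar>\<close>; inside the locale \<open>s\<close> is the operator norm of the Hankel
operator \<open>H\<close>.
\<close>

locale bounded_symbol =
  fixes \<Omega> :: "(complex ^ 'k) set" and \<psi> :: "complex ^ 'k \<Rightarrow> complex" and B :: real
  assumes open_\<Omega>: "open \<Omega>"
    and symbol_measurable: "\<psi> \<in> borel_measurable (lebesgue_on \<Omega>)"
    and symbol_bound: "\<And>z. z \<in> \<Omega> \<Longrightarrow> cmod (\<psi> z) \<le> B"
    and bound_nonneg: "0 \<le> B"
begin

abbreviation "M \<equiv> lebesgue_on \<Omega>"
abbreviation "A2 \<equiv> bergman_space \<Omega>"
abbreviation "H \<equiv> hankel \<Omega> \<psi>"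
abbreviation "s \<equiv> hankel_norm \<Omega> \<psi>"

lemma mult_symbol:
  assumes "L2_fun M f"
  shows "L2_fun M (\<lambda>z. \<psi> z * f z)" "norm_L2 M (\<lambda>z. \<psi> z * f z) \<le> B * norm_L2 M f"
    "L2_fun M (\<lambda>z. cnj (\<psi> z) * f z)"
  using L2_fun_bounded_mult[OF assms symbol_measurable, of B] symbol_bound bound_nonneg
    L2_fun_bounded_mult(1)[OF assms borel_measurable_cnj[OF symbol_measurable], of B] by auto

lemma inner_L2_mult_symbol: "inner_L2 M (\<lambda>z. \<psi> z * f z) g = inner_L2 M f (\<lambda>z. cnj (\<psi> z) * g z)"
  by (simp add: inner_L2_def mult.commute mult.left_commute)

lemma hankel_L2: "f \<in> A2 \<Longrightarrow> L2_fun M (H f)"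
  unfolding hankel_eq_proj_residual
  using proj_residual_L2[OF open_\<Omega>] mult_symbol(1) bergman_spaceD(2) by blast

lemma hankel_orthogonal:
  assumes "f \<in> A2" "h \<in> A2"
  shows "inner_L2 M (H f) h = 0" "inner_L2 M h (H f) = 0"
  unfolding hankel_eq_proj_residual
  using proj_residual_orthogonal[OF open_\<Omega> mult_symbol(1)[OF bergman_spaceD(2)] ] assms by auto

lemma hankel_add_cmult:
  assumes "f \<in> A2" "g \<in> A2"
  shows "H (\<lambda>z. f z + c * g z) = (\<lambda>z. H f z + c * H g z)"
  using proj_residual_add_cmult[OF open_\<Omega> mult_symbol(1)[OF bergman_spaceD(2)] mult_symbol(1)[OF bergman_spaceD(2)],
      OF assms, of c]
  by (simp add: hankel_eq_proj_residual algebra_simps)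

lemma hankel_cmult:
  assumes "f \<in> A2"
  shows "H (\<lambda>z. c * f z) = (\<lambda>z. c * H f z)"
proof -
  have "H (\<lambda>z. 0) = (\<lambda>z. 0)"
    using hankel_add_cmult[OF zero_in_bergman_space zero_in_bergman_space, of "-1"] by (simp add: fun_eq_iff)
  then show ?thesis using hankel_add_cmult[OF zero_in_bergman_space assms, of c] by simp
qed

lemma norm_hankel_le_symbol_bound:
  assumes "f \<in> A2" shows "norm_L2 M (H f) \<le> B * norm_L2 M f"
  unfolding hankel_eq_proj_residual
  using proj_residual_norm_le[OF open_\<Omega> mult_symbol(1)] mult_symbol(2) bergman_spaceD(2)[OF assms]
  by (meson order_trans)

text \<open>
Since \<open>H f\<close> is orthogonal to the Bergman space, the projection in \<open>H u\<close> does not contribute.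
\<close>

lemma inner_L2_hankel_left:
  assumes "u \<in> A2" "f \<in> A2"
  shows "inner_L2 M (H u) (H f) = inner_L2 M u (\<lambda>z. cnj (\<psi> z) * H f z)"
proof -
  have u: "L2_fun M (\<lambda>z. \<psi> z * u z)" using mult_symbol(1) bergman_spaceD(2) assms by blast
  have P: "bergman_proj \<Omega> (\<lambda>z. \<psi> z * u z) \<in> A2" by (rule bergman_proj(1)[OF open_\<Omega> u])
  have "inner_L2 M (H u) (H f) = inner_L2 M (\<lambda>z. \<psi> z * u z) (H f) - inner_L2 M (bergman_proj \<Omega> (\<lambda>z. \<psi> z * u z)) (H f)"
    unfolding hankel_def[of _ _ u]
    by (rule inner_L2_diff_left) (use u P bergman_spaceD(2) hankel_L2[OF assms(2)] in auto)
  then show ?thesis using hankel_orthogonal(2)[OF assms(2) P] by (simp add: inner_L2_mult_symbol)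
qed

text \<open>
The adjoint applied to \<open>H f\<close> is the projection of \<open>cnj \<psi> * H f\<close>. Only vectors in the range of \<open>H\<close>
are considered, because \<open>H\<^sup>* H\<close> is the operator of interest.
\<close>

lemma hankel_adjoint_hankel:
  assumes f: "f \<in> A2"
  shows "hankel_adjoint \<Omega> \<psi> (H f) \<in> A2"
    and "u \<in> A2 \<Longrightarrow> inner_L2 M u (hankel_adjoint \<Omega> \<psi> (H f)) = inner_L2 M (H u) (H f)"
proof -
  let ?G = "\<lambda>z. cnj (\<psi> z) * H f z"
  have G: "L2_fun M ?G" by (rule mult_symbol(3)[OF hankel_L2[OF f]])
  let ?h = "bergman_proj \<Omega> ?G"
  have h: "?h \<in> A2" by (rule bergman_proj(1)[OF open_\<Omega> G])
  have eq: "inner_L2 M (H u) (H f) = inner_L2 M u ?h" if u: "u \<in> A2" for u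
  proof -
    have "inner_L2 M u (proj_residual \<Omega> ?G) = inner_L2 M u ?G - inner_L2 M u ?h"
      unfolding proj_residual_def by (rule inner_L2_diff_right) (use G h u bergman_spaceD(2) in auto)
    then show ?thesis using proj_residual_orthogonal(2)[OF open_\<Omega> G u] inner_L2_hankel_left[OF u f] by simp
  qed
  have "hankel_adjoint \<Omega> \<psi> (H f) = ?h"
    unfolding hankel_adjoint_def L2_inner_eq
  proof (rule the_equality)
    fix k assume k: "k \<in> A2 \<and> (\<forall>u\<in>A2. inner_L2 M (H u) (H f) = inner_L2 M u k)"
    let ?d = "\<lambda>z. k z - ?h z"
    have d: "?d \<in> A2" using h k by (auto intro: bergman_space_diff)
    have "inner_L2 M ?d ?d = inner_L2 M ?d k - inner_L2 M ?d ?h"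
      by (rule inner_L2_diff_right) (use k h d bergman_spaceD(2) in auto)
    also have "\<dots> = 0" using k d eq[OF d] by simp
    finally have "norm_L2 M ?d = 0" by (simp add: inner_L2_self)
    then have "?d = (\<lambda>z. 0)" using bergman_space_norm_eq_0[OF open_\<Omega> d] by blast
    then show "k = ?h" by (auto simp: fun_eq_iff)
  qed (use h eq in auto)
  then show "hankel_adjoint \<Omega> \<psi> (H f) \<in> A2"
    and "u \<in> A2 \<Longrightarrow> inner_L2 M u (hankel_adjoint \<Omega> \<psi> (H f)) = inner_L2 M (H u) (H f)"
    using h eq by auto
qed

lemma hankel_norm_set_bdd_nonempty:
  shows "bdd_above {norm_L2 M (H f) | f. f \<in> A2 \<and> norm_L2 M f \<le> 1}"
    and "{norm_L2 M (H f) | f. f \<in> A2 \<and> norm_L2 M f \<le> 1} \<noteq> {}"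
proof -
  have "norm_L2 M (H f) \<le> B" if "f \<in> A2" "norm_L2 M f \<le> 1" for f
    using norm_hankel_le_symbol_bound[OF that(1)] mult_left_mono[OF that(2) bound_nonneg] by simp
  then show "bdd_above {norm_L2 M (H f) | f. f \<in> A2 \<and> norm_L2 M f \<le> 1}"
    by (intro bdd_aboveI[of _ B]) auto
  have "norm_L2 M (\<lambda>z. 0) \<le> 1" by (simp add: norm_L2_def)
  then show "{norm_L2 M (H f) | f. f \<in> A2 \<and> norm_L2 M f \<le> 1} \<noteq> {}"
    using zero_in_bergman_space by blast
qed

lemma hankel_norm_nonneg: "0 \<le> s"
proof -
  have z: "norm_L2 M (\<lambda>z. 0) \<le> 1" by (simp add: norm_L2_def)
  have "norm_L2 M (H (\<lambda>z. 0)) \<le> s"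
    unfolding hankel_norm_def L2_norm_on_eq
    by (rule cSup_upper[OF _ hankel_norm_set_bdd_nonempty(1)]) (use z zero_in_bergman_space in blast)
  then show ?thesis using norm_L2_nonneg order_trans by blast
qed

lemma hankel_norm_least:
  assumes "\<And>f. f \<in> A2 \<Longrightarrow> norm_L2 M f \<le> 1 \<Longrightarrow> norm_L2 M (H f) \<le> c"
  shows "s \<le> c"
  unfolding hankel_norm_def L2_norm_on_eq
  by (rule cSup_least[OF hankel_norm_set_bdd_nonempty(2)]) (use assms in blast)

lemma norm_L2_hankel_le:
  assumes u: "u \<in> A2"
  shows "norm_L2 M (H u) \<le> s * norm_L2 M u"
proof (cases "norm_L2 M u = 0")
  case True
  then show ?thesis using norm_hankel_le_symbol_bound[OF u] by simp
next
  case False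
  then have pos: "norm_L2 M u > 0" by (simp add: less_le)
  let ?c = "of_real (1 / norm_L2 M u) :: complex"
  have "norm_L2 M (\<lambda>z. ?c * u z) \<le> 1" unfolding norm_L2_cmult using pos by (simp add: norm_divide)
  then have "norm_L2 M (H (\<lambda>z. ?c * u z)) \<le> s"
    unfolding hankel_norm_def L2_norm_on_eq
    using bergman_space_cmult[OF u, of ?c] by (intro cSup_upper[OF _ hankel_norm_set_bdd_nonempty(1)]) blast
  then have "1 / norm_L2 M u * norm_L2 M (H u) \<le> s"
    unfolding hankel_cmult[OF u] norm_L2_cmult using pos by (simp add: norm_divide)
  then show ?thesis using pos by (simp add: field_simps)
qed

text \<open>
Stated homogeneously, without normalizing \<open>f\<close>, so that the case \<open>s = 0\<close> is not special. If every
\<open>f\<close> of nonzero norm failed, \<open>sqrt (s\<^sup>2 - \<epsilon>)\<close> would be a smaller bound for the operator norm.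
\<close>

lemma hankel_near_maximizer:
  assumes nontrivial: "\<exists>f\<in>A2. norm_L2 M f \<noteq> 0" and e: "\<epsilon> > 0"
  shows "\<exists>f\<in>A2. norm_L2 M f > 0 \<and> s\<^sup>2 * (norm_L2 M f)\<^sup>2 - (norm_L2 M (H f))\<^sup>2 \<le> \<epsilon> * (norm_L2 M f)\<^sup>2"
proof (rule ccontr)
  assume "\<not> ?thesis"
  then have c: "(norm_L2 M (H f))\<^sup>2 < (s\<^sup>2 - \<epsilon>) * (norm_L2 M f)\<^sup>2" if "f \<in> A2" "norm_L2 M f > 0" for f
    using that by (force simp: algebra_simps not_le)
  obtain f0 where f0: "f0 \<in> A2" "norm_L2 M f0 > 0" using nontrivial by (metis norm_L2_nonneg less_le)
  have "0 < (s\<^sup>2 - \<epsilon>) * (norm_L2 M f0)\<^sup>2" using c[OF f0] zero_le_power2[of "norm_L2 M (H f0)"] by linarith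
  then have pos: "s\<^sup>2 - \<epsilon> > 0" using f0 by (simp add: zero_less_mult_iff)
  have "s \<le> sqrt (s\<^sup>2 - \<epsilon>)"
  proof (rule hankel_norm_least)
    fix f assume f: "f \<in> A2" "norm_L2 M f \<le> 1"
    have "(norm_L2 M (H f))\<^sup>2 \<le> s\<^sup>2 - \<epsilon>"
    proof (cases "norm_L2 M f = 0")
      case True
      then show ?thesis using norm_L2_hankel_le[OF f(1)] pos by (simp add: order_antisym[OF _ norm_L2_nonneg])
    next
      case False
      then have "(norm_L2 M (H f))\<^sup>2 \<le> (s\<^sup>2 - \<epsilon>) * (norm_L2 M f)\<^sup>2" using c[OF f(1)] by (simp add: less_le)
      also have "\<dots> \<le> (s\<^sup>2 - \<epsilon>) * 1" using pos f(2) by (intro mult_left_mono) (auto simp: power_le_one)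
      finally show ?thesis by simp
    qed
    then show "norm_L2 M (H f) \<le> sqrt (s\<^sup>2 - \<epsilon>)" by (rule real_le_rsqrt)
  qed
  then have "s\<^sup>2 \<le> (sqrt (s\<^sup>2 - \<epsilon>))\<^sup>2" using hankel_norm_nonneg by (intro power_mono)
  then show False using pos e by simp
qed

text \<open>
The form \<open>Q(f, u) = s\<^sup>2 \<langle>f, u\<rangle> - \<langle>H f, H u\<rangle>\<close> is positive semidefinite because \<open>s\<close> is the norm of \<open>H\<close>, and
\<open>Q(f, f)\<close> is small by assumption; its Cauchy-Schwarz inequality makes \<open>Q(f, u)\<close> small for all \<open>u\<close>.
\<close>

lemma near_maximizer_weak_eigenvector:
  assumes f: "f \<in> A2" and u: "u \<in> A2" and e: "\<epsilon> \<ge> 0"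
    and near: "s\<^sup>2 * (norm_L2 M f)\<^sup>2 - (norm_L2 M (H f))\<^sup>2 \<le> \<epsilon> * (norm_L2 M f)\<^sup>2"
  shows "cmod (inner_L2 M (H u) (H f) - of_real (s\<^sup>2) * inner_L2 M u f) \<le> sqrt \<epsilon> * s * norm_L2 M f * norm_L2 M u"
proof -
  let ?z = "of_real (s\<^sup>2) * inner_L2 M f u - inner_L2 M (H f) (H u)"
  let ?Q = "\<lambda>f. s\<^sup>2 * (norm_L2 M f)\<^sup>2 - (norm_L2 M (H f))\<^sup>2"
  have Q0: "?Q g \<ge> 0" if "g \<in> A2" for g
  proof -
    have "(norm_L2 M (H g))\<^sup>2 \<le> (s * norm_L2 M g)\<^sup>2" using norm_L2_hankel_le[OF that] by (intro power_mono) auto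
    then show ?thesis by (simp add: power_mult_distrib)
  qed
  have "(cmod ?z)\<^sup>2 \<le> ?Q f * ?Q u"
  proof (rule nonneg_quadratic_imp_discriminant)
    fix c
    have "?Q (\<lambda>z. f z + c * u z) = ?Q f + 2 * Re (cnj c * ?z) + (cmod c)\<^sup>2 * ?Q u"
      unfolding hankel_add_cmult[OF f u]
        norm_L2_sq_add_cmult[OF bergman_spaceD(2)[OF f] bergman_spaceD(2)[OF u]]
        norm_L2_sq_add_cmult[OF hankel_L2[OF f] hankel_L2[OF u]]
      by (simp add: algebra_simps)
    then show "0 \<le> ?Q f + 2 * Re (cnj c * ?z) + (cmod c)\<^sup>2 * ?Q u"
      using Q0[OF bergman_space_add_cmult[OF f u, of c]] by simp
  qed (rule Q0[OF u])
  also have "\<dots> \<le> (\<epsilon> * (norm_L2 M f)\<^sup>2) * (s\<^sup>2 * (norm_L2 M u)\<^sup>2)"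
    using near Q0[OF f] Q0[OF u] e by (intro mult_mono) auto
  also have "\<dots> = (sqrt \<epsilon> * s * norm_L2 M f * norm_L2 M u)\<^sup>2"
    using e by (simp add: power_mult_distrib)
  finally have "cmod ?z \<le> sqrt \<epsilon> * s * norm_L2 M f * norm_L2 M u"
    by (rule power2_le_imp_le) (use e hankel_norm_nonneg in simp)
  moreover have "inner_L2 M (H u) (H f) - of_real (s\<^sup>2) * inner_L2 M u f = - cnj ?z"
    by (simp add: inner_L2_cnj)
  ultimately show ?thesis by (simp only: norm_minus_cancel complex_mod_cnj)
qed

end

text \<open>
Hankel operators depend linearly on the symbol and \<open>I - P\<close> is a contraction, so the operator norm
is 1-Lipschitz in the supremum norm of the symbol.
\<close>

lemma hankel_norm_perturb:
  assumes "bounded_symbol \<Omega> p B" "bounded_symbol \<Omega> q B'"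
    and d: "\<And>z. z \<in> \<Omega> \<Longrightarrow> cmod (p z - q z) \<le> \<delta>" "0 \<le> \<delta>"
  shows "\<bar>hankel_norm \<Omega> p - hankel_norm \<Omega> q\<bar> \<le> \<delta>"
proof -
  have *: "hankel_norm \<Omega> p \<le> hankel_norm \<Omega> q + \<delta>"
    if p: "bounded_symbol \<Omega> p B" and q: "bounded_symbol \<Omega> q B'"
      and d: "\<And>z. z \<in> \<Omega> \<Longrightarrow> cmod (p z - q z) \<le> \<delta>"
    for p q B B'
  proof -
    interpret p: bounded_symbol \<Omega> p B by (rule p)
    interpret q: bounded_symbol \<Omega> q B' by (rule q)
    let ?M = "lebesgue_on \<Omega>"
    show ?thesis
    proof (rule p.hankel_norm_least)
      fix f assume f: "f \<in> bergman_space \<Omega>" "norm_L2 ?M f \<le> 1"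
      let ?d = "\<lambda>z. (p z - q z) * f z"
      have m: "(\<lambda>z. p z - q z) \<in> borel_measurable ?M"
        using p.symbol_measurable q.symbol_measurable by measurable
      have L: "L2_fun ?M ?d" "norm_L2 ?M ?d \<le> \<delta> * norm_L2 ?M f"
        using L2_fun_bounded_mult[OF bergman_spaceD(2)[OF f(1)] m] d assms(4) by auto
      have "(\<lambda>z. p z * f z) = (\<lambda>z. q z * f z + 1 * ?d z)" by (simp add: algebra_simps)
      then have "hankel \<Omega> p f = (\<lambda>z. hankel \<Omega> q f z + 1 * proj_residual \<Omega> ?d z)"
        unfolding hankel_eq_proj_residual
        using proj_residual_add_cmult[OF p.open_\<Omega> q.mult_symbol(1)[OF bergman_spaceD(2)[OF f(1)]] L(1), of 1]
        by simp
      then have "norm_L2 ?M (hankel \<Omega> p f) \<le> norm_L2 ?M (hankel \<Omega> q f) + norm_L2 ?M (proj_residual \<Omega> ?d)"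
        using norm_L2_triangle[OF q.hankel_L2[OF f(1)] proj_residual_L2[OF p.open_\<Omega> L(1)]] by simp
      also have "\<dots> \<le> hankel_norm \<Omega> q * norm_L2 ?M f + \<delta> * norm_L2 ?M f"
        using q.norm_L2_hankel_le[OF f(1)] proj_residual_norm_le[OF p.open_\<Omega> L(1)] L(2) by linarith
      also have "\<dots> \<le> (hankel_norm \<Omega> q + \<delta>) * 1"
        unfolding distrib_right[symmetric]
        using f(2) q.hankel_norm_nonneg assms(4) by (intro mult_left_mono) auto
      finally show "norm_L2 ?M (hankel \<Omega> p f) \<le> hankel_norm \<Omega> q + \<delta>" by simp
    qed
  qed
  from *[OF assms(1,2) d(1)] *[OF assms(2,1)] d(1)
  show ?thesis by (fastforce simp: norm_minus_commute abs_le_iff)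
qed


section \<open>Fubini on the polydisc\<close>

definition drop_coord :: "complex ^ ('m::finite) option \<Rightarrow> complex ^ 'm" where
  "drop_coord v = (\<chi> j. v $ Some j)"

lemma append_coord_nth [simp]:
  "append_coord z w $ Some j = z $ j" "append_coord z w $ None = w"
  by (simp_all add: append_coord_def)

lemma drop_append [simp]: "drop_coord (append_coord z w) = z"
  by (simp add: drop_coord_def vec_eq_iff)

lemma append_drop [simp]: "append_coord (drop_coord v) (v $ None) = v"
proof -
  have "append_coord (drop_coord v) (v $ None) $ i = v $ i" for i
    by (cases i) (simp_all add: drop_coord_def)
  then show ?thesis by (simp add: vec_eq_iff)
qed

lemma append_coord_cases: obtains z w where "v = append_coord z w"
  using append_drop by metis

lemma append_coord_eq_iff [simp]: "append_coord z w = append_coord z' w' \<longleftrightarrow> z = z' \<and> w = w'"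
  by (metis drop_append append_coord_nth(2))

lemma sum_UNIV_option: "(\<Sum>i\<in>(UNIV :: 'm::finite option set). f i) = f None + (\<Sum>j\<in>UNIV. f (Some j))"
  by (simp add: UNIV_option_conv sum.reindex)

lemma inner_append_coord: "append_coord z w \<bullet> append_coord z' w' = z \<bullet> z' + w \<bullet> w'"
  by (simp add: inner_vec_def sum_UNIV_option)

lemma append_coord_diff: "append_coord z w - append_coord z' w' = append_coord (z - z') (w - w')"
proof -
  have "(append_coord z w - append_coord z' w') $ i = append_coord (z - z') (w - w') $ i" for i
    by (cases i) simp_all
  then show ?thesis by (simp add: vec_eq_iff)
qed

lemma axis_Some: "axis (Some i) x = append_coord (axis i x) 0"
proof -
  have "axis (Some i) x $ j = append_coord (axis i x) 0 $ j" for j by (cases j) (auto simp: axis_def)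
  then show ?thesis by (simp add: vec_eq_iff)
qed

lemma axis_None: "axis None x = append_coord 0 x"
  unfolding vec_eq_iff
proof
  fix j show "axis None x $ j = append_coord 0 x $ j" by (cases j) (auto simp: axis_def)
qed

text \<open>
The standard basis splits into the vectors living in the first coordinates and those in the last
one. All comparisons of boxes and their volumes below rest on this splitting.
\<close>

lemma Basis_append_coord:
  "(Basis :: (complex ^ ('m::finite) option) set)
     = (\<lambda>b. append_coord b 0) ` Basis \<union> (\<lambda>b. append_coord 0 b) ` Basis"
proof -
  have "(Basis :: (complex ^ 'm option) set) = (\<Union>i. \<Union>u\<in>Basis. {axis i u})" by (simp add: Basis_vec_def)
  also have "\<dots> = (\<Union>i. \<Union>u\<in>Basis. {axis (Some i) u}) \<union> (\<Union>u\<in>Basis. {axis None u})"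
    by (simp add: UNIV_option_conv Un_commute)
  also have "\<dots> = (\<lambda>b. append_coord b 0) ` Basis \<union> (\<lambda>b. append_coord 0 b) ` Basis"
    unfolding axis_Some axis_None Basis_vec_def by blast
  finally show ?thesis .
qed

lemma ball_Basis_append_coord:
  "(\<forall>b\<in>Basis. P (append_coord z w \<bullet> b) (append_coord z' w' \<bullet> b)) \<longleftrightarrow>
     (\<forall>b\<in>Basis. P (z \<bullet> b) (z' \<bullet> b)) \<and> (\<forall>b\<in>Basis. P (w \<bullet> b) (w' \<bullet> b))"
  by (simp add: Basis_append_coord ball_Un inner_append_coord)

lemma prod_Basis_append_coord:
  "(\<Prod>b\<in>Basis. append_coord z w \<bullet> b) = (\<Prod>b\<in>Basis. z \<bullet> b) * (\<Prod>b\<in>Basis. w \<bullet> b)"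
proof -
  have "(\<Prod>b\<in>Basis. append_coord z w \<bullet> b)
      = (\<Prod>b\<in>(\<lambda>b. append_coord b 0) ` Basis. append_coord z w \<bullet> b) *
        (\<Prod>b\<in>(\<lambda>b. append_coord 0 b) ` Basis. append_coord z w \<bullet> b)"
    unfolding Basis_append_coord by (rule prod.union_disjoint) (auto simp: nonzero_Basis)
  also have "\<dots> = (\<Prod>b\<in>Basis. z \<bullet> b) * (\<Prod>b\<in>Basis. w \<bullet> b)"
    by (simp add: prod.reindex inj_on_def inner_append_coord)
  finally show ?thesis .
qed

lemma continuous_on_append_coord:
  assumes "continuous_on A f" "continuous_on A g"
  shows "continuous_on A (\<lambda>x. append_coord (f x) (g x))"
  unfolding append_coord_def
proof (rule continuous_on_vec_lambda)
  fix i show "continuous_on A (\<lambda>x. case i of Some j \<Rightarrow> f x $ j | None \<Rightarrow> g x)"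
    by (cases i) (auto intro!: continuous_intros assms)
qed

lemma borel_measurable_append_coord [measurable]:
  "(\<lambda>(w, z). append_coord z w) \<in> borel_measurable (borel \<Otimes>\<^sub>M borel)"
proof -
  have "continuous_on UNIV (\<lambda>(w, z). append_coord z w)"
    unfolding case_prod_unfold by (intro continuous_on_append_coord continuous_intros)
  then show ?thesis unfolding borel_prod by (rule borel_measurable_continuous_onI)
qed

text \<open>
Boxes in the larger space are products of boxes, and Lebesgue measure is determined by its values on
boxes. The last coordinate comes first in the product because it is the variable of the outer
integral in the applications.
\<close>

lemma lborel_append_coord:
  "distr (lborel \<Otimes>\<^sub>M lborel) borel (\<lambda>(w, z). append_coord z w) = (lborel :: (complex ^ ('m::finite) option) measure)"
proof (rule lborel_eqI[symmetric])
  fix l u :: "complex ^ 'm option"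
  obtain la lb ua ub where l: "l = append_coord la lb" and u: "u = append_coord ua ub"
    by (metis append_coord_cases)
  assume "\<And>b. b \<in> Basis \<Longrightarrow> l \<bullet> b \<le> u \<bullet> b"
  then have "\<forall>b\<in>Basis. l \<bullet> b \<le> u \<bullet> b" by blast
  then have le: "\<forall>b\<in>Basis. la \<bullet> b \<le> ua \<bullet> b" "\<forall>b\<in>Basis. lb \<bullet> b \<le> ub \<bullet> b"
    unfolding l u ball_Basis_append_coord by auto
  have box: "append_coord z w \<in> box l u \<longleftrightarrow> z \<in> box la ua \<and> w \<in> box lb ub" for z w
    unfolding l u mem_box ball_conj_distrib ball_Basis_append_coord by auto
  have "emeasure (distr (lborel \<Otimes>\<^sub>M lborel) borel (\<lambda>(w, z). append_coord z w)) (box l u)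
      = emeasure (lborel \<Otimes>\<^sub>M lborel) (box lb ub \<times> box la ua)"
    by (subst emeasure_distr) (auto simp: box space_pair_measure intro!: arg_cong[where f="emeasure _"])
  also have "\<dots> = emeasure lborel (box lb ub) * emeasure lborel (box la ua)"
    by (rule lborel.emeasure_pair_measure_Times) auto
  also have "\<dots> = ennreal (\<Prod>b\<in>Basis. (u - l) \<bullet> b)"
    unfolding l u append_coord_diff prod_Basis_append_coord
    using le by (simp add: emeasure_lborel_box ennreal_mult' prod_nonneg inner_diff_left mult.commute)
  finally show "emeasure (distr (lborel \<Otimes>\<^sub>M lborel) borel (\<lambda>(w, z). append_coord z w)) (box l u)
      = ennreal (\<Prod>b\<in>Basis. (u - l) \<bullet> b)" .
qed simp

lemma integrable_append_coord:
  fixes F :: "complex ^ ('m::finite) option \<Rightarrow> 'b::{banach, second_countable_topology}"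
  assumes "integrable lborel F"
  shows "integrable (lborel \<Otimes>\<^sub>M lborel) (\<lambda>(w, z). F (append_coord z w))"
proof -
  have "integrable (distr (lborel \<Otimes>\<^sub>M lborel) borel (\<lambda>(w, z). append_coord z w)) F"
    using assms by (simp add: lborel_append_coord)
  then have "integrable (lborel \<Otimes>\<^sub>M lborel) (\<lambda>x. F ((\<lambda>(w, z). append_coord z w) x))"
    by (rule integrable_distr[rotated]) measurable
  then show ?thesis by (simp add: case_prod_unfold)
qed

lemma Fubini_append_coord:
  fixes F :: "complex ^ ('m::finite) option \<Rightarrow> 'b::{banach, second_countable_topology}"
  assumes F: "integrable lborel F"
  shows "AE w in lborel. integrable lborel (\<lambda>z. F (append_coord z w))"
    and "integrable lborel (\<lambda>w. LINT z|lborel. F (append_coord z w))"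
    and "(LINT v|lborel. F v) = (LINT w|lborel. LINT z|lborel. F (append_coord z w))"
proof -
  note i = integrable_append_coord[OF F]
  show "AE w in lborel. integrable lborel (\<lambda>z. F (append_coord z w))"
    using lborel_pair.AE_integrable_fst'[OF i] by simp
  show "integrable lborel (\<lambda>w. LINT z|lborel. F (append_coord z w))"
    using lborel_pair.integrable_fst'[OF i] by simp
  have "(LINT v|lborel. F v) = (LINT v|distr (lborel \<Otimes>\<^sub>M lborel) borel (\<lambda>(w, z). append_coord z w). F v)"
    by (simp add: lborel_append_coord)
  also have "\<dots> = (LINT x|(lborel \<Otimes>\<^sub>M lborel). F ((\<lambda>(w, z). append_coord z w) x))"
    by (rule integral_distr) (use F in measurable)
  also have "\<dots> = (LINT x|(lborel \<Otimes>\<^sub>M lborel). (\<lambda>(w, z). F (append_coord z w)) x)"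
    by (simp add: case_prod_unfold)
  also have "\<dots> = (LINT w|lborel. LINT z|lborel. F (append_coord z w))"
    by (subst lborel_pair.integral_fst'[OF i, symmetric]) simp
  finally show "(LINT v|lborel. F v) = (LINT w|lborel. LINT z|lborel. F (append_coord z w))" .
qed

text \<open>
Functions of this kind have the same integrals over \<open>\<Omega>\<close> with completed Lebesgue measure as over
the whole space with \<open>lborel\<close>; the latter is the setting in which Fubini's theorem applies.
\<close>

definition supported_on :: "('a::topological_space \<Rightarrow> complex) \<Rightarrow> 'a set \<Rightarrow> bool" where
  "supported_on f \<Omega> \<longleftrightarrow> f \<in> borel_measurable borel \<and> (\<forall>z. z \<notin> \<Omega> \<longrightarrow> f z = 0)"

lemma integral_lebesgue_on_supported:
  fixes f :: "'a::euclidean_space \<Rightarrow> 'b::{banach, second_countable_topology}"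
  assumes "open \<Omega>" "f \<in> borel_measurable borel" "\<And>z. z \<notin> \<Omega> \<Longrightarrow> f z = 0"
  shows "integrable (lebesgue_on \<Omega>) f \<longleftrightarrow> integrable lborel f"
    and "(LINT z|lebesgue_on \<Omega>. f z) = (LINT z|lborel. f z)"
proof -
  have eq: "(\<lambda>z. indicator \<Omega> z *\<^sub>R f z) = f"
    using assms(3) by (auto simp: fun_eq_iff indicator_def)
  have \<Omega>: "\<Omega> \<inter> space lebesgue \<in> sets lebesgue" using assms(1) by simp
  show "integrable (lebesgue_on \<Omega>) f \<longleftrightarrow> integrable lborel f"
    unfolding integrable_restrict_space[OF \<Omega>] eq using assms(2) by (intro integrable_completion) simp
  show "(LINT z|lebesgue_on \<Omega>. f z) = (LINT z|lborel. f z)"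
    unfolding integral_restrict_space[OF \<Omega>] eq using assms(2) by (intro integral_completion) simp
qed

lemma supported_on_lebesgue_on:
  fixes f g :: "'a::euclidean_space \<Rightarrow> complex"
  assumes \<Omega>: "open \<Omega>" and f: "supported_on f \<Omega>"
  shows "L2_fun (lebesgue_on \<Omega>) f \<longleftrightarrow> L2_fun lborel f"
    and "norm_L2 (lebesgue_on \<Omega>) f = norm_L2 lborel f"
    and "g \<in> borel_measurable borel \<Longrightarrow> inner_L2 (lebesgue_on \<Omega>) f g = inner_L2 lborel f g"
    and "g \<in> borel_measurable borel \<Longrightarrow> inner_L2 (lebesgue_on \<Omega>) g f = inner_L2 lborel g f"
proof -
  have [measurable]: "f \<in> borel_measurable borel" and z: "\<And>z. z \<notin> \<Omega> \<Longrightarrow> f z = 0"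
    using f by (auto simp: supported_on_def)
  have "f \<in> borel_measurable lebesgue" by (simp add: measurable_completion)
  then have m: "f \<in> borel_measurable (lebesgue_on \<Omega>)" by (rule measurable_restrict_space1)
  note * = integral_lebesgue_on_supported[OF \<Omega>, of "\<lambda>z. (cmod (f z))\<^sup>2"]
  show "L2_fun (lebesgue_on \<Omega>) f \<longleftrightarrow> L2_fun lborel f"
    unfolding L2_fun_def using m z by (subst *) auto
  show "norm_L2 (lebesgue_on \<Omega>) f = norm_L2 lborel f"
    unfolding norm_L2_def using z by (subst *) auto
  assume [measurable]: "g \<in> borel_measurable borel"
  show "inner_L2 (lebesgue_on \<Omega>) f g = inner_L2 lborel f g" "inner_L2 (lebesgue_on \<Omega>) g f = inner_L2 lborel g f"
    unfolding inner_L2_def using z by (intro integral_lebesgue_on_supported[OF \<Omega>]; simp)+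
qed

lemma bergman_space_supported_on: "open \<Omega> \<Longrightarrow> f \<in> bergman_space \<Omega> \<Longrightarrow> supported_on f \<Omega>"
  using bergman_space_borel bergman_spaceD(3) by (auto simp: supported_on_def)

lemma supported_on_continuous_mult:
  assumes "open \<Omega>" "continuous_on \<Omega> p" "supported_on f \<Omega>"
  shows "supported_on (\<lambda>z. p z * f z) \<Omega>"
proof -
  have [measurable]: "f \<in> borel_measurable borel" using assms by (simp add: supported_on_def)
  have [measurable]: "(\<lambda>z. indicator \<Omega> z *\<^sub>R p z) \<in> borel_measurable borel"
    using assms by (intro borel_measurable_continuous_on_indicator) auto
  have "(\<lambda>z. (indicator \<Omega> z *\<^sub>R p z) * f z) \<in> borel_measurable borel" by measurable
  also have "(\<lambda>z. (indicator \<Omega> z *\<^sub>R p z) * f z) = (\<lambda>z. p z * f z)"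
    using assms(3) by (auto simp: fun_eq_iff indicator_def supported_on_def)
  finally show ?thesis using assms(3) by (auto simp: supported_on_def)
qed

lemma supported_on_diff:
  assumes "supported_on f \<Omega>" "supported_on g \<Omega>"
  shows "supported_on (\<lambda>z. f z - g z) \<Omega>"
  using assms by (auto simp: supported_on_def)

lemma open_polydisc: "open (polydisc :: (complex ^ 'k) set)"
  unfolding polydisc_def by (rule open_vector_box) simp

lemma append_coord_in_polydisc: "append_coord z w \<in> polydisc \<longleftrightarrow> z \<in> polydisc \<and> w \<in> ball 0 1"
proof -
  have "(\<forall>i. append_coord z w $ i \<in> ball 0 1) \<longleftrightarrow> (\<forall>j. z $ j \<in> ball 0 1) \<and> w \<in> ball 0 1"
    unfolding split_option_all by auto
  then show ?thesis by (simp add: polydisc_def)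
qed

lemma bounded_polydisc: "bounded (polydisc :: (complex ^ 'k) set)"
proof (rule boundedI)
  fix x :: "complex ^ 'k" assume "x \<in> polydisc"
  then have "\<And>i. norm (x $ i) \<le> 1" by (simp add: polydisc_def less_imp_le)
  then have "(\<Sum>i\<in>UNIV. norm (x $ i)) \<le> (\<Sum>i\<in>(UNIV::'k set). 1)" by (intro sum_mono)
  moreover have "norm x \<le> (\<Sum>i\<in>UNIV. norm (x $ i))"
    unfolding norm_vec_def by (rule L2_set_le_sum) simp
  ultimately show "norm x \<le> (\<Sum>i\<in>(UNIV::'k set). 1)" by linarith
qed

lemma emeasure_lborel_bounded_finite:
  assumes "bounded (A :: 'a::euclidean_space set)"
  shows "emeasure lborel A < \<infinity>"
proof -
  obtain r where "\<forall>x\<in>A. norm x \<le> r" using assms unfolding bounded_pos by (elim exE conjE)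
  then have "A \<subseteq> cball 0 r" by auto
  then show ?thesis
    by (intro le_less_trans[OF emeasure_mono emeasure_lborel_cball_finite]) auto
qed

text \<open>
The constant function 1, extended by 0, is square integrable because the polydisc is bounded.
\<close>

lemma bergman_space_polydisc_nontrivial:
  "\<exists>f\<in>bergman_space (polydisc :: (complex ^ 'k) set). norm_L2 (lebesgue_on polydisc) f \<noteq> 0"
proof -
  let ?D = "polydisc :: (complex ^ 'k) set"
  let ?f = "indicator ?D :: _ \<Rightarrow> complex"
  have "holomorphic_vec_on ?f ?D"
    unfolding holomorphic_vec_on_def
  proof
    fix z assume z: "z \<in> ?D"
    have "((\<lambda>_. 1) has_derivative (\<lambda>_. 0)) (at z)" by simp
    then have "(?f has_derivative (\<lambda>_. 0)) (at z)"
      by (rule has_derivative_transform_within_open[OF _ open_polydisc z]) simp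
    then show "\<exists>L. (?f has_derivative L) (at z) \<and> (\<forall>c v. L (c *s v) = c * L v)" by auto
  qed
  moreover have "supported_on ?f ?D"
    using borel_open[OF open_polydisc] by (auto simp: supported_on_def intro!: borel_measurable_indicator)
  moreover have "L2_fun lborel ?f"
  proof -
    have "integrable lborel (indicator ?D :: _ \<Rightarrow> real)"
      using borel_open[OF open_polydisc] emeasure_lborel_bounded_finite[OF bounded_polydisc]
      by (intro integrable_real_indicator) auto
    moreover have "(\<lambda>x. (cmod (?f x))\<^sup>2) = indicator ?D" by (auto simp: indicator_def)
    ultimately show ?thesis
      using borel_open[OF open_polydisc] by (auto simp: L2_fun_def intro!: borel_measurable_indicator)
  qed
  ultimately have f: "?f \<in> bergman_space ?D"
    using supported_on_lebesgue_on(1)[OF open_polydisc] by (auto simp: bergman_space_def square_integrable_on_eq)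
  have "0 \<in> ?D" by (simp add: polydisc_def)
  then have "?f 0 = 1" by simp
  then have "?f \<noteq> (\<lambda>z. 0)" by (metis zero_neq_one)
  with f show ?thesis using bergman_space_norm_eq_0[OF open_polydisc f] by blast
qed

definition tensor :: "(complex ^ ('m::finite) \<Rightarrow> complex) \<Rightarrow> (complex \<Rightarrow> complex) \<Rightarrow> complex ^ 'm option \<Rightarrow> complex" where
  "tensor F k v = F (drop_coord v) * k (v $ None)"

lemma tensor_append_coord [simp]: "tensor F k (append_coord z w) = F z * k w"
  by (simp add: tensor_def)

lemma tensor_supported_on:
  assumes F: "supported_on F polydisc" and k: "supported_on k (ball 0 1)"
  shows "supported_on (tensor F k) polydisc"
proof -
  have [measurable]: "F \<in> borel_measurable borel" "k \<in> borel_measurable borel"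
    using assms by (auto simp: supported_on_def)
  have [measurable]: "drop_coord \<in> borel_measurable borel"
    unfolding drop_coord_def by (intro borel_measurable_continuous_onI continuous_intros)
  have [measurable]: "(\<lambda>v. v $ None) \<in> borel_measurable (borel :: (complex ^ 'a option) measure)"
    by (intro borel_measurable_continuous_onI continuous_intros)
  have "tensor F k \<in> borel_measurable borel" unfolding tensor_def[abs_def] by measurable
  moreover have "tensor F k v = 0" if "v \<notin> polydisc" for v
    using that assms by (cases v rule: append_coord_cases) (auto simp: append_coord_in_polydisc supported_on_def)
  ultimately show ?thesis by (simp add: supported_on_def)
qed

lemma tensor_L2:
  fixes F :: "complex ^ ('m::finite) \<Rightarrow> complex"
  assumes F: "supported_on F polydisc" "L2_fun (lebesgue_on polydisc) F"
    and k: "supported_on k (ball 0 1)" "L2_fun lborel k"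
  shows "L2_fun (lebesgue_on polydisc) (tensor F k)"
    and "norm_L2 (lebesgue_on polydisc) (tensor F k) = norm_L2 (lebesgue_on polydisc) F * norm_L2 lborel k"
proof -
  have sT: "supported_on (tensor F k) polydisc" by (rule tensor_supported_on[OF F(1) k(1)])
  then have [measurable]: "tensor F k \<in> borel_measurable borel" by (simp add: supported_on_def)
  have FL: "L2_fun lborel F" using F supported_on_lebesgue_on(1)[OF open_polydisc F(1)] by simp
  have [measurable]: "F \<in> borel_measurable borel" "k \<in> borel_measurable borel"
    using F k by (auto simp: supported_on_def)
  let ?n = "norm_L2 lborel F * norm_L2 lborel k"
  have "(\<integral>\<^sup>+v. ennreal ((cmod (tensor F k v))\<^sup>2) \<partial>lborel)
      = (\<integral>\<^sup>+v. ennreal ((cmod (tensor F k v))\<^sup>2) \<partial>distr (lborel \<Otimes>\<^sub>M lborel) borel (\<lambda>(w, z). append_coord z w))"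
    by (simp add: lborel_append_coord)
  also have "\<dots> = (\<integral>\<^sup>+x. ennreal ((cmod (tensor F k (case x of (w, z) \<Rightarrow> append_coord z w)))\<^sup>2) \<partial>(lborel \<Otimes>\<^sub>M lborel))"
    by (rule nn_integral_distr) measurable
  also have "\<dots> = (\<integral>\<^sup>+x. ennreal ((cmod (k (fst x)))\<^sup>2) * ennreal ((cmod (F (snd x)))\<^sup>2) \<partial>(lborel \<Otimes>\<^sub>M lborel))"
    by (intro nn_integral_cong) (auto simp: norm_mult power_mult_distrib ennreal_mult' mult.commute)
  also have "\<dots> = (\<integral>\<^sup>+w. (\<integral>\<^sup>+z. ennreal ((cmod (k w))\<^sup>2) * ennreal ((cmod (F z))\<^sup>2) \<partial>lborel) \<partial>lborel)"
    by (subst lborel.nn_integral_fst[symmetric]) auto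
  also have "\<dots> = ennreal ((norm_L2 lborel k)\<^sup>2) * ennreal ((norm_L2 lborel F)\<^sup>2)"
    by (simp add: nn_integral_cmult nn_integral_multc nn_integral_cmod_sq[OF FL] nn_integral_cmod_sq[OF k(2)])
  also have "\<dots> = ennreal (?n\<^sup>2)" by (simp add: ennreal_mult' power_mult_distrib mult.commute)
  finally have eq: "(\<integral>\<^sup>+v. ennreal ((cmod (tensor F k v))\<^sup>2) \<partial>lborel) = ennreal (?n\<^sup>2)" .
  have L: "L2_fun lborel (tensor F k)"
    by (rule L2_fun_if_nn_integral_le[where a="?n"]) (use eq in auto)
  then show "L2_fun (lebesgue_on polydisc) (tensor F k)"
    using supported_on_lebesgue_on(1)[OF open_polydisc sT] by simp
  have "ennreal ((norm_L2 lborel (tensor F k))\<^sup>2) = ennreal (?n\<^sup>2)"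
    using nn_integral_cmod_sq[OF L] eq by simp
  then have "(norm_L2 lborel (tensor F k))\<^sup>2 = ?n\<^sup>2" by simp
  then show "norm_L2 (lebesgue_on polydisc) (tensor F k) = norm_L2 (lebesgue_on polydisc) F * norm_L2 lborel k"
    by (simp add: supported_on_lebesgue_on(2)[OF open_polydisc sT]
        supported_on_lebesgue_on(2)[OF open_polydisc F(1)] power2_eq_iff_nonneg)
qed

lemma bounded_linear_drop_coord: "bounded_linear (drop_coord :: _ \<Rightarrow> complex ^ ('m::finite))"
proof -
  have "linear (drop_coord :: _ \<Rightarrow> complex ^ 'm)"
    by (rule linearI) (simp_all add: drop_coord_def vec_eq_iff)
  then show ?thesis by (simp add: linear_conv_bounded_linear)
qed

lemma tensor_bergman_space:
  assumes f: "f \<in> bergman_space polydisc" and k: "k holomorphic_on ball 0 1"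
    "supported_on k (ball 0 1)" "L2_fun lborel k"
  shows "tensor f k \<in> bergman_space polydisc"
proof -
  have sf: "supported_on f polydisc" by (rule bergman_space_supported_on[OF open_polydisc f])
  have "holomorphic_vec_on (tensor f k) polydisc"
    unfolding holomorphic_vec_on_def
  proof
    fix v :: "complex ^ 'a option" assume v: "v \<in> polydisc"
    then have "append_coord (drop_coord v) (v $ None) \<in> polydisc" by simp
    then have d: "drop_coord v \<in> polydisc" and n: "v $ None \<in> ball 0 1"
      unfolding append_coord_in_polydisc by auto
    obtain L where L: "(f has_derivative L) (at (drop_coord v))" "\<And>c v. L (c *s v) = c * L v"
      using bergman_spaceD(1)[OF f] d unfolding holomorphic_vec_on_def by blast
    obtain D where D: "(k has_field_derivative D) (at (v $ None))"
      using k(1) n holomorphic_on_imp_differentiable_at[OF k(1) open_ball n] field_differentiable_def by blast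
    have 1: "((\<lambda>v. f (drop_coord v)) has_derivative (\<lambda>h. L (drop_coord h))) (at v)"
      using has_derivative_compose[OF bounded_linear_imp_has_derivative[OF bounded_linear_drop_coord] L(1)] .
    have "bounded_linear (\<lambda>v::complex ^ 'a option. v $ None)" by (rule bounded_linear_vec_nth)
    then have 2: "((\<lambda>v. k (v $ None)) has_derivative (\<lambda>h. D * h $ None)) (at v)"
      using has_derivative_compose[OF bounded_linear_imp_has_derivative] D
      unfolding has_field_derivative_def by blast
    have 3: "(tensor f k has_derivative (\<lambda>h. f (drop_coord v) * (D * h $ None) + L (drop_coord h) * k (v $ None))) (at v)"
      unfolding tensor_def[abs_def] by (rule has_derivative_mult[OF 1 2])
    have "drop_coord (c *s h) = c *s drop_coord h" for c and h :: "complex ^ 'a option"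
      by (simp add: drop_coord_def vec_eq_iff)
    then show "\<exists>L. (tensor f k has_derivative L) (at v) \<and> (\<forall>c v. L (c *s v) = c * L v)"
      using 3 by (intro exI[of _ "\<lambda>h. f (drop_coord v) * (D * h $ None) + L (drop_coord h) * k (v $ None)"])
        (simp add: L(2) algebra_simps)
  qed
  then show ?thesis
    using tensor_L2(1)[OF sf bergman_spaceD(2)[OF f] k(2,3)] tensor_supported_on[OF sf k(2)]
    by (simp add: bergman_space_def square_integrable_on_eq supported_on_def)
qed

definition slice :: "(complex ^ ('m::finite) option \<Rightarrow> complex) \<Rightarrow> complex \<Rightarrow> complex ^ 'm \<Rightarrow> complex" where
  "slice h w z = h (append_coord z w)"

lemma slice_supported_on:
  assumes h: "supported_on h polydisc"
  shows "supported_on (slice h w) polydisc"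
proof -
  have [measurable]: "h \<in> borel_measurable borel" using h by (simp add: supported_on_def)
  have [measurable]: "(\<lambda>z. append_coord z w) \<in> borel_measurable borel"
    by (intro borel_measurable_continuous_onI continuous_on_append_coord continuous_intros)
  have "slice h w \<in> borel_measurable borel" unfolding slice_def[abs_def] by measurable
  then show ?thesis using h by (auto simp: supported_on_def slice_def append_coord_in_polydisc)
qed

lemma slice_holomorphic:
  assumes "holomorphic_vec_on h polydisc" "\<And>v. v \<notin> polydisc \<Longrightarrow> h v = 0"
  shows "holomorphic_vec_on (slice h w) polydisc"
  unfolding holomorphic_vec_on_def
proof
  fix z :: "complex ^ 'a" assume z: "z \<in> polydisc"
  show "\<exists>L. (slice h w has_derivative L) (at z) \<and> (\<forall>c v. L (c *s v) = c * L v)"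
  proof (cases "w \<in> ball 0 1")
    case True
    then have "append_coord z w \<in> polydisc" using z by (simp add: append_coord_in_polydisc)
    then obtain L where L: "(h has_derivative L) (at (append_coord z w))" "\<And>c v. L (c *s v) = c * L v"
      using assms(1) unfolding holomorphic_vec_on_def by blast
    have sc: "append_coord (c *s v) 0 = c *s append_coord v 0" for c and v :: "complex ^ 'a"
    proof -
      have "append_coord (c *s v) 0 $ i = (c *s append_coord v 0) $ i" for i by (cases i) simp_all
      then show ?thesis by (simp add: vec_eq_iff)
    qed
    have "linear (\<lambda>v :: complex ^ 'a. append_coord v 0)"
    proof (rule linearI)
      fix u v :: "complex ^ 'a" and r :: real
      have "append_coord (u + v) 0 $ i = (append_coord u 0 + append_coord v 0) $ i" for i by (cases i) simp_all
      then show "append_coord (u + v) 0 = append_coord u 0 + append_coord v 0" by (simp add: vec_eq_iff)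
      have "append_coord (r *\<^sub>R v) 0 $ i = (r *\<^sub>R append_coord v 0) $ i" for i by (cases i) simp_all
      then show "append_coord (r *\<^sub>R v) 0 = r *\<^sub>R append_coord v 0" by (simp add: vec_eq_iff)
    qed
    then have bl: "bounded_linear (\<lambda>v :: complex ^ 'a. append_coord v 0)" by (simp add: linear_conv_bounded_linear)
    have eq: "append_coord v w = append_coord 0 w + append_coord v 0" for v :: "complex ^ 'a"
    proof -
      have "append_coord v w $ i = (append_coord 0 w + append_coord v 0) $ i" for i by (cases i) simp_all
      then show ?thesis by (simp add: vec_eq_iff)
    qed
    have "((\<lambda>v :: complex ^ 'a. append_coord 0 w + append_coord v 0) has_derivative (\<lambda>v. 0 + append_coord v 0)) (at z)"
      by (intro has_derivative_add has_derivative_const bounded_linear_imp_has_derivative bl)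
    then have "((\<lambda>v :: complex ^ 'a. append_coord v w) has_derivative (\<lambda>v. append_coord v 0)) (at z)"
      by (simp add: eq[symmetric])
    from has_derivative_compose[OF this L(1)]
    have "(slice h w has_derivative (\<lambda>v. L (append_coord v 0))) (at z)" by (simp add: slice_def[abs_def])
    then show ?thesis by (intro exI[of _ "\<lambda>v. L (append_coord v 0)"]) (simp add: sc L(2))
  next
    case False
    then have "slice h w = (\<lambda>z. 0)"
      using assms(2) append_coord_in_polydisc by (auto simp: slice_def fun_eq_iff)
    then show ?thesis by (intro exI[of _ "\<lambda>_. 0"]) auto
  qed
qed

text \<open>
All three statements are Fubini's theorem for \<open>\<bar>h\<bar>\<^sup>2\<close>. The slice norms are embedded in the complex
numbers so that the Cauchy-Schwarz inequality in the last coordinate applies to them.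
\<close>

lemma slice_bergman_space:
  fixes h :: "complex ^ ('m::finite) option \<Rightarrow> complex"
  assumes h: "h \<in> bergman_space polydisc"
  shows "AE w in lborel. slice h w \<in> bergman_space polydisc"
    and "L2_fun lborel (\<lambda>w. of_real (norm_L2 (lebesgue_on polydisc) (slice h w)))"
    and "norm_L2 lborel (\<lambda>w. of_real (norm_L2 (lebesgue_on polydisc) (slice h w))) = norm_L2 (lebesgue_on polydisc) h"
proof -
  have sh: "supported_on h polydisc" by (rule bergman_space_supported_on[OF open_polydisc h])
  note ss = slice_supported_on[OF sh]
  have "L2_fun lborel h" using bergman_spaceD(2)[OF h] supported_on_lebesgue_on(1)[OF open_polydisc sh] by simp
  then have i: "integrable lborel (\<lambda>v. (cmod (h v))\<^sup>2)" by (simp add: L2_fun_def)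
  have nn: "(norm_L2 (lebesgue_on polydisc) (slice h w))\<^sup>2 = (LINT z|lborel. (cmod (h (append_coord z w)))\<^sup>2)" for w
    unfolding supported_on_lebesgue_on(2)[OF open_polydisc ss] norm_L2_sq by (simp add: slice_def)
  show "AE w in lborel. slice h w \<in> bergman_space polydisc"
    using Fubini_append_coord(1)[OF i]
  proof eventually_elim
    case (elim w)
    have "L2_fun lborel (slice h w)"
      using elim ss[of w] by (simp add: L2_fun_def slice_def[abs_def] supported_on_def)
    then have "L2_fun (lebesgue_on polydisc) (slice h w)"
      using supported_on_lebesgue_on(1)[OF open_polydisc ss] by simp
    moreover have "holomorphic_vec_on (slice h w) polydisc"
      using bergman_spaceD[OF h] by (intro slice_holomorphic) auto
    ultimately show ?case using ss[of w] by (simp add: bergman_space_def square_integrable_on_eq supported_on_def)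
  qed
  have i2: "integrable lborel (\<lambda>w. (norm_L2 (lebesgue_on polydisc) (slice h w))\<^sup>2)"
    unfolding nn by (rule Fubini_append_coord(2)[OF i])
  then have "(\<lambda>w. sqrt ((norm_L2 (lebesgue_on polydisc) (slice h w))\<^sup>2)) \<in> borel_measurable lborel"
    by (rule measurable_compose[OF borel_measurable_integrable borel_measurable_sqrt])
  then show "L2_fun lborel (\<lambda>w. of_real (norm_L2 (lebesgue_on polydisc) (slice h w)))"
    using i2 by (simp add: L2_fun_def)
  have "(norm_L2 lborel (\<lambda>w. of_real (norm_L2 (lebesgue_on polydisc) (slice h w))))\<^sup>2
      = (LINT w|lborel. (norm_L2 (lebesgue_on polydisc) (slice h w))\<^sup>2)"
    unfolding norm_L2_sq[of lborel] by simp
  also have "\<dots> = (norm_L2 lborel h)\<^sup>2"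
    unfolding nn norm_L2_sq[of lborel] by (rule Fubini_append_coord(3)[OF i, symmetric])
  finally have "(norm_L2 lborel (\<lambda>w. of_real (norm_L2 (lebesgue_on polydisc) (slice h w))))\<^sup>2 = (norm_L2 (lebesgue_on polydisc) h)\<^sup>2"
    by (simp add: supported_on_lebesgue_on(2)[OF open_polydisc sh])
  then show "norm_L2 lborel (\<lambda>w. of_real (norm_L2 (lebesgue_on polydisc) (slice h w))) = norm_L2 (lebesgue_on polydisc) h"
    by (simp add: power2_eq_iff_nonneg)
qed

text \<open>
Fubini turns a pairing with a product into an average of pairings of slices, by which statements
about the smaller polydisc pass to the larger one.
\<close>

lemma inner_L2_tensor:
  fixes h :: "complex ^ ('m::finite) option \<Rightarrow> complex"
  assumes h: "h \<in> bergman_space polydisc"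
    and F: "supported_on F polydisc" "L2_fun (lebesgue_on polydisc) F"
    and k: "supported_on k (ball 0 1)" "L2_fun lborel k"
  shows "integrable lborel (\<lambda>w. cnj (k w) * inner_L2 (lebesgue_on polydisc) (slice h w) F)"
    and "inner_L2 (lebesgue_on polydisc) h (tensor F k)
      = (LINT w|lborel. cnj (k w) * inner_L2 (lebesgue_on polydisc) (slice h w) F)"
proof -
  have sh: "supported_on h polydisc" by (rule bergman_space_supported_on[OF open_polydisc h])
  have sT: "supported_on (tensor F k) polydisc" by (rule tensor_supported_on[OF F(1) k(1)])
  have hL: "L2_fun lborel h" using bergman_spaceD(2)[OF h] supported_on_lebesgue_on(1)[OF open_polydisc sh] by simp
  have TL: "L2_fun lborel (tensor F k)"
    using tensor_L2(1)[OF F k] supported_on_lebesgue_on(1)[OF open_polydisc sT] by simp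
  note i = inner_L2_integrable[OF hL TL]
  have eq: "(LINT z|lborel. h (append_coord z w) * cnj (tensor F k (append_coord z w)))
      = cnj (k w) * inner_L2 (lebesgue_on polydisc) (slice h w) F" for w
  proof -
    have "inner_L2 (lebesgue_on polydisc) (slice h w) F = inner_L2 lborel (slice h w) F"
      using F(1) by (intro supported_on_lebesgue_on(3)[OF open_polydisc slice_supported_on[OF sh]])
        (simp add: supported_on_def)
    moreover have "(LINT z|lborel. h (append_coord z w) * cnj (tensor F k (append_coord z w)))
        = (LINT z|lborel. cnj (k w) * (slice h w z * cnj (F z)))"
      by (simp add: slice_def mult.commute mult.left_commute)
    ultimately show ?thesis by (simp add: inner_L2_def)
  qed
  show "integrable lborel (\<lambda>w. cnj (k w) * inner_L2 (lebesgue_on polydisc) (slice h w) F)"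
    using Fubini_append_coord(2)[OF i] unfolding eq .
  have "inner_L2 (lebesgue_on polydisc) h (tensor F k) = inner_L2 lborel h (tensor F k)"
    using sT by (intro supported_on_lebesgue_on(3)[OF open_polydisc sh]) (simp add: supported_on_def)
  also have "\<dots> = (LINT w|lborel. cnj (k w) * inner_L2 (lebesgue_on polydisc) (slice h w) F)"
    unfolding inner_L2_def[of lborel] Fubini_append_coord(3)[OF i] eq ..
  finally show "inner_L2 (lebesgue_on polydisc) h (tensor F k)
      = (LINT w|lborel. cnj (k w) * inner_L2 (lebesgue_on polydisc) (slice h w) F)" .
qed


section \<open>Peak functions on the disc\<close>

text \<open>
From the parallelogram law \<open>\<bar>1 + x\<bar>\<^sup>2 + \<bar>1 - x\<bar>\<^sup>2 = 2 + 2 \<bar>x\<bar>\<^sup>2\<close> at \<open>x = cnj q * w\<close>, where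
\<open>\<bar>1 - x\<bar>\<close> is the distance from \<open>w\<close> to \<open>q\<close>.
\<close>

lemma peak_far_bound:
  assumes q: "cmod q = 1" and w: "cmod w \<le> 1" "\<delta> \<le> dist w q" and d: "0 \<le> \<delta>"
  shows "(cmod ((1 + cnj q * w) / 2))\<^sup>2 \<le> 1 - \<delta>\<^sup>2 / 4"
proof -
  let ?x = "cnj q * w"
  have par: "(cmod (1 + x))\<^sup>2 + (cmod (1 - x))\<^sup>2 = 2 + 2 * (cmod x)\<^sup>2" for x
    unfolding cmod_power2 by (simp add: power2_eq_square algebra_simps)
  have "cnj q * q = 1" using q by (metis complex_norm_square mult.commute of_real_1 power_one)
  then have "1 - ?x = cnj q * (q - w)" by (simp add: algebra_simps)
  then have "cmod (1 - ?x) = dist w q" using q by (simp add: norm_mult dist_norm norm_minus_commute)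
  then have "\<delta>\<^sup>2 \<le> (cmod (1 - ?x))\<^sup>2" using w d by (intro power_mono) auto
  moreover have "(cmod ?x)\<^sup>2 \<le> 1" using q w by (simp add: norm_mult power_le_one)
  ultimately have "(cmod (1 + ?x))\<^sup>2 \<le> 4 - \<delta>\<^sup>2" using par[of ?x] by linarith
  then show ?thesis by (simp add: norm_divide power_divide)
qed

lemma peak_near_bound:
  assumes q: "cmod q = 1" and w: "dist w q \<le> \<eta>"
  shows "1 - \<eta> / 2 \<le> cmod ((1 + cnj q * w) / 2)"
proof -
  have "cnj q * q = 1" using q by (metis complex_norm_square mult.commute of_real_1 power_one)
  then have eq: "(1 + cnj q * w) / 2 = 1 - (cnj q * (q - w)) / 2" by (simp add: field_simps)
  have "cmod ((cnj q * (q - w)) / 2) \<le> \<eta> / 2"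
    using q w by (simp add: norm_mult norm_divide dist_norm norm_minus_commute)
  moreover have "1 - cmod ((cnj q * (q - w)) / 2) \<le> cmod (1 - (cnj q * (q - w)) / 2)"
    using norm_triangle_ineq2[of 1 "(cnj q * (q - w)) / 2"] by simp
  ultimately show ?thesis unfolding eq by linarith
qed

text \<open>
High powers of \<open>(1 + cnj q w) / 2\<close> carry almost all of their mass close to \<open>q\<close>: away from \<open>q\<close> their
squared modulus is at most \<open>a ^ j\<close> with \<open>a < 1\<close>, while on a fixed small ball inside the disc and near \<open>q\<close> it is at
least \<open>b ^ j\<close> with \<open>b > a\<close>, and the ratio of the two tends to 0.
\<close>

lemma peak_function:
  assumes q: "cmod q = 1" and d: "\<delta> > 0" and e: "\<epsilon> > 0"
  obtains k where "k holomorphic_on ball 0 1" "k \<in> borel_measurable borel" "\<And>w. w \<notin> ball 0 1 \<Longrightarrow> k w = 0"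
    "L2_fun lborel k" "norm_L2 lborel k > 0"
    "(norm_L2 lborel (\<lambda>w. if dist w q < \<delta> then 0 else k w))\<^sup>2 \<le> \<epsilon> * (norm_L2 lborel k)\<^sup>2"
proof -
  define a where "a = max 0 (1 - \<delta>\<^sup>2 / 4)"
  have a: "0 \<le> a" "a < 1" using d by (auto simp: a_def)
  \<comment> \<open>With this choice \<open>1 - \<eta> / 2\<close> lies halfway between \<open>sqrt a\<close> and 1.\<close>
  define \<eta> where "\<eta> = 1 - sqrt a"
  have sa: "0 \<le> sqrt a" "sqrt a < 1" using a by (auto simp: real_sqrt_lt_1_iff)
  then have \<eta>: "0 < \<eta>" "\<eta> \<le> 1" by (auto simp: \<eta>_def)
  define b where "b = (1 - \<eta> / 2)\<^sup>2"
  have "sqrt a < 1 - \<eta> / 2" unfolding \<eta>_def using sa by argo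
  then have "(sqrt a)\<^sup>2 < b" unfolding b_def using sa by (intro power_strict_mono) auto
  then have ab: "a < b" using a by simp
  then have b: "0 < b" using a by simp
  let ?N = "ball 0 1 \<inter> ball q \<eta>"
  let ?p = "of_real (1 - \<eta>/2) * q"
  have "cmod ?p < 1" using q \<eta> by (simp only: norm_mult norm_of_real) simp
  moreover have "dist q ?p < \<eta>"
  proof -
    have "q - ?p = of_real (\<eta>/2) * q" by (simp add: algebra_simps)
    then have "dist q ?p = \<eta> / 2" unfolding dist_norm using q \<eta> by (simp only: norm_mult norm_of_real)
    then show ?thesis using \<eta> by simp
  qed
  ultimately have "?p \<in> ?N" by (simp add: dist_commute)
  moreover have "open ?N" by auto
  ultimately obtain \<rho> where \<rho>: "\<rho> > 0" "ball ?p \<rho> \<subseteq> ?N" using open_contains_ball by blast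
  let ?P = "ball ?p \<rho>"
  define m0 where "m0 = measure lborel ?P"
  have m0: "m0 > 0" unfolding m0_def using \<rho>(1) by (rule content_ball_pos)
  define m1 where "m1 = measure lborel (ball (0::complex) 1)"
  have "(\<lambda>j. m1 * (a / b) ^ j) \<longlonglongrightarrow> m1 * 0"
    using a ab b by (intro tendsto_intros LIMSEQ_power_zero) (simp add: abs_of_nonneg)
  then have "\<forall>\<^sub>F j in sequentially. m1 * (a / b) ^ j < \<epsilon> * m0"
    using e m0 by (intro order_tendstoD(2)[where y="m1 * 0"]) auto
  then obtain j where j: "m1 * (a / b) ^ j < \<epsilon> * m0" by (auto simp: eventually_sequentially)
  have j': "m1 * a ^ j \<le> \<epsilon> * (m0 * b ^ j)"
    using j b by (simp add: power_divide field_simps)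
  define c where "c w = ((1 + cnj q * w) / 2) ^ j" for w
  define k where "k w = (if w \<in> ball 0 1 then c w else 0)" for w
  have c_cont: "continuous_on UNIV c" unfolding c_def by (intro continuous_intros) auto
  have csq: "(cmod (c w))\<^sup>2 = ((cmod ((1 + cnj q * w) / 2))\<^sup>2) ^ j" for w
    by (simp add: c_def norm_power power_mult[symmetric] mult.commute)
  have "continuous_on (ball 0 1) k"
    by (rule continuous_on_eq[OF continuous_on_subset[OF c_cont subset_UNIV]]) (simp add: k_def)
  then have m: "k \<in> borel_measurable borel"
    by (rule borel_measurable_open_support) (auto simp: k_def)
  have ball_int: "integrable lborel (indicator (ball x r) :: complex \<Rightarrow> real)" for x r
    using emeasure_lborel_ball_finite[of x r] by (intro integrable_real_indicator) auto
  have c1: "(cmod (c w))\<^sup>2 \<le> 1" if "w \<in> ball 0 1" for w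
  proof -
    have "(cmod ((1 + cnj q * w) / 2))\<^sup>2 \<le> 1"
      using peak_far_bound[OF q, of w 0] that by simp
    then show ?thesis unfolding csq by (rule power_le_one[OF zero_le_power2])
  qed
  have sq_int: "integrable lborel (\<lambda>w. (cmod (k w))\<^sup>2)"
  proof (rule Bochner_Integration.integrable_bound[OF ball_int[of 0 1]])
    show "(\<lambda>w. (cmod (k w))\<^sup>2) \<in> borel_measurable lborel" using m by simp
    show "AE w in lborel. norm ((cmod (k w))\<^sup>2) \<le> norm (indicat_real (ball 0 1) w)"
      using c1 by (auto simp: k_def indicator_def)
  qed
  then have L: "L2_fun lborel k" using m by (simp add: L2_fun_def)
  have "m0 * b ^ j = (LINT w|lborel. b ^ j * indicator ?P w)" by (simp add: m0_def)
  also have "\<dots> \<le> (norm_L2 lborel k)\<^sup>2"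
    unfolding norm_L2_sq
  proof (rule integral_mono[OF _ sq_int])
    show "integrable lborel (\<lambda>w. b ^ j * indicator ?P w :: real)" using ball_int by simp
    fix w
    show "b ^ j * indicator ?P w \<le> (cmod (k w))\<^sup>2"
    proof (cases "w \<in> ?P")
      case True
      then have w: "w \<in> ball 0 1" "dist w q \<le> \<eta>" using \<rho>(2) by (auto simp: dist_commute subset_iff less_imp_le)
      have "b \<le> (cmod ((1 + cnj q * w) / 2))\<^sup>2"
        unfolding b_def using peak_near_bound[OF q w(2)] \<eta> by (intro power_mono) auto
      then have "b ^ j \<le> (cmod (c w))\<^sup>2" unfolding csq using b by (intro power_mono) auto
      then show ?thesis using True w(1) by (simp add: k_def)
    qed simp
  qed
  finally have lower: "m0 * b ^ j \<le> (norm_L2 lborel k)\<^sup>2" .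
  moreover have "0 < m0 * b ^ j" using m0 b by simp
  ultimately have "norm_L2 lborel k \<noteq> 0" by auto
  then have pos: "norm_L2 lborel k > 0" by (simp add: less_le)
  let ?far = "\<lambda>w. if dist w q < \<delta> then 0 else k w"
  have fm: "?far \<in> borel_measurable borel" using m by measurable
  have "(norm_L2 lborel ?far)\<^sup>2 \<le> (LINT w|lborel. a ^ j * indicator (ball (0::complex) 1) w)"
    unfolding norm_L2_sq
  proof (rule integral_mono)
    show "integrable lborel (\<lambda>w. a ^ j * indicator (ball (0::complex) 1) w :: real)" using ball_int by simp
    show "integrable lborel (\<lambda>w. (cmod (?far w))\<^sup>2)"
      by (rule Bochner_Integration.integrable_bound[OF sq_int]) (use fm in auto)
    fix w
    show "(cmod (?far w))\<^sup>2 \<le> a ^ j * indicator (ball (0::complex) 1) w"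
    proof (cases "w \<in> ball 0 1 \<and> \<not> dist w q < \<delta>")
      case True
      then have "(cmod ((1 + cnj q * w) / 2))\<^sup>2 \<le> 1 - \<delta>\<^sup>2 / 4" using d by (intro peak_far_bound[OF q]) auto
      then have "(cmod (c w))\<^sup>2 \<le> a ^ j" unfolding csq a_def by (intro power_mono) auto
      then show ?thesis using True by (simp add: k_def)
    qed (use a in \<open>auto simp: k_def\<close>)
  qed
  also have "\<dots> = m1 * a ^ j" by (simp add: m1_def)
  also have "\<dots> \<le> \<epsilon> * (m0 * b ^ j)" by (rule j')
  also have "\<dots> \<le> \<epsilon> * (norm_L2 lborel k)\<^sup>2" using lower e by (intro mult_left_mono) auto
  finally have far: "(norm_L2 lborel ?far)\<^sup>2 \<le> \<epsilon> * (norm_L2 lborel k)\<^sup>2" .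
  have "c holomorphic_on ball 0 1" unfolding c_def by (intro holomorphic_intros) auto
  then have hol: "k holomorphic_on ball 0 1"
    by (rule holomorphic_transform) (simp add: k_def)
  show ?thesis by (rule that[OF hol m _ L pos far]) (simp add: k_def)
qed


section \<open>Localizing the symbol at a boundary point\<close>

lemma norm_append_zero: "norm (append_coord 0 w) = norm w"
  by (simp add: norm_eq_sqrt_inner inner_append_coord)

lemma dist_append_coord: "dist (append_coord z w) (append_coord z w') = dist w w'"
  by (simp add: dist_norm append_coord_diff norm_append_zero)

text \<open>
Boundary points \<open>(z, w)\<close> are approached radially, along \<open>(z, t w)\<close> with \<open>t < 1\<close>.
\<close>

lemma append_coord_in_closure_polydisc:
  assumes z: "z \<in> polydisc" and w: "cmod w \<le> 1"
  shows "append_coord z w \<in> closure polydisc"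
  unfolding closure_approachable
proof (intro allI impI)
  fix e :: real assume e: "e > 0"
  define t where "t = max 0 (1 - e / 2)"
  have t: "0 \<le> t" "t < 1" "1 - t < e" using e by (auto simp: t_def)
  have "t * cmod w < 1" using t w mult_left_mono[of "cmod w" 1 t] by simp
  then have "append_coord z (of_real t * w) \<in> polydisc"
    using z t by (simp add: append_coord_in_polydisc norm_mult)
  moreover have "dist (of_real t * w) w < e"
  proof -
    have "of_real t * w - w = of_real (t - 1) * w" by (simp add: algebra_simps)
    then have "dist (of_real t * w) w = \<bar>t - 1\<bar> * cmod w" unfolding dist_norm by (simp only: norm_mult norm_of_real)
    also have "\<dots> \<le> (1 - t) * 1" using t w by (intro mult_mono) auto
    finally show ?thesis using t by simp
  qed
  ultimately show "\<exists>y\<in>polydisc. dist y (append_coord z w) < e"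
    using dist_append_coord by metis
qed

lemma compact_closure_polydisc: "compact (closure (polydisc :: (complex ^ 'k) set))"
  using bounded_polydisc by (simp add: compact_closure)

lemma continuous_symbol_bound:
  fixes \<psi> :: "complex ^ 'k \<Rightarrow> complex"
  assumes "continuous_on (closure polydisc) \<psi>"
  obtains B where "0 \<le> B" "\<And>v. v \<in> closure polydisc \<Longrightarrow> cmod (\<psi> v) \<le> B"
proof -
  have "bounded (\<psi> ` closure polydisc)"
    using compact_continuous_image[OF assms compact_closure_polydisc] by (rule compact_imp_bounded)
  then obtain B where "B > 0" "\<forall>x\<in>\<psi> ` closure polydisc. norm x \<le> B" unfolding bounded_pos by (elim exE conjE)
  then show ?thesis by (intro that[of B]) auto
qed

lemma boundary_slice_continuous:
  fixes \<psi> :: "complex ^ ('m::finite) option \<Rightarrow> complex"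
  assumes "continuous_on (closure polydisc) \<psi>" "cmod q = 1"
  shows "continuous_on polydisc (\<lambda>z. \<psi> (append_coord z q))"
  by (rule continuous_on_compose2[OF assms(1)])
     (use assms(2) in \<open>auto intro!: continuous_on_append_coord continuous_intros append_coord_in_closure_polydisc\<close>)

lemma continuous_bounded_symbol:
  fixes \<phi> :: "complex ^ 'k \<Rightarrow> complex"
  assumes "continuous_on polydisc \<phi>" "\<And>v. v \<in> polydisc \<Longrightarrow> cmod (\<phi> v) \<le> B" "0 \<le> B"
  shows "bounded_symbol polydisc \<phi> B"
  using assms open_polydisc
  by unfold_locales (auto intro!: continuous_imp_measurable_on_sets_lebesgue)

lemma hankel_supported_on:
  assumes \<phi>: "bounded_symbol polydisc \<phi> B" "continuous_on polydisc \<phi>" and f: "f \<in> bergman_space polydisc"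
  shows "supported_on (hankel polydisc \<phi> f) polydisc"
proof -
  interpret bounded_symbol polydisc \<phi> B by (rule \<phi>)
  have "bergman_proj polydisc (\<lambda>z. \<phi> z * f z) \<in> bergman_space polydisc"
    by (rule bergman_proj(1)[OF open_polydisc mult_symbol(1)[OF bergman_spaceD(2)[OF f]]])
  then show ?thesis
    unfolding hankel_def
    by (intro supported_on_diff supported_on_continuous_mult bergman_space_supported_on open_polydisc \<phi> f)
qed

text \<open>
Near \<open>w = q\<close> uniform continuity makes \<open>\<psi>(z', w) - \<psi>(z', q)\<close> small, and away from \<open>q\<close> the factor \<open>k\<close> has
little mass while the difference is bounded by \<open>2 B\<close>. One \<open>k\<close> serves all \<open>F\<close>, which is needed because
the estimate will be applied both to \<open>f\<close> and to its image under the Hankel operator.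
\<close>

lemma peak_function_localizes_symbol:
  fixes \<psi> :: "complex ^ ('m::finite) option \<Rightarrow> complex"
  assumes \<psi>: "continuous_on (closure polydisc) \<psi>"
    and B: "0 \<le> B" "\<And>v. v \<in> closure polydisc \<Longrightarrow> cmod (\<psi> v) \<le> B"
    and q: "cmod q = 1" and \<kappa>: "\<kappa> > 0"
  obtains k where "k holomorphic_on ball 0 1" "supported_on k (ball 0 1)" "L2_fun lborel k" "norm_L2 lborel k > 0"
    "\<forall>F. supported_on F polydisc \<longrightarrow> L2_fun (lebesgue_on polydisc) F \<longrightarrow>
      L2_fun (lebesgue_on polydisc) (\<lambda>v. (\<psi> v - \<psi> (append_coord (drop_coord v) q)) * tensor F k v) \<and>
      norm_L2 (lebesgue_on polydisc) (\<lambda>v. (\<psi> v - \<psi> (append_coord (drop_coord v) q)) * tensor F k v)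
        \<le> \<kappa> * (norm_L2 (lebesgue_on polydisc) F * norm_L2 lborel k)"
proof -
  let ?M = "lebesgue_on (polydisc :: (complex ^ 'm option) set)"
  let ?d = "\<lambda>v. \<psi> v - \<psi> (append_coord (drop_coord v) q)"
  have "uniformly_continuous_on (closure polydisc) \<psi>"
    by (rule compact_uniformly_continuous[OF \<psi> compact_closure_polydisc])
  then obtain \<delta> where \<delta>: "\<delta> > 0"
    and uc: "\<And>v v'. v \<in> closure polydisc \<Longrightarrow> v' \<in> closure polydisc \<Longrightarrow> dist v' v < \<delta> \<Longrightarrow> dist (\<psi> v') (\<psi> v) < \<kappa> / 2"
    using half_gt_zero[OF \<kappa>] unfolding uniformly_continuous_on_def by blast
  \<comment> \<open>Small enough that the far part contributes at most \<open>(2 B)\<^sup>2 \<epsilon> \<le> \<kappa>\<^sup>2 / 4\<close>; adding 1 covers \<open>B = 0\<close>.\<close>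
  define \<epsilon> where "\<epsilon> = \<kappa>\<^sup>2 / (16 * (B\<^sup>2 + 1))"
  have B1: "0 < B\<^sup>2 + 1" by (simp add: add_nonneg_pos)
  have "\<epsilon> > 0" using \<kappa> B1 by (simp add: \<epsilon>_def)
  obtain k where k: "k holomorphic_on ball 0 1" "k \<in> borel_measurable borel" "\<And>w. w \<notin> ball 0 1 \<Longrightarrow> k w = 0"
    "L2_fun lborel k" "norm_L2 lborel k > 0"
    and kfar: "(norm_L2 lborel (\<lambda>w. if dist w q < \<delta> then 0 else k w))\<^sup>2 \<le> \<epsilon> * (norm_L2 lborel k)\<^sup>2"
    by (rule peak_function[OF q \<delta> \<open>\<epsilon> > 0\<close>]) (rule that; assumption)
  have sk: "supported_on k (ball 0 1)" using k by (simp add: supported_on_def)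
  let ?far = "\<lambda>w. if dist w q < \<delta> then 0 else k w"
  have "?far \<in> borel_measurable borel" using k(2) by measurable
  then have sfar: "supported_on ?far (ball 0 1)" using k(3) by (simp add: supported_on_def)
  have "?far = (\<lambda>w. (if dist w q < \<delta> then 0 else 1) * k w)" by auto
  then have Lfar: "L2_fun lborel ?far"
    using L2_fun_bounded_mult(1)[OF k(4), of "\<lambda>w. if dist w q < \<delta> then 0 else 1" 1] by simp
  have incl: "append_coord (drop_coord v) q \<in> closure polydisc" if "v \<in> polydisc" for v :: "complex ^ 'm option"
    using that q by (cases v rule: append_coord_cases)
      (auto simp: append_coord_in_polydisc intro!: append_coord_in_closure_polydisc)
  have "continuous_on polydisc ?d"
    using closure_subset q incl
    by (intro continuous_on_diff continuous_on_subset[OF \<psi>] continuous_on_compose2[OF \<psi>] continuous_on_append_coord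
        continuous_intros linear_continuous_on bounded_linear_drop_coord) auto
  then have dm: "?d \<in> borel_measurable ?M"
    by (intro continuous_imp_measurable_on_sets_lebesgue) (simp_all add: open_polydisc)
  have d2B: "cmod (?d v) \<le> 2 * B" if "v \<in> polydisc" for v
  proof -
    have "v \<in> closure polydisc" using that closure_subset by blast
    then show ?thesis
      using norm_triangle_ineq4[of "\<psi> v" "\<psi> (append_coord (drop_coord v) q)"] B(2)[OF incl[OF that]] B(2)[of v] by linarith
  qed
  have "L2_fun ?M (\<lambda>v. ?d v * tensor F k v) \<and>
      norm_L2 ?M (\<lambda>v. ?d v * tensor F k v) \<le> \<kappa> * (norm_L2 (lebesgue_on polydisc) F * norm_L2 lborel k)"
    if F: "supported_on F polydisc" "L2_fun (lebesgue_on polydisc) F" for F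
  proof
    let ?n = "norm_L2 (lebesgue_on polydisc) F"
    have T: "L2_fun ?M (tensor F k)" "norm_L2 ?M (tensor F k) = ?n * norm_L2 lborel k"
      by (rule tensor_L2[OF F sk k(4)])+
    have Tf: "L2_fun ?M (tensor F ?far)" "norm_L2 ?M (tensor F ?far) = ?n * norm_L2 lborel ?far"
      by (rule tensor_L2[OF F sfar Lfar])+
    show L: "L2_fun ?M (\<lambda>v. ?d v * tensor F k v)"
      by (rule L2_fun_bounded_mult(1)[OF T(1) dm]) (use d2B in simp)
    have pt: "(cmod (?d v * tensor F k v))\<^sup>2
        \<le> (\<kappa> / 2)\<^sup>2 * (cmod (tensor F k v))\<^sup>2 + (2 * B)\<^sup>2 * (cmod (tensor F ?far v))\<^sup>2" if v: "v \<in> polydisc" for v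
    proof (cases "dist (v $ None) q < \<delta>")
      case True
      have "dist v (append_coord (drop_coord v) q) < \<delta>"
        using True dist_append_coord[of "drop_coord v" "v $ None" q] by simp
      then have "dist (\<psi> v) (\<psi> (append_coord (drop_coord v) q)) < \<kappa> / 2"
        using incl[OF v] v closure_subset by (intro uc) auto
      then have "cmod (?d v) \<le> \<kappa> / 2" by (simp add: dist_norm)
      then have "(cmod (?d v * tensor F k v))\<^sup>2 \<le> (\<kappa> / 2)\<^sup>2 * (cmod (tensor F k v))\<^sup>2"
        unfolding norm_mult power_mult_distrib by (intro mult_right_mono power_mono) auto
      moreover have "0 \<le> (2 * B)\<^sup>2 * (cmod (tensor F ?far v))\<^sup>2" by simp
      ultimately show ?thesis by linarith
    next
      case False
      then have fe: "tensor F ?far v = tensor F k v" by (simp add: tensor_def)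
      have "(cmod (?d v * tensor F k v))\<^sup>2 \<le> (2 * B)\<^sup>2 * (cmod (tensor F k v))\<^sup>2"
        unfolding norm_mult power_mult_distrib[of "cmod (?d v)"]
        using d2B[OF v] by (intro mult_right_mono power_mono) auto
      moreover have "0 \<le> (\<kappa> / 2)\<^sup>2 * (cmod (tensor F k v))\<^sup>2" by simp
      ultimately show ?thesis unfolding fe by linarith
    qed
    have "(norm_L2 ?M (\<lambda>v. ?d v * tensor F k v))\<^sup>2
        \<le> (LINT v|?M. (\<kappa> / 2)\<^sup>2 * (cmod (tensor F k v))\<^sup>2 + (2 * B)\<^sup>2 * (cmod (tensor F ?far v))\<^sup>2)"
      unfolding norm_L2_sq
      by (rule integral_mono[OF L2_fun_integrable[OF L]])
         (use pt L2_fun_integrable[OF T(1)] L2_fun_integrable[OF Tf(1)] in auto)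
    also have "\<dots> = (\<kappa> / 2)\<^sup>2 * (norm_L2 ?M (tensor F k))\<^sup>2 + (2 * B)\<^sup>2 * (norm_L2 ?M (tensor F ?far))\<^sup>2"
      unfolding norm_L2_sq using L2_fun_integrable[OF T(1)] L2_fun_integrable[OF Tf(1)] by simp
    also have "\<dots> = ?n\<^sup>2 * ((\<kappa> / 2)\<^sup>2 * (norm_L2 lborel k)\<^sup>2 + (2 * B)\<^sup>2 * (norm_L2 lborel ?far)\<^sup>2)"
      unfolding T Tf by (simp add: power_mult_distrib algebra_simps)
    also have "\<dots> \<le> ?n\<^sup>2 * (\<kappa>\<^sup>2 * (norm_L2 lborel k)\<^sup>2)"
    proof (rule mult_left_mono)
      have "(2 * B)\<^sup>2 * \<epsilon> \<le> \<kappa>\<^sup>2 / 4"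
        using \<kappa> B1 by (simp add: \<epsilon>_def field_simps)
      then have "(2 * B)\<^sup>2 * \<epsilon> * (norm_L2 lborel k)\<^sup>2 \<le> \<kappa>\<^sup>2 / 4 * (norm_L2 lborel k)\<^sup>2" by (intro mult_right_mono) auto
      then have "(2 * B)\<^sup>2 * (\<epsilon> * (norm_L2 lborel k)\<^sup>2) \<le> \<kappa>\<^sup>2 * (norm_L2 lborel k)\<^sup>2 / 4" by (simp only: mult.assoc times_divide_eq_left)
      moreover have "(2 * B)\<^sup>2 * (norm_L2 lborel ?far)\<^sup>2 \<le> (2 * B)\<^sup>2 * (\<epsilon> * (norm_L2 lborel k)\<^sup>2)"
        using kfar by (intro mult_left_mono) auto
      moreover have "0 \<le> \<kappa>\<^sup>2 * (norm_L2 lborel k)\<^sup>2" by simp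
      moreover have "(\<kappa> / 2)\<^sup>2 * (norm_L2 lborel k)\<^sup>2 = \<kappa>\<^sup>2 * (norm_L2 lborel k)\<^sup>2 / 4" by (simp add: power_divide)
      ultimately show "(\<kappa> / 2)\<^sup>2 * (norm_L2 lborel k)\<^sup>2 + (2 * B)\<^sup>2 * (norm_L2 lborel ?far)\<^sup>2 \<le> \<kappa>\<^sup>2 * (norm_L2 lborel k)\<^sup>2"
        by linarith
    qed simp
    also have "\<dots> = (\<kappa> * (?n * norm_L2 lborel k))\<^sup>2" by (simp add: power_mult_distrib)
    finally show "norm_L2 ?M (\<lambda>v. ?d v * tensor F k v) \<le> \<kappa> * (?n * norm_L2 lborel k)"
      by (rule power2_le_imp_le) (use \<kappa> in simp)
  qed
  then show ?thesis by (intro that[OF k(1) sk k(4,5)] allI impI)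
qed

text \<open>
A bound for a pairing that is uniform over the Bergman space of the smaller polydisc is applied to
almost every slice of \<open>h\<close> and averaged against \<open>k\<close>, using the Cauchy-Schwarz inequality in the last
coordinate. With \<open>l = 0\<close> and \<open>c = 0\<close> it says that orthogonality to the Bergman space is inherited by products.
\<close>

lemma inner_L2_tensor_bound:
  fixes h :: "complex ^ ('m::finite) option \<Rightarrow> complex"
  assumes h: "h \<in> bergman_space polydisc"
    and F: "supported_on F polydisc" "L2_fun (lebesgue_on polydisc) F"
    and G: "supported_on G polydisc" "L2_fun (lebesgue_on polydisc) G"
    and k: "supported_on k (ball 0 1)" "L2_fun lborel k"
    and c: "\<And>u. u \<in> bergman_space polydisc \<Longrightarrow>
        cmod (inner_L2 (lebesgue_on polydisc) u F - l * inner_L2 (lebesgue_on polydisc) u G) \<le> c * norm_L2 (lebesgue_on polydisc) u"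
    and c0: "0 \<le> c"
  shows "cmod (inner_L2 (lebesgue_on polydisc) h (tensor F k) - l * inner_L2 (lebesgue_on polydisc) h (tensor G k))
    \<le> c * (norm_L2 lborel k * norm_L2 (lebesgue_on polydisc) h)"
proof -
  let ?D = "lebesgue_on (polydisc :: (complex ^ 'm) set)"
  let ?b = "\<lambda>w. cnj (k w) * inner_L2 ?D (slice h w) F - l * (cnj (k w) * inner_L2 ?D (slice h w) G)"
  let ?n = "\<lambda>w. complex_of_real (norm_L2 ?D (slice h w))"
  let ?k = "\<lambda>w. complex_of_real (cmod (k w))"
  have i: "integrable lborel ?b"
    by (intro Bochner_Integration.integrable_diff integrable_mult_right inner_L2_tensor(1)[OF h F k] inner_L2_tensor(1)[OF h G k])
  have kL: "L2_fun lborel ?k" using k(2) by (auto simp: L2_fun_def)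
  note nL = slice_bergman_space(2)[OF h]
  have i2: "integrable lborel (\<lambda>w. cmod (k w) * norm_L2 ?D (slice h w))"
    using integrable_Re[OF inner_L2_integrable[OF kL nL]] by simp
  have pointwise: "cmod (?b w) \<le> c * (cmod (k w) * norm_L2 ?D (slice h w))"
    if w: "slice h w \<in> bergman_space polydisc" for w
  proof -
    have "?b w = cnj (k w) * (inner_L2 ?D (slice h w) F - l * inner_L2 ?D (slice h w) G)"
      by (simp only: right_diff_distrib mult.left_commute[of l])
    then have "cmod (?b w) = cmod (k w) * cmod (inner_L2 ?D (slice h w) F - l * inner_L2 ?D (slice h w) G)"
      by (simp only: norm_mult complex_mod_cnj)
    also have "\<dots> \<le> cmod (k w) * (c * norm_L2 ?D (slice h w))"
      by (rule mult_left_mono[OF c[OF w] norm_ge_zero])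
    finally show ?thesis by (simp only: mult.left_commute[of c])
  qed
  have AEle: "AE w in lborel. cmod (?b w) \<le> c * (cmod (k w) * norm_L2 ?D (slice h w))"
    by (rule eventually_mono[OF slice_bergman_space(1)[OF h] pointwise])
  have eq: "inner_L2 (lebesgue_on polydisc) h (tensor F k) - l * inner_L2 (lebesgue_on polydisc) h (tensor G k) = (LINT w|lborel. ?b w)"
    unfolding inner_L2_tensor(2)[OF h F k] inner_L2_tensor(2)[OF h G k]
    using inner_L2_tensor(1)[OF h F k] inner_L2_tensor(1)[OF h G k] by simp
  have "cmod (inner_L2 (lebesgue_on polydisc) h (tensor F k) - l * inner_L2 (lebesgue_on polydisc) h (tensor G k))
      \<le> (LINT w|lborel. cmod (?b w))" unfolding eq by (rule integral_norm_bound)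
  also have "\<dots> \<le> (LINT w|lborel. c * (cmod (k w) * norm_L2 ?D (slice h w)))"
    by (rule integral_mono_AE[OF integrable_norm[OF i] integrable_mult_right[OF i2] AEle])
  also have "\<dots> = c * (LINT w|lborel. cmod (k w) * norm_L2 ?D (slice h w))" by simp
  also have "\<dots> \<le> c * (norm_L2 lborel ?k * norm_L2 lborel ?n)"
  proof (rule mult_left_mono[OF _ c0])
    have "inner_L2 lborel ?k ?n = of_real (LINT w|lborel. cmod (k w) * norm_L2 ?D (slice h w))"
      unfolding inner_L2_def by (simp flip: of_real_mult)
    then have "cmod (inner_L2 lborel ?k ?n) = \<bar>LINT w|lborel. cmod (k w) * norm_L2 ?D (slice h w)\<bar>" by simp
    then show "(LINT w|lborel. cmod (k w) * norm_L2 ?D (slice h w)) \<le> norm_L2 lborel ?k * norm_L2 lborel ?n"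
      using inner_L2_Cauchy_Schwarz[OF kL nL] by linarith
  qed
  also have "norm_L2 lborel ?n = norm_L2 (lebesgue_on polydisc) h" by (rule slice_bergman_space(3)[OF h])
  also have "norm_L2 lborel ?k = norm_L2 lborel k" by (simp add: norm_L2_def)
  finally show ?thesis .
qed


section \<open>Approximate eigenvectors and the essential spectrum\<close>

text \<open>
With \<open>g = f k\<close>, the vector \<open>h = (T - l) g\<close> is paired with itself. Replacing \<open>H g\<close> by
\<open>(H\<^sub>q f) k\<close> and then \<open>\<psi>\<close> by its boundary slice leaves three terms: \<open>X\<close>, the weak eigenvalue
equation of \<open>f\<close> averaged over slices of \<open>h\<close>, and the two replacement errors \<open>Z\<close> and \<open>Y\<close>. Each is at most a small
multiple of \<open>\<bar>g\<bar> \<bar>h\<bar>\<close>, and one factor \<open>\<bar>h\<bar>\<close> cancels.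
\<close>

lemma approximate_eigenvector:
  fixes \<psi> :: "complex ^ ('m::finite) option \<Rightarrow> complex"
  assumes \<psi>: "continuous_on (closure polydisc) \<psi>" and q: "cmod q = 1" and e: "e > 0"
  defines "l \<equiv> (hankel_norm (polydisc :: (complex ^ 'm) set) (\<lambda>z. \<psi> (append_coord z q)))\<^sup>2"
  shows "\<exists>g\<in>bergman_space polydisc. norm_L2 (lebesgue_on polydisc) g > 0 \<and>
    norm_L2 (lebesgue_on polydisc) (\<lambda>v. hankel_adjoint polydisc \<psi> (hankel polydisc \<psi> g) v - of_real l * g v)
      \<le> e * norm_L2 (lebesgue_on polydisc) g"
proof -
  obtain B where B: "0 \<le> B" "\<And>v. v \<in> closure polydisc \<Longrightarrow> cmod (\<psi> v) \<le> B"
    using continuous_symbol_bound[OF \<psi>] by (metis (no_types))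
  let ?q = "\<lambda>z. \<psi> (append_coord z q)"
  have q_cont: "continuous_on polydisc ?q" by (rule boundary_slice_continuous[OF \<psi> q])
  have \<psi>_cont: "continuous_on polydisc \<psi>" using \<psi> closure_subset by (rule continuous_on_subset)
  have E: "bounded_symbol polydisc \<psi> B"
    by (rule continuous_bounded_symbol[OF \<psi>_cont _ B(1)]) (use B(2) closure_subset in blast)
  have D: "bounded_symbol polydisc ?q B"
    by (rule continuous_bounded_symbol[OF q_cont _ B(1)])
       (use q in \<open>auto intro!: B(2) append_coord_in_closure_polydisc\<close>)
  interpret E: bounded_symbol "polydisc :: (complex ^ 'm option) set" \<psi> B by (rule E)
  interpret D: bounded_symbol "polydisc :: (complex ^ 'm) set" ?q B by (rule D)
  \<comment> \<open>Half of the error budget \<open>e\<close> is spent on \<open>X\<close>, half on \<open>Y\<close> and \<open>Z\<close>; adding 1 to \<open>s\<close> and to \<open>B\<close> avoids division by zero.\<close>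
  define \<epsilon> where "\<epsilon> = (e / (2 * (D.s + 1)))\<^sup>2"
  have s1: "D.s + 1 > 0" using D.hankel_norm_nonneg by linarith
  have \<epsilon>: "\<epsilon> > 0" using s1 e by (simp add: \<epsilon>_def)
  have sqrt\<epsilon>: "sqrt \<epsilon> * D.s \<le> e / 2"
  proof -
    have "sqrt \<epsilon> = e / (2 * (D.s + 1))" unfolding \<epsilon>_def real_sqrt_abs using s1 e by simp
    then have "sqrt \<epsilon> * D.s = e / 2 * (D.s / (D.s + 1))" by simp
    also have "\<dots> \<le> e / 2 * 1" using s1 e by (intro mult_left_mono) auto
    finally show ?thesis by simp
  qed
  obtain f where f: "f \<in> D.A2" "norm_L2 D.M f > 0"
    and near: "D.s\<^sup>2 * (norm_L2 D.M f)\<^sup>2 - (norm_L2 D.M (D.H f))\<^sup>2 \<le> \<epsilon> * (norm_L2 D.M f)\<^sup>2"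
    using D.hankel_near_maximizer[OF bergman_space_polydisc_nontrivial \<epsilon>] by blast
  define \<kappa> where "\<kappa> = e / (4 * (B + 1))"
  have \<kappa>: "\<kappa> > 0" "2 * B * \<kappa> \<le> e / 2" using e B(1) by (auto simp: \<kappa>_def field_simps)
  obtain k where k: "k holomorphic_on ball 0 1" "supported_on k (ball 0 1)" "L2_fun lborel k" "norm_L2 lborel k > 0"
    and localize': "\<forall>F. supported_on F polydisc \<longrightarrow> L2_fun D.M F \<longrightarrow>
      L2_fun E.M (\<lambda>v. (\<psi> v - ?q (drop_coord v)) * tensor F k v) \<and>
      norm_L2 E.M (\<lambda>v. (\<psi> v - ?q (drop_coord v)) * tensor F k v) \<le> \<kappa> * (norm_L2 D.M F * norm_L2 lborel k)"
  proof (rule peak_function_localizes_symbol[OF \<psi> B(1) _ q \<kappa>(1)])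
    show "cmod (\<psi> v) \<le> B" if "v \<in> closure polydisc" for v by (rule B(2)[OF that])
  qed (rule that; assumption)
  note localize = localize'[rule_format]
  define g where "g = tensor f k"
  have sf: "supported_on f polydisc" by (rule bergman_space_supported_on[OF open_polydisc f(1)])
  have g: "g \<in> E.A2" unfolding g_def by (rule tensor_bergman_space[OF f(1) k(1,2,3)])
  have gn: "norm_L2 E.M g = norm_L2 D.M f * norm_L2 lborel k"
    unfolding g_def by (rule tensor_L2(2)[OF sf bergman_spaceD(2)[OF f(1)] k(2,3)])
  let ?Hf = "D.H f"
  have sH: "supported_on ?Hf polydisc" by (rule hankel_supported_on[OF D q_cont f(1)])
  have HL: "L2_fun D.M ?Hf" by (rule D.hankel_L2[OF f(1)])
  let ?G = "tensor ?Hf k"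
  have GL: "L2_fun E.M ?G" by (rule tensor_L2(1)[OF sH HL k(2,3)])

  \<comment> \<open>First replacement: \<open>H g = (H\<^sub>q f) k + ?R\<close> with a small remainder \<open>?R\<close>.\<close>
  let ?\<Delta>1 = "\<lambda>v. (\<psi> v - ?q (drop_coord v)) * tensor f k v"
  have \<Delta>1: "L2_fun E.M ?\<Delta>1" "norm_L2 E.M ?\<Delta>1 \<le> \<kappa> * norm_L2 E.M g"
    using localize[OF sf bergman_spaceD(2)[OF f(1)]] gn by auto
  let ?qf = "\<lambda>z. ?q z * f z"
  have sqf: "supported_on ?qf polydisc"
    by (rule supported_on_continuous_mult[OF open_polydisc q_cont sf])
  have qfL: "L2_fun D.M ?qf" by (rule D.mult_symbol(1)[OF bergman_spaceD(2)[OF f(1)]])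
  \<comment> \<open>The projection of a product with the holomorphic factor \<open>k\<close> acts on the other factor alone.\<close>
  have "proj_residual polydisc (tensor ?qf k) = ?G"
  proof (rule proj_residual_eqI[OF open_polydisc])
    show "L2_fun E.M (tensor ?qf k)" by (rule tensor_L2(1)[OF sqf qfL k(2,3)])
    have "tensor (bergman_proj polydisc ?qf) k \<in> E.A2"
      by (rule tensor_bergman_space[OF bergman_proj(1)[OF open_polydisc qfL] k(1,2,3)])
    also have "tensor (bergman_proj polydisc ?qf) k = (\<lambda>v. tensor ?qf k v - ?G v)"
      by (auto simp: fun_eq_iff tensor_def hankel_def algebra_simps)
    finally show "(\<lambda>v. tensor ?qf k v - ?G v) \<in> E.A2" .
    fix h assume h: "h \<in> E.A2"
    have "cmod (inner_L2 E.M h ?G - 0 * inner_L2 E.M h ?G) \<le> 0 * (norm_L2 lborel k * norm_L2 E.M h)"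
      by (rule inner_L2_tensor_bound[OF h sH HL sH HL k(2,3)]) (simp_all add: D.hankel_orthogonal(2)[OF f(1)])
    then have "inner_L2 E.M h ?G = 0" by simp
    then show "inner_L2 E.M ?G h = 0" using inner_L2_cnj[of E.M h ?G] by simp
  qed
  moreover have "(\<lambda>v. \<psi> v * g v) = (\<lambda>v. tensor ?qf k v + 1 * ?\<Delta>1 v)"
    by (auto simp: fun_eq_iff g_def tensor_def algebra_simps)
  ultimately have "E.H g = (\<lambda>v. ?G v + 1 * proj_residual polydisc ?\<Delta>1 v)"
    unfolding hankel_eq_proj_residual[of _ \<psi>]
    using proj_residual_add_cmult[OF open_polydisc tensor_L2(1)[OF sqf qfL k(2,3)] \<Delta>1(1), of 1] by simp
  then have Hg: "E.H g = (\<lambda>v. ?G v + proj_residual polydisc ?\<Delta>1 v)" by simp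
  let ?R = "proj_residual polydisc ?\<Delta>1"
  have RL: "L2_fun E.M ?R" by (rule proj_residual_L2[OF open_polydisc \<Delta>1(1)])
  have Rn: "norm_L2 E.M ?R \<le> \<kappa> * norm_L2 E.M g"
    using proj_residual_norm_le[OF open_polydisc \<Delta>1(1)] \<Delta>1(2) by linarith

  \<comment> \<open>Second replacement: \<open>cnj \<psi>\<close> by the conjugate of its boundary slice, against \<open>(H\<^sub>q f) k\<close>.\<close>
  let ?\<Delta>2 = "\<lambda>v. cnj (\<psi> v - ?q (drop_coord v)) * ?G v"
  let ?\<Delta>2' = "\<lambda>v. (\<psi> v - ?q (drop_coord v)) * ?G v"
  let ?qH = "\<lambda>z. cnj (?q z) * ?Hf z"
  have sqH: "supported_on ?qH polydisc"
    by (rule supported_on_continuous_mult[OF open_polydisc _ sH]) (intro continuous_intros q_cont)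
  have qHL: "L2_fun D.M ?qH" by (rule D.mult_symbol(3)[OF HL])
  have TqH: "L2_fun E.M (tensor ?qH k)" by (rule tensor_L2(1)[OF sqH qHL k(2,3)])
  have psiG: "L2_fun E.M (\<lambda>v. cnj (\<psi> v) * ?G v)" by (rule E.mult_symbol(3)[OF GL])
  have psiR: "L2_fun E.M (\<lambda>v. cnj (\<psi> v) * ?R v)" by (rule E.mult_symbol(3)[OF RL])
  have split2: "?\<Delta>2 = (\<lambda>v. cnj (\<psi> v) * ?G v - tensor ?qH k v)"
    by (auto simp: fun_eq_iff tensor_def algebra_simps)
  have \<Delta>2L: "L2_fun E.M ?\<Delta>2" unfolding split2 by (rule L2_fun_diff[OF psiG TqH])
  have "norm_L2 E.M ?\<Delta>2 = norm_L2 E.M ?\<Delta>2'" by (simp add: norm_L2_def norm_mult flip: complex_cnj_diff)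
  also have "\<dots> \<le> \<kappa> * (norm_L2 D.M ?Hf * norm_L2 lborel k)" using localize[OF sH HL] by blast
  also have "\<dots> \<le> \<kappa> * ((B * norm_L2 D.M f) * norm_L2 lborel k)"
    using D.norm_hankel_le_symbol_bound[OF f(1)] \<kappa>(1) k(4) by (intro mult_left_mono mult_right_mono) auto
  finally have \<Delta>2n: "norm_L2 E.M ?\<Delta>2 \<le> B * \<kappa> * norm_L2 E.M g" by (simp add: gn mult_ac)

  define T where "T = hankel_adjoint polydisc \<psi> (E.H g)"
  have T: "T \<in> E.A2" "\<And>u. u \<in> E.A2 \<Longrightarrow> inner_L2 E.M u T = inner_L2 E.M (E.H u) (E.H g)"
    unfolding T_def using E.hankel_adjoint_hankel[OF g] by auto
  define h where "h = (\<lambda>v. T v - of_real l * g v)"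
  have lg: "(\<lambda>v. of_real l * g v) \<in> E.A2" by (rule bergman_space_cmult[OF g])
  have h: "h \<in> E.A2" unfolding h_def by (rule bergman_space_diff[OF T(1) lg])
  have hL: "L2_fun E.M h" by (rule bergman_spaceD(2)[OF h])
  define X where "X = inner_L2 E.M h (tensor ?qH k) - of_real l * inner_L2 E.M h g"
  define Y where "Y = inner_L2 E.M h ?\<Delta>2"
  define Z where "Z = inner_L2 E.M (\<lambda>v. \<psi> v * h v) ?R"
  have e1: "inner_L2 E.M h h = inner_L2 E.M h T - inner_L2 E.M h (\<lambda>v. of_real l * g v)"
    using inner_L2_diff_right[OF bergman_spaceD(2)[OF T(1)] bergman_spaceD(2)[OF lg] hL] by (simp only: h_def)
  have e2: "inner_L2 E.M h (\<lambda>v. of_real l * g v) = of_real l * inner_L2 E.M h g"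
    by (simp add: inner_L2_def mult.left_commute)
  have e3: "inner_L2 E.M h T = inner_L2 E.M h (\<lambda>v. cnj (\<psi> v) * E.H g v)"
    using T(2)[OF h] E.inner_L2_hankel_left[OF h g] by simp
  have Hg': "(\<lambda>v. cnj (\<psi> v) * E.H g v) = (\<lambda>v. cnj (\<psi> v) * ?G v + 1 * (cnj (\<psi> v) * ?R v))"
    unfolding Hg by (simp add: distrib_left)
  have e4: "inner_L2 E.M h (\<lambda>v. cnj (\<psi> v) * E.H g v) = inner_L2 E.M h (\<lambda>v. cnj (\<psi> v) * ?G v) + Z"
    unfolding Hg' inner_L2_add_right[OF psiG psiR hL] Z_def E.inner_L2_mult_symbol by simp
  have G': "(\<lambda>v. cnj (\<psi> v) * ?G v) = (\<lambda>v. tensor ?qH k v + 1 * ?\<Delta>2 v)"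
    by (auto simp: fun_eq_iff tensor_def algebra_simps)
  have e5: "inner_L2 E.M h (\<lambda>v. cnj (\<psi> v) * ?G v) = inner_L2 E.M h (tensor ?qH k) + Y"
    unfolding G' inner_L2_add_right[OF TqH \<Delta>2L hL] Y_def by simp
  have main: "inner_L2 E.M h h = X + Y + Z"
    unfolding e1 e2 e3 e4 e5 X_def by simp

  have X: "cmod X \<le> (sqrt \<epsilon> * D.s * norm_L2 D.M f) * (norm_L2 lborel k * norm_L2 E.M h)"
    unfolding X_def g_def
  proof (rule inner_L2_tensor_bound[OF h sqH qHL sf bergman_spaceD(2)[OF f(1)] k(2,3)])
    show "cmod (inner_L2 D.M u ?qH - of_real l * inner_L2 D.M u f) \<le> sqrt \<epsilon> * D.s * norm_L2 D.M f * norm_L2 D.M u"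
      if u: "u \<in> D.A2" for u
      using D.near_maximizer_weak_eigenvector[OF f(1) u less_imp_le[OF \<epsilon>] near]
      unfolding D.inner_L2_hankel_left[OF u f(1)] l_def .
    show "0 \<le> sqrt \<epsilon> * D.s * norm_L2 D.M f" using \<epsilon> D.hankel_norm_nonneg by simp
  qed
  also have "\<dots> = (sqrt \<epsilon> * D.s) * (norm_L2 E.M g * norm_L2 E.M h)" by (simp add: gn mult_ac)
  also have "\<dots> \<le> e / 2 * (norm_L2 E.M g * norm_L2 E.M h)"
    using sqrt\<epsilon> by (intro mult_right_mono) auto
  finally have X': "cmod X \<le> e / 2 * (norm_L2 E.M g * norm_L2 E.M h)" .
  have "cmod Y \<le> norm_L2 E.M h * norm_L2 E.M ?\<Delta>2"
    unfolding Y_def by (rule inner_L2_Cauchy_Schwarz[OF hL \<Delta>2L])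
  also have "\<dots> \<le> norm_L2 E.M h * (B * \<kappa> * norm_L2 E.M g)" using \<Delta>2n by (intro mult_left_mono) auto
  finally have Y: "cmod Y \<le> (B * \<kappa>) * (norm_L2 E.M g * norm_L2 E.M h)" by (simp add: mult_ac)
  have "cmod Z \<le> norm_L2 E.M (\<lambda>v. \<psi> v * h v) * norm_L2 E.M ?R"
    unfolding Z_def by (rule inner_L2_Cauchy_Schwarz[OF E.mult_symbol(1)[OF hL] RL])
  also have "\<dots> \<le> (B * norm_L2 E.M h) * (\<kappa> * norm_L2 E.M g)"
    using E.mult_symbol(2)[OF hL] Rn B(1) by (intro mult_mono) auto
  finally have Z: "cmod Z \<le> (B * \<kappa>) * (norm_L2 E.M g * norm_L2 E.M h)" by (simp add: mult_ac)
  have "(norm_L2 E.M h)\<^sup>2 = cmod (X + Y + Z)" unfolding main[symmetric] inner_L2_self norm_of_real by simp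
  also have "\<dots> \<le> cmod X + cmod Y + cmod Z" using norm_triangle_ineq[of "X + Y" Z] norm_triangle_ineq[of X Y] by linarith
  also have "\<dots> \<le> (e / 2 + 2 * B * \<kappa>) * (norm_L2 E.M g * norm_L2 E.M h)" using X' Y Z by (simp add: algebra_simps)
  also have "\<dots> \<le> e * (norm_L2 E.M g * norm_L2 E.M h)" using \<kappa>(2) by (intro mult_right_mono) auto
  finally have "norm_L2 E.M h * norm_L2 E.M h \<le> (e * norm_L2 E.M g) * norm_L2 E.M h" by (simp add: power2_eq_square mult.assoc)
  then have "norm_L2 E.M h \<le> e * norm_L2 E.M g"
    using e by (cases "norm_L2 E.M h = 0") (auto simp: mult_le_cancel_right less_le)
  moreover have "norm_L2 E.M g > 0" using gn f(2) k(4) by simp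
  ultimately show ?thesis
    using g unfolding h_def T_def by blast
qed

text \<open>
A bounded inverse of \<open>T - \<mu>\<close> would bound the norm of \<open>g\<close> by a multiple of the norm of its image.
\<close>

lemma approximate_eigenvalue_in_spectrum:
  assumes shift: "\<And>f. f \<in> V \<Longrightarrow> shifted_operator T \<mu> f \<in> V"
    and approx: "\<And>e. e > 0 \<Longrightarrow> \<exists>g\<in>V. N g > (0::real) \<and> N (shifted_operator T \<mu> g) \<le> e * N g"
    and N: "\<And>f. N f \<ge> 0"
  shows "\<mu> \<in> spectrum_on N V T"
  unfolding spectrum_on_def
proof (rule CollectI, rule notI)
  assume "\<exists>S. bounded_operator_on N V S \<and> (\<forall>f\<in>V. S (shifted_operator T \<mu> f) = f \<and> shifted_operator T \<mu> (S f) = f)"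
  then obtain S C where S: "\<And>f. f \<in> V \<Longrightarrow> S (shifted_operator T \<mu> f) = f" and C: "\<And>f. f \<in> V \<Longrightarrow> N (S f) \<le> C * N f"
    unfolding bounded_operator_on_def by blast
  have "1 / (2 * (\<bar>C\<bar> + 1)) > 0" by simp
  from approx[OF this] obtain g where g: "g \<in> V" "N g > 0"
    and le: "N (shifted_operator T \<mu> g) \<le> 1 / (2 * (\<bar>C\<bar> + 1)) * N g" by blast
  have "N g \<le> C * N (shifted_operator T \<mu> g)" using C[OF shift[OF g(1)]] S[OF g(1)] by simp
  also have "\<dots> \<le> (\<bar>C\<bar> + 1) * N (shifted_operator T \<mu> g)" using N by (intro mult_right_mono) auto
  also have "\<dots> \<le> (\<bar>C\<bar> + 1) * (1 / (2 * (\<bar>C\<bar> + 1)) * N g)" using le by (intro mult_left_mono) auto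
  also have "\<dots> = N g / 2" by (simp add: field_simps)
  finally show False using g(2) by simp
qed

lemma boundary_slice_norm_in_spectrum:
  fixes \<psi> :: "complex ^ ('m::finite) option \<Rightarrow> complex"
  assumes \<psi>: "continuous_on (closure polydisc) \<psi>" and q: "cmod q = 1"
  shows "complex_of_real ((hankel_norm (polydisc :: (complex ^ 'm) set) (\<lambda>z. \<psi> (append_coord z q)))\<^sup>2)
    \<in> spectrum_on (L2_norm_on polydisc) (bergman_space polydisc) (hankel_adjoint polydisc \<psi> \<circ> hankel polydisc \<psi>)"
proof (rule approximate_eigenvalue_in_spectrum)
  obtain B where B: "0 \<le> B" "\<And>v. v \<in> closure polydisc \<Longrightarrow> cmod (\<psi> v) \<le> B"
    using continuous_symbol_bound[OF \<psi>] by (metis (no_types))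
  have "bounded_symbol polydisc \<psi> B"
    by (rule continuous_bounded_symbol[OF continuous_on_subset[OF \<psi> closure_subset] _ B(1)])
       (use B(2) closure_subset in blast)
  then interpret E: bounded_symbol "polydisc :: (complex ^ 'm option) set" \<psi> B .
  show "shifted_operator (hankel_adjoint polydisc \<psi> \<circ> hankel polydisc \<psi>) \<mu> f \<in> bergman_space polydisc"
    if "f \<in> bergman_space polydisc" for f and \<mu>
    unfolding shifted_operator_def comp_def
    by (intro bergman_space_diff bergman_space_cmult E.hankel_adjoint_hankel(1) that)
qed (use approximate_eigenvector[OF \<psi> q] in \<open>simp_all add: shifted_operator_def L2_norm_on_eq\<close>)

lemma boundary_slice_norm_continuous:
  fixes \<psi> :: "complex ^ ('m::finite) option \<Rightarrow> complex"
  assumes \<psi>: "continuous_on (closure polydisc) \<psi>"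
  shows "continuous_on (sphere 0 1) (\<lambda>q. hankel_norm (polydisc :: (complex ^ 'm) set) (\<lambda>z. \<psi> (append_coord z q)))"
  unfolding continuous_on_iff
proof (intro ballI allI impI)
  fix q :: complex and e :: real assume q: "q \<in> sphere 0 1" and e: "e > 0"
  obtain B where B: "0 \<le> B" "\<And>v. v \<in> closure polydisc \<Longrightarrow> cmod (\<psi> v) \<le> B"
    using continuous_symbol_bound[OF \<psi>] by (metis (no_types))
  have sym: "bounded_symbol (polydisc :: (complex ^ 'm) set) (\<lambda>z. \<psi> (append_coord z q)) B" if "q \<in> sphere 0 1" for q
    using that by (intro continuous_bounded_symbol boundary_slice_continuous[OF \<psi>] B append_coord_in_closure_polydisc) auto
  have "uniformly_continuous_on (closure polydisc) \<psi>"
    by (rule compact_uniformly_continuous[OF \<psi> compact_closure_polydisc])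
  then obtain d where d: "d > 0"
    and uc: "\<And>v v'. v \<in> closure polydisc \<Longrightarrow> v' \<in> closure polydisc \<Longrightarrow> dist v' v < d \<Longrightarrow> dist (\<psi> v') (\<psi> v) < e / 2"
    using half_gt_zero[OF e] unfolding uniformly_continuous_on_def by blast
  have "dist (hankel_norm (polydisc :: (complex ^ 'm) set) (\<lambda>z. \<psi> (append_coord z p)))
     (hankel_norm (polydisc :: (complex ^ 'm) set) (\<lambda>z. \<psi> (append_coord z q))) < e"
    if p: "p \<in> sphere 0 1" "dist p q < d" for p
  proof -
    have "\<bar>hankel_norm (polydisc :: (complex ^ 'm) set) (\<lambda>z. \<psi> (append_coord z p)) -
      hankel_norm (polydisc :: (complex ^ 'm) set) (\<lambda>z. \<psi> (append_coord z q))\<bar> \<le> e / 2"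
    proof (rule hankel_norm_perturb[OF sym[OF p(1)] sym[OF q]])
      fix z :: "complex ^ 'm" assume "z \<in> polydisc"
      then have "dist (\<psi> (append_coord z p)) (\<psi> (append_coord z q)) < e / 2"
        using p q by (intro uc append_coord_in_closure_polydisc) (auto simp: dist_append_coord)
      then show "cmod (\<psi> (append_coord z p) - \<psi> (append_coord z q)) \<le> e / 2" by (simp add: dist_norm)
    qed (use e in simp)
    then show ?thesis using e by (simp add: dist_real_def)
  qed
  then show "\<exists>d>0. \<forall>p\<in>sphere 0 1. dist p q < d \<longrightarrow>
      dist (hankel_norm (polydisc :: (complex ^ 'm) set) (\<lambda>z. \<psi> (append_coord z p)))
        (hankel_norm (polydisc :: (complex ^ 'm) set) (\<lambda>z. \<psi> (append_coord z q))) < e"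
    using d by blast
qed

text \<open>
Points of the discrete spectrum are isolated in the spectrum; points of an interval inside the
spectrum are not.
\<close>

lemma open_interval_in_essential_spectrum:
  assumes "complex_of_real ` {a<..<b} \<subseteq> spectrum_on N V T"
  shows "complex_of_real ` {a<..<b} \<subseteq> essential_spectrum_on N V T"
proof -
  have "\<not> complex_of_real x isolated_in spectrum_on N V T" if x: "x \<in> {a<..<b}" for x
  proof
    assume "complex_of_real x isolated_in spectrum_on N V T"
    then obtain e where e: "e > 0" and iso: "\<And>y. y \<in> spectrum_on N V T \<Longrightarrow> dist (of_real x) y < e \<Longrightarrow> y = of_real x"
      unfolding isolated_in_dist_Ex_iff by blast
    obtain y where "x < y" "y < min b (x + e)" using dense[of x "min b (x + e)"] x e by auto
    then have y: "y \<in> {a<..<b}" "y \<noteq> x" "\<bar>x - y\<bar> < e" using x by auto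
    have "dist (complex_of_real x) (of_real y) < e"
      using y(3) by (simp add: dist_norm flip: of_real_diff)
    then have "complex_of_real y = of_real x" using y(1) assms by (intro iso) auto
    then show False using y(2) by simp
  qed
  then show ?thesis using assms by (auto simp: essential_spectrum_on_def discrete_spectrum_on_def)
qed

theorem theorem2:
  fixes \<psi> :: "complex ^ ('m::finite) option \<Rightarrow> complex"
  assumes "continuous_on (closure polydisc) \<psi>"
    and "\<not> (\<lambda>q. hankel_norm (polydisc :: (complex ^ 'm) set) (\<lambda>z'. \<psi> (append_coord z' q)))
             constant_on sphere 0 1"
  shows "\<exists>a b :: real. a < b \<and>
           complex_of_real ` {a<..<b} \<subseteq>
             essential_spectrum_on (L2_norm_on polydisc) (bergman_space polydisc)
               (hankel_adjoint polydisc \<psi> \<circ> hankel polydisc \<psi>)"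
proof -
  let ?s = "\<lambda>q. hankel_norm (polydisc :: (complex ^ 'm) set) (\<lambda>z'. \<psi> (append_coord z' q))"
  let ?\<sigma> = "spectrum_on (L2_norm_on polydisc) (bergman_space polydisc) (hankel_adjoint polydisc \<psi> \<circ> hankel polydisc \<psi>)"
  obtain p q where pq: "p \<in> sphere 0 1" "q \<in> sphere 0 1" "?s p < ?s q"
  proof -
    have "\<exists>q\<in>sphere 0 1. ?s q \<noteq> ?s 1" using assms(2) unfolding constant_on_def by blast
    then obtain q where "q \<in> sphere 0 1" "?s q \<noteq> ?s 1" by blast
    then show ?thesis using that[of 1 q] that[of q 1] by (cases "?s q < ?s 1") auto
  qed
  obtain B where B: "0 \<le> B" "\<And>v. v \<in> closure polydisc \<Longrightarrow> cmod (\<psi> v) \<le> B"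
    using continuous_symbol_bound[OF assms(1)] by (metis (no_types))
  have "bounded_symbol (polydisc :: (complex ^ 'm) set) (\<lambda>z. \<psi> (append_coord z p)) B"
    using pq(1) by (intro continuous_bounded_symbol boundary_slice_continuous[OF assms(1)] B append_coord_in_closure_polydisc) auto
  then have "0 \<le> ?s p" by (rule bounded_symbol.hankel_norm_nonneg)
  then have lt: "(?s p)\<^sup>2 < (?s q)\<^sup>2" using pq(3) by (intro power_strict_mono) auto
  have "connected ((\<lambda>q. (?s q)\<^sup>2) ` sphere 0 1)"
    by (intro connected_continuous_image continuous_on_power boundary_slice_norm_continuous assms(1) connected_sphere) simp
  then have attained: "{(?s p)\<^sup>2..(?s q)\<^sup>2} \<subseteq> (\<lambda>q. (?s q)\<^sup>2) ` sphere 0 1"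
    by (rule connected_contains_Icc) (use pq in auto)
  have "complex_of_real ` {(?s p)\<^sup>2<..<(?s q)\<^sup>2} \<subseteq> ?\<sigma>"
  proof (rule image_subsetI)
    fix x assume "x \<in> {(?s p)\<^sup>2<..<(?s q)\<^sup>2}"
    then have "x \<in> {(?s p)\<^sup>2..(?s q)\<^sup>2}" by simp
    with attained have "x \<in> (\<lambda>q. (?s q)\<^sup>2) ` sphere 0 1" by (rule subsetD)
    then obtain r where r: "r \<in> sphere 0 1" and x: "x = (?s r)\<^sup>2" by (rule imageE)
    show "complex_of_real x \<in> ?\<sigma>"
      unfolding x by (rule boundary_slice_norm_in_spectrum[OF assms(1)]) (use r in simp)
  qed
  from open_interval_in_essential_spectrum[OF this] lt show ?thesis by blast
qed

end
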